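(* For $z > 0$ and $k \ge 1$ let \[ \gamma_k(z) = \sum_{n :\, \Omega(n) = k} \frac{z^{k}}{n (\log n)^z}. \] Let \[ G(z) = \frac{1}{\Gamma(1+z)} \prod_p \Bigl(1 - \frac{z}{p}\Bigr)^{-1}\Bigl(1 - \frac{1}{p}\Bigr)^z, \qquad d_w = 2^{-w}\prod_{p > 2}\Bigl(1 - \frac{w}{p}\Bigr)^{-1}\Bigl(1 - \frac{1}{p}\Bigr)^w, \] with products over primes, and let $\gamma$ be the Euler–Mascheroni constant. Let $\varepsilon > 0$. Then, as $k \to \infty$, with implied constants in the $O_\varepsilon$-terms depending only on $\varepsilon$: \begin{itemize} \item for $z \in [\varepsilon, 1-\varepsilon]$: \[ \gamma_k(z) = G(z) + \Bigl(\frac{z}{z+1}\Bigr)^k \frac{2 d_{z+1}}{\Gamma(z)(1-z)}\Bigl(\gamma - \frac{z\log 2}{1-z} - \sum_{p>2}\frac{z \log p}{(p-1)(p-z-1)}\Bigr) + O_\varepsilon\Bigl(\Bigl(\frac{z}{2}\Bigr)^k k^{2-z}\Bigr); \] \item $\gamma_k(1) = 1 - 2^{-k}\frac{d_2}{4}(\log 2)\bigl(k^2 - 4k\log k + O(k\sqrt{\log k})\bigr)$; \item for $z \in [1+\varepsilon, 2-\varepsilon]$: $\gamma_k(z) = G(z) + O_\varepsilon\bigl((z/2)^k k^{2-z}\bigr)$; \item $\gamma_k(2) = \frac{d_2}{2}\bigl(k - 2\log k + O(\sqrt{\log k})\bigr)$. \end{itemize} Moreover, for any $0 < \varepsilon <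 1$, uniformly in $z \in (0, 2-\varepsilon]$, \[ \gamma_k(z) = G(z) + O_\varepsilon\Bigl(\Bigl(1 - \frac{\varepsilon}{2}\Bigr)^k k^{\varepsilon}\Bigr). \]
   Context: $\Omega(n)$ denotes the number of prime divisors of $n$ counted with multiplicity; $p$ always denotes a prime. *)

theory Defs
  imports "HOL-Analysis.Analysis" "HOL-Computational_Algebra.Computational_Algebra"
    "HOL-Library.Landau_Symbols"
begin

definition bigomega :: "nat \<Rightarrow> nat" where
  "bigomega n = size (prime_factorization n)"

text \<open>Since \<^term>\<open>bigomega 0 = 0\<close> and \<^term>\<open>bigomega 1 = 0\<close>, for \<open>k \<ge> 1\<close> the sum below
  ranges over integers \<open>n \<ge> 2\<close> only, so that \<open>ln n > 0\<close>.\<close>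

definition erdos_gamma :: "nat \<Rightarrow> real \<Rightarrow> real" where
  "erdos_gamma k z =
     (\<Sum>\<^sub>\<infinity>n\<in>{n. bigomega n = k}. z ^ k / (real n * ln (real n) powr z))"

text \<open>Products over primes are written as \<^const>\<open>prodinf\<close> with factor 1 at the other indices.
  They converge to a nonzero limit whenever no factor has a zero denominator; this covers
  \<open>G_fun\<close> for \<open>0 < z < 2\<close> and \<open>d_fun\<close> for \<open>0 < w < 3\<close>.\<close>

definition G_fun :: "real \<Rightarrow> real" where
  "G_fun z = 1 / Gamma (1 + z) *
     (\<Prod>p. if prime p
           then inverse (1 - z / real p) * (1 - 1 / real p) powr z else 1)"

definition d_fun :: "real \<Rightarrow> real" where
  "d_fun w = 2 powr (- w) *
     (\<Prod>p. if prime p \<and> p > 2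
           then inverse (1 - w / real p) * (1 - 1 / real p) powr w else 1)"

end

theory Submission
  imports Defs "HOL-Complex_Analysis.Complex_Analysis" "HOL-Real_Asymp.Real_Asymp"
begin

text \<open>Put \<open>P\<^sub>k(s) = (\<Sum>\<Omega>(n) = k. n powr - s)\<close>. Then \<open>\<Gamma>(z) z powr - k \<gamma>\<^sub>k(z)\<close> is the Mellin integral
  of \<open>P\<^sub>k(1 + t)\<close>, and \<open>(\<Sum>k. P\<^sub>k(s) w ^ k)\<close> is the product of \<open>inverse (1 - w p powr - s)\<close> over
  all primes \<open>p\<close>. For \<open>s = 1 + t\<close> this product equals \<open>t powr - w * A(t, w) / (1 - w 2 powr - s)\<close>,
  where \<open>A(t, w) = A\<^sub>0(w) + t A\<^sub>1(w) + O(t\<^sup>2)\<close> uniformly for \<open>\<bar>w\<bar> \<le> 5 / 2\<close>; by Cauchy's inequality the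
  Taylor coefficients in \<open>w\<close> have the same expansion. Only real \<open>s > 1\<close> is needed, so
  \<open>t \<zeta>(1 + t) = 1 + \<gamma> t + O(t\<^sup>2)\<close> is the sole analytic input on \<open>\<zeta>\<close>. Cutting the integral at \<open>t = 1 / k\<close>
  and majorising all power series in \<open>w\<close> coefficientwise gives an error \<open>O(k powr (2 - z) / 2 ^ k)\<close>.
  The two main terms come from the poles at \<open>w = z\<close> and \<open>w = z + 1\<close>; when one of these collides
  with the pole \<open>w = 2\<close> of the factor at \<open>p = 2\<close>, they turn into truncated Poisson sums of mean
  \<open>2 ln k\<close>.\<close>

section \<open>Almost primes and the recurrence for their zeta sums\<close>

text \<open>Two orders in t are what the error requires. After scaling by 2^k the factor t^-w
  contributes the weights (2 ln (1/t))^m / m!, of total mass t^-2. A remainder of size t^2 (n + 1)^2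
  in the n-th coefficient thus becomes O(k^2) uniformly in t, and integrating t^(z - 1) k^2 over (0,
  1/k) gives k^(2 - z) / z. The poles w = z and w = z + 1 come up to 2, so the regularised product
  has to be controlled beyond |w| = 2, whereas the prime 3 limits it to |w| < 3. The radii used are
  2 < 5/2 < 11/4 < 3: passing from 3 to 11/4 pays for the factor m left by differentiating p^(-m(1 +
  t)) in t, passing from 11/4 to 5/2 makes the logarithm bounded, so that it can be exponentiated,
  and Cauchy's inequality at 5/2 leaves the ratio 4/5 at w = 2. Identities between generating
  functions are proved formally, from uniqueness for F' = H F, which avoids branches of
  logarithms.\<close>

definition almost_primes :: "nat \<Rightarrow> nat set" where
  "almost_primes k = {n. n > 0 \<and> bigomega n = k}"

definition almost_prime_zeta :: "nat \<Rightarrow> real \<Rightarrow> real" where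
  "almost_prime_zeta k s = (\<Sum>\<^sub>\<infinity>n\<in>almost_primes k. real n powr (- s))"

definition odd_primes :: "nat set" where
  "odd_primes = {p. prime p \<and> p > 2}"

definition odd_prime_zeta :: "real \<Rightarrow> real" where
  "odd_prime_zeta s = (\<Sum>\<^sub>\<infinity>p\<in>odd_primes. real p powr (- s))"

lemma bigomega_prime_power_mult:
  assumes "prime p" "m > 0"
  shows "bigomega (p ^ i * m) = i + bigomega m"
  using assms by (simp add: bigomega_def prime_factorization_mult prime_factorization_prime_power)

lemma prime_power_divisors_Sigma:
  fixes n :: nat
  assumes "n > 0"
  shows "{(p, i). prime p \<and> i \<ge> 1 \<and> p ^ i dvd n} =
         (SIGMA p:prime_factors n. {1..multiplicity p n})"
proof (safe, goal_cases)
  case (1 p i)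
  have "p dvd n" using 1 dvd_trans[OF dvd_power[of i p]] by auto
  thus ?case using 1 assms by (auto simp: in_prime_factors_iff)
next
  case (2 p i)
  have "n \<noteq> 0" "\<not> is_unit p" using assms 2 by (auto simp: prime_gt_Suc_0_nat)
  thus ?case using 2 by (simp add: multiplicity_geI)
next
  case (3 p i)
  thus ?case by auto
next
  case (4 p i)
  thus ?case by auto
next
  case (5 p i)
  thus ?case by (meson atLeastAtMost_iff multiplicity_dvd')
qed

text \<open>A prime p contributes one pair for each of its \<open>multiplicity p n\<close> powers
  dividing n, which adds up to the count with multiplicity. This produces the factor k on the left
  of \<open>almost_prime_zeta_recurrence\<close>.\<close>

lemma prime_power_divisors:
  fixes n :: nat
  assumes "n > 0"
  shows "finite {(p, i). prime p \<and> i \<ge> 1 \<and> p ^ i dvd n}"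
    and "card {(p, i). prime p \<and> i \<ge> 1 \<and> p ^ i dvd n} = bigomega n"
proof -
  show "finite {(p, i). prime p \<and> i \<ge> 1 \<and> p ^ i dvd n}"
    unfolding prime_power_divisors_Sigma[OF assms] by auto
  have "card (SIGMA p:prime_factors n. {1..multiplicity p n}) =
        (\<Sum>p\<in>prime_factors n. multiplicity p n)"
    by simp
  also have "\<dots> = bigomega n"
    unfolding bigomega_def size_multiset_overloaded_eq
    by (intro sum.cong) (auto simp: count_prime_factorization_prime in_prime_factors_imp_prime)
  finally show "card {(p, i). prime p \<and> i \<ge> 1 \<and> p ^ i dvd n} = bigomega n"
    by (simp only: prime_power_divisors_Sigma[OF assms])
qed

lemma summable_on_nat_powr:
  assumes "s > 1"
  shows "(\<lambda>n. real n powr (- s)) summable_on A"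
proof -
  have "summable (\<lambda>n. real n powr (- s))"
    using assms by (simp add: summable_real_powr_iff)
  hence "(\<lambda>n. real n powr (- s)) summable_on UNIV"
    by (subst summable_on_UNIV_nonneg_real_iff) auto
  thus ?thesis by (rule summable_on_subset_banach) auto
qed

lemma almost_primes_0: "almost_primes 0 = {1}"
  by (auto simp: almost_primes_def bigomega_def prime_factorization_empty_iff)

lemma almost_prime_zeta_0: "almost_prime_zeta 0 s = 1"
  by (simp add: almost_prime_zeta_def almost_primes_0)

lemma almost_prime_zeta_has_sum:
  assumes "s > 1"
  shows "((\<lambda>n. real n powr (- s)) has_sum almost_prime_zeta k s) (almost_primes k)"
  unfolding almost_prime_zeta_def using summable_on_nat_powr[OF assms] by (rule has_sum_infsum)

definition prime_zeta :: "real \<Rightarrow> real" where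
  "prime_zeta s = (\<Sum>\<^sub>\<infinity>p\<in>{p. prime p}. real p powr (- s))"

lemma prime_zeta_has_sum:
  assumes "s > 1"
  shows "((\<lambda>n. real n powr (- s)) has_sum prime_zeta s) {p. prime p}"
  unfolding prime_zeta_def using summable_on_nat_powr[OF assms] by (rule has_sum_infsum)

lemma odd_prime_zeta_has_sum:
  assumes "s > 1"
  shows "((\<lambda>n. real n powr (- s)) has_sum odd_prime_zeta s) odd_primes"
  unfolding odd_prime_zeta_def using summable_on_nat_powr[OF assms] by (rule has_sum_infsum)

lemma prime_zeta_split:
  assumes "s > 1"
  shows "prime_zeta s = 2 powr (- s) + odd_prime_zeta s"
proof -
  have eq: "{p. prime p} = insert (2::nat) odd_primes"
    by (auto simp: odd_primes_def dest: prime_ge_2_nat)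
  have "((\<lambda>n. real n powr (- s)) has_sum (real 2 powr (- s) + odd_prime_zeta s)) (insert 2 odd_primes)"
    by (rule has_sum_insert[OF _ odd_prime_zeta_has_sum[OF assms]]) (simp add: odd_primes_def)
  from has_sum_unique[OF this prime_zeta_has_sum[OF assms, unfolded eq]] show ?thesis by simp
qed

text \<open>Counting the pairs of an \<open>n\<close> with \<open>\<Omega>(n) = k\<close> and a prime power dividing it in two ways;
  this is Newton's identity for the complete homogeneous symmetric functions of the \<open>p\<^sup>-\<^sup>s\<close>.\<close>

lemma almost_prime_zeta_recurrence:
  assumes s: "s > 1"
  shows "real k * almost_prime_zeta k s =
         (\<Sum>i=1..k. prime_zeta (real i * s) * almost_prime_zeta (k - i) s)"
proof -
  define D :: "nat \<Rightarrow> (nat \<times> nat) set"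
    where "D = (\<lambda>n. {(p, i). prime p \<and> i \<ge> 1 \<and> p ^ i dvd n})"
  define T where "T = (SIGMA n:almost_primes k. D n)"
  define T' :: "(nat \<times> nat \<times> nat) set"
    where "T' = (SIGMA i:{1..k}. {p. prime p} \<times> almost_primes (k - i))"
  define f :: "nat \<times> nat \<times> nat \<Rightarrow> real" where "f = (\<lambda>(n, p, i). real n powr (- s))"
  define f' :: "nat \<times> nat \<times> nat \<Rightarrow> real"
    where "f' = (\<lambda>(i, p, m). real p powr (- (real i * s)) * real m powr (- s))"
  have fib: "((\<lambda>y. f (n, y)) has_sum (real k * real n powr (- s))) (D n)" if "n \<in> almost_primes k" for n
  proof -
    have n: "n > 0" "bigomega n = k" using that by (auto simp: almost_primes_def)
    have "((\<lambda>y. f (n, y)) has_sum (\<Sum>y\<in>D n. f (n, y))) (D n)"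
      unfolding D_def by (rule has_sum_finite[OF prime_power_divisors(1)[OF n(1)]])
    also have "(\<Sum>y\<in>D n. f (n, y)) = real (card (D n)) * real n powr (- s)"
      by (simp add: f_def)
    also have "card (D n) = k"
      unfolding D_def using prime_power_divisors(2)[OF n(1)] n(2) by simp
    finally show ?thesis .
  qed
  have sumT: "(f has_sum (real k * almost_prime_zeta k s)) T"
    unfolding T_def
  proof (rule has_sum_SigmaI[OF fib])
    show g: "((\<lambda>n. real k * real n powr (- s)) has_sum real k * almost_prime_zeta k s) (almost_primes k)"
      by (intro has_sum_cmult_right almost_prime_zeta_has_sum s)
    show "f summable_on Sigma (almost_primes k) D"
      by (rule summable_on_SigmaI[OF fib has_sum_imp_summable[OF g]]) (auto simp: f_def)
  qed
  have fib': "((\<lambda>y. f' (i, y)) has_sum (prime_zeta (real i * s) * almost_prime_zeta (k - i) s))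
               ({p. prime p} \<times> almost_primes (k - i))" if i: "i \<in> {1..k}" for i
  proof -
    have is1: "real i * s > 1" using i s by (auto intro!: order.strict_trans2[OF s])
    have a: "((\<lambda>m. f' (i, p, m)) has_sum real p powr (- (real i * s)) * almost_prime_zeta (k - i) s)
            (almost_primes (k - i))" for p
      unfolding f'_def by (auto intro!: has_sum_cmult_right almost_prime_zeta_has_sum s)
    have b: "((\<lambda>p. real p powr (- (real i * s)) * almost_prime_zeta (k - i) s) has_sum
            prime_zeta (real i * s) * almost_prime_zeta (k - i) s) {p. prime p}"
      by (intro has_sum_cmult_left prime_zeta_has_sum is1)
    show ?thesis
      by (rule has_sum_SigmaI[OF a b], rule summable_on_SigmaI[OF a has_sum_imp_summable[OF b]])
         (auto simp: f'_def)
  qed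
  have sumT': "(f' has_sum (\<Sum>i=1..k. prime_zeta (real i * s) * almost_prime_zeta (k - i) s)) T'"
    unfolding T'_def
  proof (rule has_sum_SigmaI[OF fib'])
    show "f' summable_on (SIGMA i:{1..k}. {p. prime p} \<times> almost_primes (k - i))"
      by (rule summable_on_SigmaI[OF fib']) (auto simp: f'_def intro!: summable_on_finite)
  qed (auto intro!: has_sum_finite)
  \<comment> \<open>The triple (n, p, i) corresponds to (i, p, m) with n = p^i m. The cofactor has
    \<open>bigomega m = k - i\<close>, and n^-s splits as p^(-is) m^-s.\<close>
  have "(f has_sum S) T \<longleftrightarrow> (f' has_sum S) T'" for S
  proof (rule has_sum_reindex_bij_witness[where j = "\<lambda>(n, p, i). (i, p, n div p ^ i)"
        and i = "\<lambda>(i, p, m). (p ^ i * m, p, i)"])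
    fix a assume a: "a \<in> T"
    obtain n p i where [simp]: "a = (n, p, i)" by (cases a)
    have h: "n > 0" "bigomega n = k" "prime p" "i \<ge> 1" "p ^ i dvd n"
      using a by (auto simp: T_def D_def almost_primes_def)
    then obtain m where m: "n = p ^ i * m" by auto
    have p0: "p > 0" using h prime_gt_0_nat by auto
    have m0: "m > 0" using m h by (cases m) auto
    have dv: "n div p ^ i = m" using m p0 by simp
    have O: "i + bigomega m = k" using bigomega_prime_power_mult[OF h(3) m0, of i] h m by simp
    show "(\<lambda>(i, p, m). (p ^ i * m, p, i)) ((\<lambda>(n, p, i). (i, p, n div p ^ i)) a) = a"
      using m dv by simp
    show "(\<lambda>(n, p, i). (i, p, n div p ^ i)) a \<in> T'"
      using dv O m0 h by (auto simp: T'_def almost_primes_def)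
    have "real p powr (- (real i * s)) = (real p powr real i) powr (- s)"
      by (simp add: powr_powr)
    also have "\<dots> = (real p ^ i) powr (- s)" using p0 by (simp add: powr_realpow)
    finally show "f' ((\<lambda>(n, p, i). (i, p, n div p ^ i)) a) = f a"
      using dv m0 p0 by (simp add: f_def f'_def m powr_mult)
  next
    fix b assume b: "b \<in> T'"
    obtain i p m where [simp]: "b = (i, p, m)" by (cases b)
    have h: "prime p" "1 \<le> i" "i \<le> k" "m > 0" "bigomega m = k - i"
      using b by (auto simp: T'_def almost_primes_def)
    have p0: "p > 0" using h prime_gt_0_nat by auto
    show "(\<lambda>(n, p, i). (i, p, n div p ^ i)) ((\<lambda>(i, p, m). (p ^ i * m, p, i)) b) = b"
      using p0 by simp
    show "(\<lambda>(i, p, m). (p ^ i * m, p, i)) b \<in> T"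
      using h p0 by (auto simp: T_def D_def almost_primes_def bigomega_prime_power_mult)
  qed simp
  from this[of "real k * almost_prime_zeta k s"] sumT sumT' show ?thesis
    by (auto dest: has_sum_unique)
qed

text \<open>Every positive integer lies in exactly one of the sets \<open>almost_primes k\<close>.
  This evaluates the generating function at w = 1 and is the link between almost primes and the zeta
  series.\<close>

lemma almost_prime_zeta_sums_zeta:
  assumes s: "s > 1" 
  shows "(\<lambda>k. almost_prime_zeta k s) sums (\<Sum>n. real (Suc n) powr (- s))"
proof -
  have bij: "bij_betw snd (SIGMA k:UNIV. almost_primes k) {0<..}"
    by (rule bij_betwI[of _ _ _ "\<lambda>n. (bigomega n, n)"]) (auto simp: almost_primes_def)
  have "((\<lambda>n. real n powr (- s)) has_sum (\<Sum>\<^sub>\<infinity>n\<in>{0<..}. real n powr (- s))) {0<..}"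
    by (rule has_sum_infsum[OF summable_on_nat_powr[OF s]])
  hence "((\<lambda>x. real (snd x) powr (- s)) has_sum (\<Sum>\<^sub>\<infinity>n\<in>{0<..}. real n powr (- s))) 
          (SIGMA k:UNIV. almost_primes k)"
    using has_sum_reindex_bij_betw[OF bij, of "\<lambda>n. real n powr (- s)"] by simp
  hence *: "((\<lambda>k. almost_prime_zeta k s) has_sum (\<Sum>\<^sub>\<infinity>n\<in>{0<..}. real n powr (- s))) UNIV"
    by (rule has_sum_SigmaD) (simp add: almost_prime_zeta_has_sum[OF s])
  have **: "(\<Sum>\<^sub>\<infinity>n\<in>{0<..}. real n powr (- s)) = (\<Sum>n. real (Suc n) powr (- s))"
  proof -
    have "(\<Sum>\<^sub>\<infinity>n\<in>{0<..}. real n powr (- s)) = (\<Sum>\<^sub>\<infinity>n\<in>UNIV. real (Suc n) powr (- s))"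
      by (rule infsum_reindex_bij_witness[where i = Suc and j = "\<lambda>n. n - 1"]) auto
    also have "\<dots> = (\<Sum>n. real (Suc n) powr (- s))"
    proof -
      have "summable (\<lambda>n. real (Suc n) powr (- s))"
        using s summable_real_powr_iff[of "-s"] summable_Suc_iff[of "\<lambda>n. real n powr (-s)"] by simp
      hence "(\<lambda>n. real (Suc n) powr (- s)) summable_on UNIV"
        by (subst summable_on_UNIV_nonneg_real_iff) auto
      from has_sum_imp_sums[OF has_sum_infsum[OF this]] show ?thesis by (simp add: sums_iff)
    qed
    finally show ?thesis .
  qed
  show ?thesis using has_sum_imp_sums[OF *] unfolding ** .
qed

section \<open>The generating function\<close>

text \<open>Comparing coefficients in F' = H F determines coefficient n + 1 from the earlier ones,
  division by n + 1 being possible in characteristic 0. Exponential and product formulas are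
  verified below by checking logarithmic derivatives.\<close>

lemma fps_linear_ode_unique:
  fixes F G H :: "'a :: field_char_0 fps"
  assumes F: "fps_deriv F = H * F" and G: "fps_deriv G = H * G" and "F $ 0 = G $ 0"
  shows "F = G"
proof (rule fps_ext)
  fix n show "F $ n = G $ n"
  proof (induction n rule: less_induct)
    case (less n)
    show ?case
    proof (cases n)
      case (Suc m)
      have "fps_deriv F $ m = fps_deriv G $ m"
        unfolding F G fps_mult_nth using Suc by (intro sum.cong refl) (simp add: less)
      hence "of_nat (Suc m) * F $ Suc m = of_nat (Suc m) * G $ Suc m"
        by (simp del: of_nat_Suc)
      thus ?thesis unfolding Suc by (simp del: of_nat_Suc)
    qed (use assms in auto)
  qed
qed

section \<open>Geometric power series and lower bounds for radii of convergence\<close>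

definition fps_geometric :: "'a :: field \<Rightarrow> 'a fps" where
  "fps_geometric c = Abs_fps (\<lambda>n. c ^ n)"

lemma fps_geometric_nth [simp]: "fps_geometric c $ n = c ^ n"
  by (simp add: fps_geometric_def)

lemma fps_geometric_mult: "(1 - fps_const c * fps_X) * fps_geometric c = 1"
proof (rule fps_ext)
  fix n show "((1 - fps_const c * fps_X) * fps_geometric c) $ n = 1 $ n"
    by (cases n) (simp_all add: left_diff_distrib mult.assoc)
qed

lemma fps_deriv_geometric:
  fixes c :: "'a :: field"
  shows "fps_deriv (fps_geometric c) = fps_const c * fps_geometric c * fps_geometric c"
proof -
  let ?g = "fps_geometric c"
  have 1: "?g * (1 - fps_const c * fps_X) = 1" by (subst mult.commute) (rule fps_geometric_mult)
  have "fps_deriv ((1 - fps_const c * fps_X) * ?g) = 0"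
    by (subst fps_geometric_mult) simp
  hence "(1 - fps_const c * fps_X) * fps_deriv ?g = fps_const c * ?g"
    by (simp add: algebra_simps)
  hence "?g * (1 - fps_const c * fps_X) * fps_deriv ?g = ?g * (fps_const c * ?g)"
    by (simp add: mult.assoc)
  thus ?thesis unfolding 1 by (simp add: mult_ac)
qed

lemma fps_geometric_has_fps_expansion:
  "(\<lambda>w. inverse (1 - c * w :: complex)) has_fps_expansion fps_geometric c"
proof -
  have "(\<lambda>w. inverse (1 - c * w)) has_fps_expansion inverse (1 - fps_const c * fps_X)"
    by (intro fps_expansion_intros) auto
  also have "inverse (1 - fps_const c * fps_X) = fps_geometric c"
    using fps_geometric_mult[of c] by (intro fps_inverse_unique)
  finally show ?thesis .
qed

lemma fps_conv_radius_geI: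
  fixes F :: "complex fps"
  assumes bd: "\<And>n. norm (F $ n) \<le> K * (1 / \<rho>) ^ n" and "\<rho> > 0"
  shows "fps_conv_radius F \<ge> ereal \<rho>"
  unfolding fps_conv_radius_def
proof (rule conv_radius_geI_ex')
  fix r :: real assume r: "0 < r" "ereal r < ereal \<rho>"
  show "summable (\<lambda>n. F $ n * of_real r ^ n)"
  proof (rule summable_comparison_test')
    show "summable (\<lambda>n. K * (r / \<rho>) ^ n)"
      using r assms(2) by (intro summable_mult summable_geometric) auto
    show "norm (F $ n * of_real r ^ n) \<le> K * (r / \<rho>) ^ n" if "n \<ge> 0" for n
    proof -
      have "norm (F $ n * of_real r ^ n) \<le> (K * (1 / \<rho>) ^ n) * r ^ n"
        using r by (auto simp: norm_mult norm_power intro!: mult_right_mono bd)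
      thus ?thesis by (simp add: power_divide)
    qed
  qed
qed

lemma odd_prime_zeta_nonneg: "odd_prime_zeta s \<ge> 0"
  unfolding odd_prime_zeta_def by (rule infsum_nonneg) simp

text \<open>Odd primes are at least 3 and s > 1, so each of the m - 1 additional factors p^-s is at
  most 1/3. This is where the radius 3 in w comes from.\<close>

lemma odd_prime_zeta_mult_le:
  assumes s: "s > 1" and m: "m \<ge> 1"
  shows "odd_prime_zeta (real m * s) \<le> 3 * odd_prime_zeta s * (1 / 3) ^ m"
proof -
  have ms: "real m * s > 1" using m s by (auto intro!: order.strict_trans2[OF s])
  have "odd_prime_zeta (real m * s) \<le> (1/3) ^ (m - 1) * odd_prime_zeta s"
  proof (rule has_sum_mono[OF odd_prime_zeta_has_sum[OF ms] has_sum_cmult_right[OF odd_prime_zeta_has_sum[OF s]]])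
    fix p assume "p \<in> odd_primes"
    hence p: "real p \<ge> 3" by (auto simp: odd_primes_def)
    have "real (m - 1) \<le> real (m - 1) * s" using s by (simp add: mult_le_cancel_left1)
    hence "real p powr (- (real (m - 1) * s)) \<le> real p powr (- real (m - 1))"
      using p by (intro powr_mono) auto
    also have "\<dots> \<le> 3 powr (- real (m - 1))"
      using p by (intro powr_mono2') auto
    also have "\<dots> = (1/3) ^ (m - 1)"
      by (simp add: powr_minus powr_realpow power_divide inverse_eq_divide)
    finally have 1: "real p powr (- (real (m - 1) * s)) \<le> (1/3) ^ (m - 1)" .
    have "real p powr (- (real m * s)) = real p powr (- (real (m - 1) * s)) * real p powr (- s)"
      using m by (simp add: powr_add[symmetric] of_nat_diff algebra_simps)
    also have "\<dots> \<le> (1/3) ^ (m - 1) * real p powr (- s)"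
      by (intro mult_right_mono 1) auto
    finally show "real p powr (- (real m * s)) \<le> (1/3) ^ (m - 1) * real p powr (- s)" .
  qed
  also have "(1/3 :: real) ^ (m - 1) = 3 * (1/3) ^ m"
    using m by (cases m) auto
  finally show ?thesis by (simp add: mult_ac)
qed

text \<open>The series in w of minus the sum of log (1 - w p^-s) over p > 2. Division by
  \<open>real 0\<close> yields 0, which gives the constant coefficient the value needed for
  composition with exp.\<close>

definition odd_log_fps :: "real \<Rightarrow> complex fps" where
  "odd_log_fps s = Abs_fps (\<lambda>m. of_real (odd_prime_zeta (real m * s) / real m))"

lemma odd_log_fps_conv_radius:
  assumes "s > 1"
  shows "fps_conv_radius (odd_log_fps s) \<ge> 3"
proof -
  have "norm (odd_log_fps s $ m) \<le> (3 * odd_prime_zeta s) * (1 / 3) ^ m" for m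
  proof (cases "m = 0")
    case False
    hence "odd_prime_zeta (real m * s) / real m \<le> odd_prime_zeta (real m * s) / 1"
      using odd_prime_zeta_nonneg by (intro divide_left_mono) auto
    hence "odd_prime_zeta (real m * s) / real m \<le> odd_prime_zeta (real m * s)" by simp
    also have "\<dots> \<le> 3 * odd_prime_zeta s * (1 / 3) ^ m"
      using False by (intro odd_prime_zeta_mult_le assms) auto
    finally show ?thesis
      using odd_prime_zeta_nonneg[of "real m * s"] 
      by (simp add: odd_log_fps_def norm_divide del: of_real_divide of_real_power)
  qed (use odd_prime_zeta_nonneg[of s] in \<open>simp add: odd_log_fps_def\<close>)
  hence "fps_conv_radius (odd_log_fps s) \<ge> ereal 3"
    by (intro fps_conv_radius_geI) auto
  thus ?thesis by simp
qed

lemma odd_log_fps_expansion: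
  assumes "s > 1"
  shows "eval_fps (odd_log_fps s) has_fps_expansion odd_log_fps s"
proof -
  have "(0::ereal) < 3" by simp
  also note odd_log_fps_conv_radius[OF assms]
  finally show ?thesis by (rule eval_fps_has_fps_expansion)
qed

text \<open>Both sides satisfy F' = H F, where the coefficients of H are the prime zeta sums at
  multiples of s. For the left side this is the recurrence; for the right side H is split into the
  contributions of 2 and of the odd primes.\<close>

lemma almost_prime_zeta_fps:
  assumes s: "s > 1"
  shows "Abs_fps (\<lambda>k. of_real (almost_prime_zeta k s)) =
         (fps_exp 1 oo odd_log_fps s) * fps_geometric (of_real (2 powr - s))"
proof (rule fps_linear_ode_unique)
  define c :: complex where "c = of_real (2 powr - s)"
  define H :: "complex fps" where "H = Abs_fps (\<lambda>i. of_real (prime_zeta (real (Suc i) * s)))"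
  let ?L = "odd_log_fps s"
  have H: "H = fps_deriv ?L + fps_const c * fps_geometric c"
  proof (rule fps_ext)
    fix n
    have ns: "real (Suc n) * s > 1" using s by (auto intro!: order.strict_trans2[OF s])
    have "2 powr (- (real (Suc n) * s)) = (2 powr - s) powr real (Suc n)"
      by (simp add: powr_powr mult.commute)
    also have "\<dots> = (2 powr - s) ^ Suc n" by (rule powr_realpow) simp
    finally have "prime_zeta (real (Suc n) * s) = (2 powr - s) ^ Suc n + odd_prime_zeta (real (Suc n) * s)"
      by (simp only: prime_zeta_split[OF ns])
    moreover have "fps_deriv ?L $ n = of_real (odd_prime_zeta (real (Suc n) * s))"
    proof -
      have "fps_deriv ?L $ n = of_real (real (Suc n) * (odd_prime_zeta (real (Suc n) * s) / real (Suc n)))"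
        by (simp add: odd_log_fps_def del: of_nat_Suc)
      thus ?thesis by (simp del: of_nat_Suc)
    qed
    ultimately show "H $ n = (fps_deriv ?L + fps_const c * fps_geometric c) $ n"
      by (simp add: H_def c_def del: of_nat_Suc)
  qed
  show "fps_deriv (Abs_fps (\<lambda>k. of_real (almost_prime_zeta k s))) =
        H * Abs_fps (\<lambda>k. complex_of_real (almost_prime_zeta k s))"
  proof (rule fps_ext)
    fix n
    have "real (Suc n) * almost_prime_zeta (Suc n) s =
          (\<Sum>i=1..Suc n. prime_zeta (real i * s) * almost_prime_zeta (Suc n - i) s)"
      by (rule almost_prime_zeta_recurrence[OF s])
    also have "\<dots> = (\<Sum>i=0..n. prime_zeta (real (Suc i) * s) * almost_prime_zeta (n - i) s)"
      by (simp only: One_nat_def sum.atLeast_Suc_atMost_Suc_shift o_def diff_Suc_Suc)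
    finally have "of_real (real (Suc n) * almost_prime_zeta (Suc n) s) =
       complex_of_real (\<Sum>i=0..n. prime_zeta (real (Suc i) * s) * almost_prime_zeta (n - i) s)"
      by (rule arg_cong)
    thus "fps_deriv (Abs_fps (\<lambda>k. of_real (almost_prime_zeta k s))) $ n =
        (H * Abs_fps (\<lambda>k. complex_of_real (almost_prime_zeta k s))) $ n"
      by (simp add: fps_mult_nth H_def)
  qed
  have "fps_deriv ((fps_exp 1 oo ?L) * fps_geometric c) =
        H * ((fps_exp 1 oo ?L) * fps_geometric c)"
    unfolding H by (simp add: fps_compose_deriv fps_deriv_geometric odd_log_fps_def algebra_simps)
  thus "fps_deriv ((fps_exp 1 oo ?L) * fps_geometric (of_real (2 powr - s))) =
        H * ((fps_exp 1 oo ?L) * fps_geometric (of_real (2 powr - s)))"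
    unfolding c_def .
qed (simp add: almost_prime_zeta_0)

lemma almost_prime_zeta_expansion:
  assumes s: "s > 1"
  shows "(\<lambda>w. exp (eval_fps (odd_log_fps s) w) * inverse (1 - of_real (2 powr - s) * w))
           has_fps_expansion Abs_fps (\<lambda>k. of_real (almost_prime_zeta k s))"
proof -
  have "(exp \<circ> eval_fps (odd_log_fps s)) has_fps_expansion (fps_exp 1 oo odd_log_fps s)"
    by (intro has_fps_expansion_compose odd_log_fps_expansion s has_fps_expansion_exp1) 
       (simp add: odd_log_fps_def)
  from has_fps_expansion_mult[OF this fps_geometric_has_fps_expansion[of "of_real (2 powr - s)"]]
  show ?thesis unfolding almost_prime_zeta_fps[OF s] by (simp add: o_def)
qed

text \<open>The Euler product at w = 1. The formal identity only concerns germs at 0; it extends to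
  w = 1 because the exponential is analytic for |w| < 3 and the pole of the factor at 2 lies at w =
  2^s > 2.\<close>

lemma zeta_eq_exp:
  assumes s: "s > 1"
  shows "(\<Sum>n. real (Suc n) powr (- s)) * (1 - 2 powr - s) =
         exp (\<Sum>m. odd_prime_zeta (real m * s) / real m)"
proof -
  let ?f = "\<lambda>w. exp (eval_fps (odd_log_fps s) w) * inverse (1 - of_real (2 powr - s) * w)"
  let ?F = "Abs_fps (\<lambda>k. complex_of_real (almost_prime_zeta k s))"
  have c: "2 powr - s < 1 / 2"
  proof -
    have "2 powr - s < 2 powr - 1" using s by (intro powr_less_mono) auto
    thus ?thesis by (simp add: powr_minus)
  qed
  have r: "ereal (norm w) < fps_conv_radius (odd_log_fps s)" if "norm w < 2" for w :: complex
  proof -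
    have "ereal (norm w) < ereal 3" using that by simp
    also have "\<dots> \<le> fps_conv_radius (odd_log_fps s)" using odd_log_fps_conv_radius[OF s] by simp
    finally show ?thesis .
  qed
  have nz: "1 - of_real (2 powr - s) * w \<noteq> 0" if "norm w < 2" for w :: complex
  proof
    assume "1 - of_real (2 powr - s) * w = 0"
    hence "norm (of_real (2 powr - s) * w) = 1" by simp
    hence "2 powr - s * norm w = 1" by (simp add: norm_mult)
    moreover have "2 powr - s * norm w < 1/2 * 2"
      using c that by (intro mult_strict_mono) auto
    ultimately show False by simp
  qed
  have "?f holomorphic_on ball 0 2"
    by (intro holomorphic_intros) (use r nz in auto)
  from has_fps_expansion_imp_eval_fps_eq[OF almost_prime_zeta_expansion[OF s] _ this, of 1]
  have "eval_fps ?F 1 = ?f 1" by simp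
  moreover have "eval_fps ?F 1 = of_real (\<Sum>k. almost_prime_zeta k s)"
    unfolding eval_fps_def using sums_summable[OF almost_prime_zeta_sums_zeta[OF s]]
    by (simp add: suminf_of_real)
  moreover have "(\<Sum>k. almost_prime_zeta k s) = (\<Sum>n. real (Suc n) powr (- s))"
    using almost_prime_zeta_sums_zeta[OF s] by (simp add: sums_iff)
  moreover have "eval_fps (odd_log_fps s) 1 = of_real (\<Sum>m. odd_prime_zeta (real m * s) / real m)"
  proof -
    have "summable (\<lambda>n. odd_log_fps s $ n * 1 ^ n)"
      by (rule summable_fps) (use r[of 1] in auto)
    hence "summable (\<lambda>n. complex_of_real (odd_prime_zeta (real n * s) / real n))"
      by (simp add: odd_log_fps_def)
    hence "summable (\<lambda>n. odd_prime_zeta (real n * s) / real n)"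
      by (subst (asm) summable_complex_of_real)
    from suminf_of_real[OF this, where 'a = complex] show ?thesis
      by (simp add: eval_fps_def odd_log_fps_def)
  qed
  ultimately have "complex_of_real (\<Sum>n. real (Suc n) powr (- s)) =
     of_real (exp (\<Sum>m. odd_prime_zeta (real m * s) / real m) * inverse (1 - 2 powr - s))"
    by (simp add: exp_of_real)
  hence "(\<Sum>n. real (Suc n) powr (- s)) = exp (\<Sum>m. odd_prime_zeta (real m * s) / real m) * inverse (1 - 2 powr - s)"
    by (simp only: of_real_eq_iff)
  moreover have "1 - 2 powr - s \<noteq> 0" using c by linarith
  ultimately show ?thesis by (simp only: mult.assoc left_inverse mult_1_right simp_thms not_False_eq_True)
qed

section \<open>Expansion of the zeta function near 1\<close>

lemma exp_minus_Taylor_bounds: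
  fixes y :: real
  assumes "y \<ge> 0"
  shows "0 \<le> exp (- y) - 1 + y" "exp (- y) - 1 + y \<le> y\<^sup>2 / 2"
proof -
  show "0 \<le> exp (- y) - 1 + y" using exp_ge_add_one_self[of "- y"] by linarith
  have pos: "1 + y + y\<^sup>2 / 2 > 0" using assms by (simp add: add_pos_nonneg)
  \<comment> \<open>The reciprocal of the quadratic lower bound for exp y is at most 1 - y + y^2 /
    2, because the product of the two quadratics is 1 + y^4 / 4.\<close>
  have "exp (- y) \<le> 1 / (1 + y + y\<^sup>2 / 2)"
    using exp_lower_Taylor_quadratic[OF assms] pos
    by (simp add: exp_minus inverse_eq_divide frac_le)
  also have "\<dots> \<le> 1 - y + y\<^sup>2 / 2"
  proof -
    have "(1 - y + y\<^sup>2 / 2) * (1 + y + y\<^sup>2 / 2) = 1 + (y\<^sup>2)\<^sup>2 / 4"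
      by (simp add: algebra_simps power2_eq_square)
    hence "1 \<le> (1 - y + y\<^sup>2 / 2) * (1 + y + y\<^sup>2 / 2)" by simp
    thus ?thesis using pos by (simp add: pos_divide_le_eq)
  qed
  finally show "exp (- y) - 1 + y \<le> y\<^sup>2 / 2" by simp
qed

text \<open>Follows from x - x^2 \<le> ln (1 + x) \<le> x. As t \<le> 1, the hypothesis gives x
  \<le> (|c| + K) t, whose square accounts for the additional constant.\<close>

lemma ln_one_plus_first_order:
  fixes x c K t :: real
  assumes x: "x \<ge> 0" and t: "0 < t" "t \<le> 1" and K: "\<bar>x - c * t\<bar> \<le> K * t\<^sup>2"
  shows "\<bar>ln (1 + x) - c * t\<bar> \<le> (K + (\<bar>c\<bar> + K)\<^sup>2) * t\<^sup>2"
proof -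
  have "0 \<le> K * t\<^sup>2" using K abs_ge_zero order_trans by blast
  hence K0: "K \<ge> 0" using t by (simp add: zero_le_mult_iff)
  have 1: "ln (1 + x) \<le> x" using x by (rule ln_add_one_self_le_self)
  have 2: "x - x\<^sup>2 \<le> ln (1 + x)"
  proof (cases "x \<le> 1")
    case True thus ?thesis using x by (intro ln_one_plus_pos_lower_bound)
  next
    case False
    hence "x * 1 \<le> x * x" by (intro mult_left_mono) auto
    hence "x - x\<^sup>2 \<le> 0" by (simp add: power2_eq_square)
    also have "0 \<le> ln (1 + x)" using x by simp
    finally show ?thesis .
  qed
  have "\<bar>x\<bar> \<le> \<bar>c * t\<bar> + K * t\<^sup>2" using K by linarith
  also have "\<dots> \<le> \<bar>c\<bar> * t + K * t"
    using t K0 by (intro add_mono mult_left_mono) (auto simp: abs_mult power2_eq_square mult_left_le)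
  finally have "\<bar>x\<bar> \<le> (\<bar>c\<bar> + K) * t" by (simp add: distrib_right)
  hence "x\<^sup>2 \<le> ((\<bar>c\<bar> + K) * t)\<^sup>2" using x by (intro power_mono) auto
  hence 3: "x\<^sup>2 \<le> (\<bar>c\<bar> + K)\<^sup>2 * t\<^sup>2" by (simp add: power_mult_distrib)
  show ?thesis using 1 2 3 K unfolding distrib_right by linarith
qed

text \<open>Compare \<open>\<zeta>(1 + t) - 1 / t\<close> and \<open>\<gamma>\<close>, written as sums over the same intervals \<open>[n, n + 1]\<close>.\<close>

lemma zeta_interval_difference:
  fixes t N :: real
  assumes t: "0 < t" "t \<le> 1" and N: "N \<ge> 1"
  shows "\<bar>(N powr (- 1 - t) - (N powr - t - (N + 1) powr - t) / t) - (1 / N + ln N - ln (N + 1))\<bar>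
          \<le> 5 * t * N powr (- 3 / 2)"
    and "N powr (- 1 - t) - (N powr - t - (N + 1) powr - t) / t \<ge> 0"
proof -
  have mt: "- t - 1 = - 1 - t" by simp
  \<comment> \<open>\<open>\<Phi>\<close> is an antiderivative of \<open>\<phi>\<close>, so the
    difference to be bounded is \<open>\<phi> \<xi> - \<phi> N\<close> for a mean value
    \<open>\<xi>\<close>. A second mean value theorem then extracts the factor t, since the
    derivative of \<open>\<phi>\<close> vanishes for t = 0.\<close>
  define \<phi> where "\<phi> x = 1 / x - x powr (- 1 - t)" for x :: real
  define \<Phi> where "\<Phi> x = ln x + x powr (- t) / t" for x :: real
  have "\<exists>\<xi>>N. \<xi> < N + 1 \<and> \<Phi> (N + 1) - \<Phi> N = (N + 1 - N) * \<phi> \<xi>"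
    by (rule MVT2) (use N t in \<open>auto simp: mt \<Phi>_def \<phi>_def intro!: derivative_eq_intros\<close>)
  then obtain \<xi> where xi: "\<xi> > N" "\<xi> < N + 1" "\<Phi> (N + 1) - \<Phi> N = \<phi> \<xi>" by auto
  have "\<exists>\<eta>>N. \<eta> < \<xi> \<and> \<phi> \<xi> - \<phi> N = (\<xi> - N) * (- 1 / \<eta>\<^sup>2 + (1 + t) * \<eta> powr (- 2 - t))"
  proof (rule MVT2)
    fix x assume x: "N \<le> x" "x \<le> \<xi>"
    have "(\<phi> has_real_derivative (- 1 / x\<^sup>2 - (- 1 - t) * x powr (- 1 - t - 1))) (at x)"
      unfolding \<phi>_def using x N
      by (auto simp: power2_eq_square intro!: derivative_eq_intros)
    moreover have "x powr (- 1 - t - 1) = x powr (- 2 - t)" by (rule arg_cong) simp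
    hence "- 1 / x\<^sup>2 - (- 1 - t) * x powr (- 1 - t - 1) = - 1 / x\<^sup>2 + (1 + t) * x powr (- 2 - t)"
      by (simp only: algebra_simps)
    ultimately show "(\<phi> has_real_derivative (- 1 / x\<^sup>2 + (1 + t) * x powr (- 2 - t))) (at x)"
      by (rule DERIV_cong)
  qed (use xi in auto)
  then obtain \<eta> where eta: "\<eta> > N" "\<eta> < \<xi>"
    "\<phi> \<xi> - \<phi> N = (\<xi> - N) * (- 1 / \<eta>\<^sup>2 + (1 + t) * \<eta> powr (- 2 - t))" by auto
  have e0: "\<eta> > 0" using eta N by linarith
  have "\<eta> powr (- 2 - t) = \<eta> powr (- 2) * \<eta> powr (- t)" by (simp add: powr_add[symmetric])
  also have "\<eta> powr (- 2) = 1 / \<eta>\<^sup>2" using e0 by (simp add: powr_minus_divide)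
  finally have pe: "\<eta> powr (- 2 - t) = 1 / \<eta>\<^sup>2 * \<eta> powr (- t)" .
  have e1: "- 1 / \<eta>\<^sup>2 + (1 + t) * \<eta> powr (- 2 - t) = (- 1 + (1 + t) * \<eta> powr (- t)) / \<eta>\<^sup>2"
    unfolding pe by (simp add: add_divide_distrib diff_divide_distrib)
  have ln0: "0 \<le> ln \<eta>" using eta N by simp
  have pw: "\<eta> powr (- t) = exp (- (t * ln \<eta>))" using e0 by (simp add: powr_def)
  have up: "\<eta> powr (- t) \<le> 1" unfolding pw using t ln0 by simp
  have lo: "\<eta> powr (- t) \<ge> 1 - t * ln \<eta>" unfolding pw using exp_ge_add_one_self[of "- (t * ln \<eta>)"] by linarith
  have "(1 + t) * \<eta> powr (- t) \<le> 1 + t" using mult_left_mono[OF up, of "1 + t"] t by simp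
  moreover have "0 \<le> t * \<eta> powr (- t)" "0 \<le> t * ln \<eta>" using t ln0 by simp_all
  ultimately have "\<bar>- 1 + (1 + t) * \<eta> powr (- t)\<bar> \<le> t * (1 + ln \<eta>)"
    using lo t unfolding distrib_left distrib_right by linarith
  \<comment> \<open>The logarithm is traded for a square root, so that division by a square of size
    at least N^2 leaves the summable N^(-3/2). The bound 4 N for \<open>\<eta>\<close> has a
    convenient square root.\<close>
  also have "\<dots> \<le> t * (5 * N powr (1/2))"
  proof (intro mult_left_mono)
    have "ln \<eta> \<le> \<eta> powr (1/2) / (1/2)" using eta N by (intro ln_powr_bound) auto
    also have "\<eta> powr (1/2) \<le> (4 * N) powr (1/2)" using eta xi N by (intro powr_mono2) auto
    also have "(4 * N) powr (1/2) = 2 * N powr (1/2)" using N by (simp add: powr_mult powr_half_sqrt)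
    finally have "ln \<eta> \<le> 4 * N powr (1/2)" by simp
    moreover have "1 \<le> N powr (1/2)" using N by (simp add: ge_one_powr_ge_zero)
    ultimately show "1 + ln \<eta> \<le> 5 * N powr (1/2)" by linarith
  qed (use t in auto)
  finally have b1: "\<bar>- 1 + (1 + t) * \<eta> powr (- t)\<bar> \<le> 5 * t * N powr (1/2)" by simp
  have "\<bar>\<phi> \<xi> - \<phi> N\<bar> \<le> 1 * (5 * t * N powr (1/2) / N\<^sup>2)"
    unfolding eta(3) e1 abs_mult abs_divide
    using xi eta N t by (intro mult_mono frac_le b1 power_mono) auto
  also have "5 * t * N powr (1/2) / N\<^sup>2 = 5 * t * (N powr (1/2) * N powr (- 2))"
    using N by (simp add: powr_minus_divide)
  also have "N powr (1/2) * N powr (- 2) = N powr (- 3 / 2)" by (simp add: powr_add[symmetric])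
  finally have "\<bar>\<phi> \<xi> - \<phi> N\<bar> \<le> 5 * t * N powr (- 3 / 2)" by simp
  moreover have "(N powr (- 1 - t) - (N powr - t - (N + 1) powr - t) / t) - (1 / N + ln N - ln (N + 1)) =
                 \<phi> \<xi> - \<phi> N"
    unfolding xi(3)[symmetric] by (simp add: \<Phi>_def \<phi>_def diff_divide_distrib)
  ultimately show "\<bar>(N powr (- 1 - t) - (N powr - t - (N + 1) powr - t) / t) - (1 / N + ln N - ln (N + 1))\<bar>
          \<le> 5 * t * N powr (- 3 / 2)" by simp
next
  have mt: "- t - 1 = - 1 - t" by simp
  \<comment> \<open>\<open>\<Psi>\<close> is an antiderivative of the decreasing function x^(-1 -
    t), whose integral over [N, N + 1] is at most its value at N.\<close>
  define \<Psi> where "\<Psi> x = - (x powr (- t) / t)" for x :: real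
  have "\<exists>\<xi>>N. \<xi> < N + 1 \<and> \<Psi> (N + 1) - \<Psi> N = (N + 1 - N) * \<xi> powr (- 1 - t)"
    by (rule MVT2) (use N t in \<open>auto simp: mt \<Psi>_def intro!: derivative_eq_intros\<close>)
  then obtain \<xi> where xi: "\<xi> > N" "\<xi> < N + 1" "\<Psi> (N + 1) - \<Psi> N = \<xi> powr (- 1 - t)" by auto
  have "\<xi> powr (- 1 - t) \<le> N powr (- 1 - t)" using xi N t by (intro powr_mono2') auto
  thus "N powr (- 1 - t) - (N powr - t - (N + 1) powr - t) / t \<ge> 0"
    unfolding xi(3)[symmetric] by (simp add: \<Psi>_def diff_divide_distrib)
qed

text \<open>Summed over N, the interval terms add up to \<zeta>(1 + t) - 1/t and to \<gamma>, and
  the bound t N^(-3/2) makes the difference O(t). The inequality t \<zeta>(1 + t) \<ge> 1 is what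
  \<open>ln_one_plus_first_order\<close> asks for in the next lemma.\<close>

lemma zeta_near_one:
  obtains K :: real where
    "\<And>t. 0 < t \<Longrightarrow> t \<le> 1 \<Longrightarrow>
       \<bar>t * (\<Sum>n. real (Suc n) powr (- (1 + t))) - 1 - euler_mascheroni * t\<bar> \<le> K * t\<^sup>2"
    "\<And>t. 0 < t \<Longrightarrow> t \<le> 1 \<Longrightarrow> t * (\<Sum>n. real (Suc n) powr (- (1 + t))) \<ge> 1"
proof -
  have sm: "summable (\<lambda>n. real (Suc n) powr (- a))" if "a > 1" for a
    using that summable_real_powr_iff[of "- a"] summable_Suc_iff[of "\<lambda>n. real n powr (- a)"] by simp
  define K where "K = (\<Sum>n. 5 * real (Suc n) powr (- 3 / 2))"
  have smK: "summable (\<lambda>n. 5 * real (Suc n) powr (- 3 / 2))"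
    using sm[of "3/2"] by (intro summable_mult) simp
  have main: "\<bar>t * (\<Sum>n. real (Suc n) powr (- (1 + t))) - 1 - euler_mascheroni * t\<bar> \<le> K * t\<^sup>2 \<and>
        t * (\<Sum>n. real (Suc n) powr (- (1 + t))) \<ge> 1" if t: "0 < t" "t \<le> 1" for t
  proof -
    define x where "x n = real (Suc n) powr (- 1 - t) - (real (Suc n) powr - t - (real (Suc n) + 1) powr - t) / t" for n
    define y where "y n = 1 / real (Suc n) + ln (real (Suc n)) - ln (real (Suc n) + 1)" for n
    have "(\<lambda>n. real n powr (- t)) \<longlonglongrightarrow> 0"
      using t by (intro tendsto_neg_powr filterlim_real_sequentially) auto
    hence "(\<lambda>n. real (Suc n) powr (- t)) \<longlonglongrightarrow> 0" by (rule LIMSEQ_Suc)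
    from sums_divide[OF telescope_sums'[OF this], of t]
    have tel: "(\<lambda>n. (real (Suc n) powr - t - (real (Suc n) + 1) powr - t) / t) sums (1 / t)"
      by (simp add: add_ac)
    have "(\<lambda>n. real (Suc n) powr (- (1 + t))) sums (\<Sum>n. real (Suc n) powr (- (1 + t)))"
      using sm[of "1 + t"] t by (intro summable_sums) auto
    hence z: "(\<lambda>n. real (Suc n) powr (- 1 - t)) sums (\<Sum>n. real (Suc n) powr (- (1 + t)))"
      by simp
    have X: "x sums ((\<Sum>n. real (Suc n) powr (- (1 + t))) - 1 / t)"
      unfolding x_def by (rule sums_diff[OF z tel])
    have Y: "y sums euler_mascheroni"
      using euler_mascheroni_sum_real unfolding y_def by (simp add: inverse_eq_divide add_ac)
    have d: "\<bar>x n - y n\<bar> \<le> t * (5 * real (Suc n) powr (- 3 / 2))" for n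
      using zeta_interval_difference(1)[OF t, of "real (Suc n)"] unfolding x_def y_def by (simp add: mult_ac)
    have x0: "x n \<ge> 0" for n
      using zeta_interval_difference(2)[OF t, of "real (Suc n)"] unfolding x_def by simp
    have XY: "(\<lambda>n. x n - y n) sums ((\<Sum>n. real (Suc n) powr (- (1 + t))) - 1 / t - euler_mascheroni)"
      by (rule sums_diff[OF X Y])
    have dK: "(\<lambda>n. t * (5 * real (Suc n) powr (- 3 / 2))) sums (t * K)"
      unfolding K_def by (intro sums_mult summable_sums smK)
    have "\<bar>(\<Sum>n. real (Suc n) powr (- (1 + t))) - 1 / t - euler_mascheroni\<bar> \<le> t * K"
    proof (rule abs_leI)
      show "(\<Sum>n. real (Suc n) powr (- (1 + t))) - 1 / t - euler_mascheroni \<le> t * K"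
        by (rule sums_le[OF _ XY dK]) (use d abs_le_iff in blast)
      show "- ((\<Sum>n. real (Suc n) powr (- (1 + t))) - 1 / t - euler_mascheroni) \<le> t * K"
        by (rule sums_le[OF _ sums_minus[OF XY] dK]) (use d abs_le_iff in blast)
    qed
    hence "t * \<bar>(\<Sum>n. real (Suc n) powr (- (1 + t))) - 1 / t - euler_mascheroni\<bar> \<le> t * (t * K)"
      using t by (intro mult_left_mono) auto
    also have "t * \<bar>(\<Sum>n. real (Suc n) powr (- (1 + t))) - 1 / t - euler_mascheroni\<bar> =
       \<bar>t * ((\<Sum>n. real (Suc n) powr (- (1 + t))) - 1 / t - euler_mascheroni)\<bar>"
      using t by (simp add: abs_mult)
    also have "t * ((\<Sum>n. real (Suc n) powr (- (1 + t))) - 1 / t - euler_mascheroni) =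
       t * (\<Sum>n. real (Suc n) powr (- (1 + t))) - 1 - euler_mascheroni * t"
      using t by (simp add: right_diff_distrib mult.commute)
    finally have A: "\<bar>t * (\<Sum>n. real (Suc n) powr (- (1 + t))) - 1 - euler_mascheroni * t\<bar> \<le> K * t\<^sup>2"
      by (simp add: power2_eq_square mult_ac)
    have "0 \<le> (\<Sum>n. real (Suc n) powr (- (1 + t))) - 1 / t"
      by (rule sums_le[OF _ sums_zero X]) (rule x0)
    hence "t * (1 / t) \<le> t * (\<Sum>n. real (Suc n) powr (- (1 + t)))"
      using t by (intro mult_left_mono) auto
    thus ?thesis using A t by simp
  qed
  show ?thesis using that main by blast
qed

lemma log_zeta_near_one:
  obtains K :: real where "K \<ge> 0"
    "\<And>t. 0 < t \<Longrightarrow> t \<le> 1 \<Longrightarrow>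
       \<bar>ln t + ln ((\<Sum>n. real (Suc n) powr (- (1 + t))) * (1 - 2 powr - (1 + t))) -
          (- ln 2 + (euler_mascheroni + ln 2) * t)\<bar> \<le> K * t\<^sup>2"
proof -
  obtain K1 :: real where K1: "\<And>t. 0 < t \<Longrightarrow> t \<le> 1 \<Longrightarrow>
       \<bar>t * (\<Sum>n. real (Suc n) powr (- (1 + t))) - 1 - euler_mascheroni * t\<bar> \<le> K1 * t\<^sup>2"
    "\<And>t. 0 < t \<Longrightarrow> t \<le> 1 \<Longrightarrow> t * (\<Sum>n. real (Suc n) powr (- (1 + t))) \<ge> 1"
    using zeta_near_one by metis
  define K2 where "K2 = (ln 2)\<^sup>2 / (2 :: real)"
  define K where "K = (K1 + (\<bar>euler_mascheroni\<bar> + K1)\<^sup>2) + (K2 + (\<bar>ln 2\<bar> + K2)\<^sup>2)"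
  have main: "\<bar>ln t + ln ((\<Sum>n. real (Suc n) powr (- (1 + t))) * (1 - 2 powr - (1 + t))) -
          (- ln 2 + (euler_mascheroni + ln 2) * t)\<bar> \<le> K * t\<^sup>2" if t: "0 < t" "t \<le> 1" for t
  proof -
    define Z where "Z = (\<Sum>n. real (Suc n) powr (- (1 + t)))"
    \<comment> \<open>With this x the factor 1 - 2^-(1 + t) equals (1 + x) / 2, so the lemma on ln
      (1 + x) applies to it as well as to t \<zeta>(1 + t).\<close>
    define x where "x = 1 - exp (- (t * ln 2))"
    have "0 < t * Z" using K1(2)[OF t] unfolding Z_def by linarith
    hence Z0: "Z > 0" using t by (simp add: zero_less_mult_iff)
    have x0: "x \<ge> 0" using t by (simp add: x_def)
    have "\<bar>x - ln 2 * t\<bar> \<le> K2 * t\<^sup>2"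
      using exp_minus_Taylor_bounds[of "t * ln 2"] t
      by (simp add: x_def K2_def power_mult_distrib mult_ac)
    from ln_one_plus_first_order[OF x0 t this]
    have A: "\<bar>ln (1 + x) - ln 2 * t\<bar> \<le> (K2 + (\<bar>ln 2\<bar> + K2)\<^sup>2) * t\<^sup>2" .
    have "\<bar>(t * Z - 1) - euler_mascheroni * t\<bar> \<le> K1 * t\<^sup>2" 
      using K1(1)[OF t] unfolding Z_def .
    from ln_one_plus_first_order[OF _ t this] K1(2)[OF t]
    have B: "\<bar>ln (t * Z) - euler_mascheroni * t\<bar> \<le> (K1 + (\<bar>euler_mascheroni\<bar> + K1)\<^sup>2) * t\<^sup>2"
      unfolding Z_def by simp
    have "2 powr - (1 + t) = 2 powr (- 1 + - t)" by simp
    also have "\<dots> = 2 powr (- 1) * 2 powr (- t)" by (rule powr_add)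
    also have "\<dots> = exp (- (t * ln 2)) / 2" by (simp add: powr_def exp_minus)
    finally have pw: "2 powr - (1 + t) = exp (- (t * ln 2)) / 2" .
    have "1 - 2 powr - (1 + t) = (1 + x) / 2" unfolding x_def pw by (simp add: field_simps)
    hence "ln (Z * (1 - 2 powr - (1 + t))) = ln (Z * ((1 + x) / 2))" by (rule arg_cong)
    also have "\<dots> = ln Z + ln (1 + x) - ln 2"
      using Z0 x0 by (simp add: ln_mult ln_div)
    finally have "ln (Z * (1 - 2 powr - (1 + t))) = ln Z + ln (1 + x) - ln 2" .
    moreover have "ln (t * Z) = ln t + ln Z" using t Z0 by (simp add: ln_mult)
    ultimately have "ln t + ln (Z * (1 - 2 powr - (1 + t))) - (- ln 2 + (euler_mascheroni + ln 2) * t) =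
      (ln (t * Z) - euler_mascheroni * t) + (ln (1 + x) - ln 2 * t)"
      by (simp add: algebra_simps)
    thus ?thesis using A B unfolding Z_def K_def distrib_right by linarith
  qed
  have "0 \<le> K * 1\<^sup>2" by (rule order_trans[OF abs_ge_zero main[of 1]]) auto
  with main that show ?thesis by simp
qed

section \<open>Expansion of the logarithm of the regularised Euler product\<close>

text \<open>Up to the sign (-1)^j this is the j-th derivative of \<open>odd_prime_zeta\<close> at m,
  convergent for m \<ge> 2.\<close>

definition odd_prime_log_sum :: "nat \<Rightarrow> nat \<Rightarrow> real" where
  "odd_prime_log_sum j m = (\<Sum>\<^sub>\<infinity>p\<in>odd_primes. ln (real p) ^ j * real p powr (- real m))"

lemma odd_primes_ge_3: "p \<in> odd_primes \<Longrightarrow> real p \<ge> 3"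
  by (auto simp: odd_primes_def)

lemma ln_odd_prime_ge_1: "p \<in> odd_primes \<Longrightarrow> ln (real p) \<ge> 1"
  using odd_primes_ge_3[of p] exp_le by (subst ln_ge_iff) auto

text \<open>Since ln p \<ge> 1, the exponent j may be raised to 2, and since p \<ge> 3, the surplus
  p^-(m - 2) is at most 3^-(m - 2) = 9 / 3^m. Thus one convergent sum, that for j = m = 2, controls
  all of them.\<close>

lemma odd_prime_log_power_le:
  assumes p: "p \<in> odd_primes" and "j \<le> 2" "m \<ge> 2"
  shows "ln (real p) ^ j * real p powr (- real m) \<le>
         9 * (1 / 3) ^ m * (ln (real p) ^ 2 * real p powr (- real 2))"
proof -
  have p3: "real p \<ge> 3" by (rule odd_primes_ge_3[OF p])
  have 1: "ln (real p) ^ j \<le> ln (real p) ^ 2"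
    using ln_odd_prime_ge_1[OF p] assms by (intro power_increasing) auto
  have "real p powr (- real m) = real p powr (- real (m - 2)) * real p powr (- real 2)"
    using assms by (simp add: powr_add[symmetric] of_nat_diff)
  also have "\<dots> \<le> 3 powr (- real (m - 2)) * real p powr (- real 2)"
    using p3 by (intro mult_right_mono powr_mono2') auto
  also have "3 powr (- real (m - 2)) = (1 / 3 :: real) ^ (m - 2)"
    by (simp add: powr_minus powr_realpow power_divide inverse_eq_divide)
  also have "(1 / 3 :: real) ^ (m - 2) = 9 * (1 / 3) ^ m"
  proof -
    obtain n where "m = n + 2" using assms by (metis le_add_diff_inverse2)
    thus ?thesis by (simp add: power_add power2_eq_square)
  qed
  finally have 2: "real p powr (- real m) \<le> 9 * (1 / 3) ^ m * real p powr (- real 2)" .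
  have "ln (real p) ^ j * real p powr (- real m) \<le>
        ln (real p) ^ 2 * (9 * (1 / 3) ^ m * real p powr (- real 2))"
    using ln_odd_prime_ge_1[OF p] by (intro mult_mono 1 2) auto
  thus ?thesis by (simp only: mult_ac)
qed

lemma odd_prime_log_sum_has_sum:
  assumes "j \<le> 2" "m \<ge> 2"
  shows "((\<lambda>p. ln (real p) ^ j * real p powr (- real m)) has_sum odd_prime_log_sum j m) odd_primes"
  unfolding odd_prime_log_sum_def
proof (rule has_sum_infsum, rule summable_on_comparison_test)
  show "(\<lambda>p. 9 * (1 / 3) ^ m * (16 * real p powr (- (3 / 2)))) summable_on odd_primes"
    by (intro summable_on_cmult_right summable_on_nat_powr) auto
  fix p assume p: "p \<in> odd_primes"
  have p3: "real p \<ge> 3" by (rule odd_primes_ge_3[OF p])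
  \<comment> \<open>The exponent 1/4 turns (ln p)^2 into p^(1/2), which leaves the convergent
    p^(-3/2).\<close>
  have "ln (real p) \<le> real p powr (1/4) / (1/4)" using p3 by (intro ln_powr_bound) auto
  hence "ln (real p) ^ 2 \<le> (4 * real p powr (1/4)) ^ 2"
    using ln_odd_prime_ge_1[OF p] by (intro power_mono) auto
  also have "\<dots> = 16 * real p powr (1/2)"
    by (simp add: power_mult_distrib power2_eq_square powr_add[symmetric])
  finally have "ln (real p) ^ 2 * real p powr (- real 2) \<le> 16 * real p powr (1/2) * real p powr (- real 2)"
    by (intro mult_right_mono) auto
  also have "\<dots> = 16 * real p powr (- (3 / 2))" by (simp add: powr_add[symmetric])
  finally have "9 * (1 / 3) ^ m * (ln (real p) ^ 2 * real p powr (- real 2)) \<le>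
                9 * (1 / 3) ^ m * (16 * real p powr (- (3 / 2)))"
    by (intro mult_left_mono) auto
  with odd_prime_log_power_le[OF p assms]
  show "ln (real p) ^ j * real p powr (- real m) \<le> 9 * (1 / 3) ^ m * (16 * real p powr (- (3 / 2)))"
    by linarith
  show "0 \<le> ln (real p) ^ j * real p powr (- real m)"
    using ln_odd_prime_ge_1[OF p] by simp
qed

lemma odd_prime_log_sum_bounds:
  assumes "j \<le> 2" "m \<ge> 2"
  shows "0 \<le> odd_prime_log_sum j m"
    and "odd_prime_log_sum j m \<le> 9 * odd_prime_log_sum 2 2 * (1 / 3) ^ m"
proof -
  show "0 \<le> odd_prime_log_sum j m"
    unfolding odd_prime_log_sum_def
    by (rule infsum_nonneg) (use ln_odd_prime_ge_1 in force)
  have "odd_prime_log_sum j m \<le> 9 * (1 / 3) ^ m * odd_prime_log_sum 2 2"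
    by (rule has_sum_mono[OF odd_prime_log_sum_has_sum has_sum_cmult_right[OF odd_prime_log_sum_has_sum]])
       (use assms odd_prime_log_power_le in auto)
  thus "odd_prime_log_sum j m \<le> 9 * odd_prime_log_sum 2 2 * (1 / 3) ^ m" by (simp add: mult_ac)
qed

text \<open>A termwise Taylor bound for exp (- y) with y = t m ln p. For m = 1 the sums at t = 0
  diverge; that coefficient is recovered from \<zeta> in \<open>log_coeff_1_eq\<close>.\<close>

lemma odd_prime_zeta_Taylor:
  assumes m: "m \<ge> 2" and t: "t > 0"
  shows "\<bar>odd_prime_zeta (real m * (1 + t)) - odd_prime_log_sum 0 m + t * (real m * odd_prime_log_sum 1 m)\<bar>
          \<le> t\<^sup>2 * ((real m)\<^sup>2 / 2 * odd_prime_log_sum 2 m)"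
proof -
  define D where "D = odd_prime_zeta (real m * (1 + t)) + (- 1) * odd_prime_log_sum 0 m + t * (real m * odd_prime_log_sum 1 m)"
  define f where "f p = real p powr (- (real m * (1 + t))) + (- 1) * (ln (real p) ^ 0 * real p powr (- real m)) +
    t * (real m * (ln (real p) ^ 1 * real p powr (- real m)))" for p :: nat
  have ms: "real m * (1 + t) > 1" using m t by (simp add: less_1_mult)
  have fD: "(f has_sum D) odd_primes"
    unfolding f_def D_def
    by (rule has_sum_add[OF has_sum_add[OF odd_prime_zeta_has_sum[OF ms]
          has_sum_cmult_right[OF odd_prime_log_sum_has_sum]]
          has_sum_cmult_right[OF has_sum_cmult_right[OF odd_prime_log_sum_has_sum]]])
       (use m in auto)
  have g: "((\<lambda>p. t\<^sup>2 * ((real m)\<^sup>2 / 2 * (ln (real p) ^ 2 * real p powr (- real m)))) has_sum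
            t\<^sup>2 * ((real m)\<^sup>2 / 2 * odd_prime_log_sum 2 m)) odd_primes"
    by (intro has_sum_cmult_right odd_prime_log_sum_has_sum) (use m in auto)
  have bd: "0 \<le> f p \<and> f p \<le> t\<^sup>2 * ((real m)\<^sup>2 / 2 * (ln (real p) ^ 2 * real p powr (- real m)))"
    if p: "p \<in> odd_primes" for p
  proof -
    define y where "y = t * real m * ln (real p)"
    have y0: "y \<ge> 0" using t ln_odd_prime_ge_1[OF p] by (simp add: y_def)
    have p0: "real p > 0" using odd_primes_ge_3[OF p] by linarith
    have "real p powr (- (real m * (1 + t))) = real p powr (- real m) * real p powr (- (real m * t))"
      by (simp add: powr_add[symmetric] algebra_simps)
    also have "real p powr (- (real m * t)) = exp (- y)"
      using p0 by (simp add: powr_def y_def mult_ac)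
    finally have "f p = real p powr (- real m) * (exp (- y) - 1 + y)"
      by (simp add: f_def y_def algebra_simps)
    moreover have "real p powr (- real m) * (exp (- y) - 1 + y) \<le> real p powr (- real m) * (y\<^sup>2 / 2)"
      using exp_minus_Taylor_bounds[OF y0] by (intro mult_left_mono) auto
    moreover have "0 \<le> real p powr (- real m) * (exp (- y) - 1 + y)"
      using exp_minus_Taylor_bounds[OF y0] by (intro mult_nonneg_nonneg) auto
    ultimately show ?thesis by (simp add: y_def power_mult_distrib mult_ac)
  qed
  have "0 \<le> D" by (rule has_sum_nonneg[OF fD]) (use bd in auto)
  moreover have "D \<le> t\<^sup>2 * ((real m)\<^sup>2 / 2 * odd_prime_log_sum 2 m)"
    by (rule has_sum_mono[OF fD g]) (use bd in auto)
  ultimately show ?thesis unfolding D_def by linarith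
qed

text \<open>\<open>log_coeff t\<close> are the Taylor coefficients of
  \<open>w log t - (\<Sum>p>2. log (1 - w p powr - (1 + t)))\<close>; in this normalisation they extend
  smoothly to \<open>t = 0\<close>, with value \<open>log_coeff0\<close> and derivative \<open>log_coeff1\<close>.\<close>

definition log_coeff :: "real \<Rightarrow> nat \<Rightarrow> real" where
  "log_coeff t m = odd_prime_zeta (real m * (1 + t)) / real m + (if m = 1 then ln t else 0)"

definition log_coeff0 :: "nat \<Rightarrow> real" where
  "log_coeff0 m = (if m = 0 then 0
     else if m = 1 then - ln 2 - (\<Sum>n. odd_prime_log_sum 0 (n + 2) / real (n + 2))
     else odd_prime_log_sum 0 m / real m)"

definition log_coeff1 :: "nat \<Rightarrow> real" where
  "log_coeff1 m = (if m = 0 then 0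
     else if m = 1 then euler_mascheroni + ln 2 + (\<Sum>n. odd_prime_log_sum 1 (n + 2))
     else - odd_prime_log_sum 1 m)"

text \<open>Here 12/11 = (4/11) / (1/3): a factor m turns the geometric ratio 1/3 into 4/11.\<close>

lemma nat_le_power: "real m \<le> 11 * (12 / 11) ^ m"
  using Bernoulli_inequality[of "1 / 11 :: real" m] by simp

text \<open>Differentiating p^(-m(1 + t)) twice in t costs m^2, of which the division by m in
  \<open>log_coeff\<close> leaves one factor m. It is absorbed by enlarging 1/3 to 4/11, that is, by
  shrinking the radius from 3 to 11/4.\<close>

lemma log_coeff_bounds_ge_2:
  obtains C :: real where "C > 0"
    "\<And>m. m \<ge> 2 \<Longrightarrow> \<bar>log_coeff0 m\<bar> \<le> C * (4 / 11) ^ m"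
    "\<And>m. m \<ge> 2 \<Longrightarrow> \<bar>log_coeff1 m\<bar> \<le> C * (4 / 11) ^ m"
    "\<And>m t. m \<ge> 2 \<Longrightarrow> 0 < t \<Longrightarrow> \<bar>log_coeff t m - log_coeff0 m - t * log_coeff1 m\<bar> \<le> C * t\<^sup>2 * (4 / 11) ^ m"
proof -
  define Q where "Q = 9 * odd_prime_log_sum 2 2"
  have Q0: "Q \<ge> 0" using odd_prime_log_sum_bounds(1)[of 2 2] by (simp add: Q_def)
  have le: "(1 / 3 :: real) ^ m \<le> (4 / 11) ^ m" for m by (intro power_mono) auto
  have m3: "real m * (1 / 3) ^ m \<le> 11 * (4 / 11) ^ m" for m
  proof -
    have "real m * (1 / 3) ^ m \<le> 11 * (12 / 11) ^ m * (1 / 3) ^ m"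
      by (intro mult_right_mono nat_le_power) auto
    also have "\<dots> = 11 * (4 / 11) ^ m" by (simp add: mult.assoc power_mult_distrib[symmetric])
    finally show ?thesis .
  qed
  define C where "C = 11 * Q + 1"
  have C0: "C > 0" using Q0 by (simp add: C_def)
  have QC: "Q * (1 / 3) ^ m \<le> C * (4 / 11) ^ m" for m
    using Q0 by (intro mult_mono le) (auto simp: C_def)
  have b0: "\<bar>log_coeff0 m\<bar> \<le> C * (4 / 11) ^ m" if m: "m \<ge> 2" for m
  proof -
    have "odd_prime_log_sum 0 m / real m \<le> odd_prime_log_sum 0 m / 1"
      using m odd_prime_log_sum_bounds(1)[of 0 m] by (intro divide_left_mono) auto
    also have "\<dots> \<le> Q * (1 / 3) ^ m" using odd_prime_log_sum_bounds(2)[of 0 m] m by (simp add: Q_def)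
    finally have "odd_prime_log_sum 0 m / real m \<le> C * (4 / 11) ^ m" using QC[of m] by linarith
    thus ?thesis using m odd_prime_log_sum_bounds(1)[of 0 m] by (simp add: log_coeff0_def)
  qed
  have b1: "\<bar>log_coeff1 m\<bar> \<le> C * (4 / 11) ^ m" if m: "m \<ge> 2" for m
  proof -
    have "odd_prime_log_sum 1 m \<le> Q * (1 / 3) ^ m" using odd_prime_log_sum_bounds(2)[of 1 m] m by (simp add: Q_def)
    hence "odd_prime_log_sum 1 m \<le> C * (4 / 11) ^ m" using QC[of m] by linarith
    thus ?thesis using m odd_prime_log_sum_bounds(1)[of 1 m] by (simp add: log_coeff1_def)
  qed
  have b2: "\<bar>log_coeff t m - log_coeff0 m - t * log_coeff1 m\<bar> \<le> C * t\<^sup>2 * (4 / 11) ^ m"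
    if m: "m \<ge> 2" and t: "0 < t" for m t
  proof -
    have m0: "real m > 0" using m by simp
    have "log_coeff t m - log_coeff0 m - t * log_coeff1 m =
      (odd_prime_zeta (real m * (1 + t)) - odd_prime_log_sum 0 m + t * (real m * odd_prime_log_sum 1 m)) / real m"
      using m by (simp add: log_coeff_def log_coeff0_def log_coeff1_def add_divide_distrib diff_divide_distrib)
    also have "\<bar>\<dots>\<bar> \<le> (t\<^sup>2 * ((real m)\<^sup>2 / 2 * odd_prime_log_sum 2 m)) / real m"
      unfolding abs_divide abs_of_nat by (intro divide_right_mono odd_prime_zeta_Taylor m t) simp
    also have "\<dots> = t\<^sup>2 * (real m * odd_prime_log_sum 2 m / 2)"
      using m0 by (simp add: power2_eq_square)
    also have "\<dots> \<le> t\<^sup>2 * (C * (4 / 11) ^ m)"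
    proof (intro mult_left_mono)
      have "real m * odd_prime_log_sum 2 m \<le> real m * (Q * (1 / 3) ^ m)"
        using odd_prime_log_sum_bounds(2)[of 2 m] m by (intro mult_left_mono) (auto simp: Q_def)
      also have "\<dots> = Q * (real m * (1 / 3) ^ m)" by simp
      also have "\<dots> \<le> Q * (11 * (4 / 11) ^ m)" by (intro mult_left_mono m3 Q0)
      also have "\<dots> \<le> C * (4 / 11) ^ m" by (simp add: C_def algebra_simps)
      finally have *: "real m * odd_prime_log_sum 2 m \<le> C * (4 / 11) ^ m" .
      have "0 \<le> real m * odd_prime_log_sum 2 m" using odd_prime_log_sum_bounds(1)[of 2 m] m by simp
      with * show "real m * odd_prime_log_sum 2 m / 2 \<le> C * (4 / 11) ^ m" by linarith
    qed simp
    finally show ?thesis by (simp add: mult_ac)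
  qed
  show ?thesis using that C0 b0 b1 b2 by blast
qed

text \<open>The sum over p in the coefficient at m = 1 diverges as t tends to 0. By
  \<open>zeta_eq_exp\<close> the whole series at w = 1 is known, so this coefficient is the total
  minus all the others, each of which is regular at t = 0.\<close>

lemma log_coeff_1_eq:
  assumes t: "t > 0"
  shows "log_coeff t 1 = ln t + ln ((\<Sum>n. real (Suc n) powr (- (1 + t))) * (1 - 2 powr - (1 + t)))
          - (\<Sum>n. log_coeff t (n + 2))"
    and "summable (\<lambda>n. log_coeff t (n + 2))"
proof -
  define f where "f m = odd_prime_zeta (real m * (1 + t)) / real m" for m
  have le: "f m \<le> 3 * odd_prime_zeta (1 + t) * (1 / 3) ^ m" if "m \<ge> 1" for m
  proof -
    have "f m \<le> odd_prime_zeta (real m * (1 + t)) / 1"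
      unfolding f_def using odd_prime_zeta_nonneg that by (intro divide_left_mono) auto
    also have "\<dots> \<le> 3 * odd_prime_zeta (1 + t) * (1 / 3) ^ m"
      using odd_prime_zeta_mult_le[of "1 + t" m] t that by simp
    finally show ?thesis .
  qed
  have sf: "summable f"
  proof (rule summable_comparison_test'[where N = 1])
    show "summable (\<lambda>m. 3 * odd_prime_zeta (1 + t) * (1 / 3) ^ m)"
      by (intro summable_mult summable_geometric) auto
    show "norm (f m) \<le> 3 * odd_prime_zeta (1 + t) * (1 / 3) ^ m" if "m \<ge> 1" for m
      using le[OF that] odd_prime_zeta_nonneg[of "real m * (1 + t)"] by (simp add: f_def)
  qed
  have f2: "log_coeff t (n + 2) = f (n + 2)" for n by (simp add: log_coeff_def f_def)
  show "summable (\<lambda>n. log_coeff t (n + 2))"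
    unfolding f2 using sf by (rule summable_ignore_initial_segment)
  have "suminf f = (\<Sum>n. f (n + 2)) + (\<Sum>i<2. f i)"
    by (rule suminf_split_initial_segment[OF sf])
  \<comment> \<open>The term at 0 is a division by 0, hence 0.\<close>
  also have "(\<Sum>i<2. f i) = f 1" by (simp add: f_def numeral_2_eq_2)
  finally have "suminf f = (\<Sum>n. log_coeff t (n + 2)) + f 1" unfolding f2 .
  moreover have "ln ((\<Sum>n. real (Suc n) powr (- (1 + t))) * (1 - 2 powr - (1 + t))) = suminf f"
    using t by (subst zeta_eq_exp) (auto simp: f_def[abs_def])
  moreover have "log_coeff t 1 = ln t + f 1" by (simp add: log_coeff_def f_def)
  ultimately show "log_coeff t 1 = ln t + ln ((\<Sum>n. real (Suc n) powr (- (1 + t))) * (1 - 2 powr - (1 + t)))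
          - (\<Sum>n. log_coeff t (n + 2))" by linarith
qed

lemma log_coeff_expansion:
  obtains C :: real where "C > 0"
    "\<And>m. \<bar>log_coeff0 m\<bar> \<le> C * (4 / 11) ^ m" "\<And>m. \<bar>log_coeff1 m\<bar> \<le> C * (4 / 11) ^ m"
    "\<And>m t. 0 < t \<Longrightarrow> t \<le> 1 \<Longrightarrow>
       \<bar>log_coeff t m - log_coeff0 m - t * log_coeff1 m\<bar> \<le> C * t\<^sup>2 * (4 / 11) ^ m"
proof -
  obtain C2 :: real where C2: "C2 > 0"
    "\<And>m. m \<ge> 2 \<Longrightarrow> \<bar>log_coeff0 m\<bar> \<le> C2 * (4 / 11) ^ m"
    "\<And>m. m \<ge> 2 \<Longrightarrow> \<bar>log_coeff1 m\<bar> \<le> C2 * (4 / 11) ^ m"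
    "\<And>m t. m \<ge> 2 \<Longrightarrow> 0 < t \<Longrightarrow> \<bar>log_coeff t m - log_coeff0 m - t * log_coeff1 m\<bar> \<le> C2 * t\<^sup>2 * (4 / 11) ^ m"
    using log_coeff_bounds_ge_2 by blast
  obtain K :: real where K: "K \<ge> 0"
    "\<And>t. 0 < t \<Longrightarrow> t \<le> 1 \<Longrightarrow>
       \<bar>ln t + ln ((\<Sum>n. real (Suc n) powr (- (1 + t))) * (1 - 2 powr - (1 + t))) -
          (- ln 2 + (euler_mascheroni + ln 2) * t)\<bar> \<le> K * t\<^sup>2"
    using log_zeta_near_one by blast
  have geo: "summable (\<lambda>n. (4 / 11 :: real) ^ (n + 2))"
    using summable_geometric[of "4 / 11 :: real"] summable_iff_shift[of "\<lambda>n. (4/11::real) ^ n" 2] by simp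
  define g where "g = (\<Sum>n. (4 / 11 :: real) ^ (n + 2))"
  have g0: "g \<ge> 0" unfolding g_def using geo by (intro suminf_nonneg) auto
  define G where "G = C2 * g"
  have G0: "G \<ge> 0" using C2(1) g0 by (simp add: G_def)
  have s0: "summable (\<lambda>n. log_coeff0 (n + 2))"
    by (rule summable_comparison_test'[OF summable_mult[OF geo, of C2]]) (simp only: real_norm_def, rule C2(2), simp)
  have s1: "summable (\<lambda>n. log_coeff1 (n + 2))"
    by (rule summable_comparison_test'[OF summable_mult[OF geo, of C2]]) (simp only: real_norm_def, rule C2(3), simp)
  have e0: "log_coeff0 1 = - ln 2 - (\<Sum>n. log_coeff0 (n + 2))"
    by (simp add: log_coeff0_def)
  have e1: "log_coeff1 1 = euler_mascheroni + ln 2 - (\<Sum>n. log_coeff1 (n + 2))"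
  proof -
    have "(\<Sum>n. log_coeff1 (n + 2)) = (\<Sum>n. - odd_prime_log_sum 1 (n + 2))"
      by (simp add: log_coeff1_def)
    also have "\<dots> = - (\<Sum>n. odd_prime_log_sum 1 (n + 2))"
    proof (rule suminf_minus)
      have "(\<lambda>n. - log_coeff1 (n + 2)) = (\<lambda>n. odd_prime_log_sum 1 (n + 2))"
        by (simp add: log_coeff1_def)
      thus "summable (\<lambda>n. odd_prime_log_sum 1 (n + 2))" using summable_minus[OF s1] by simp
    qed
    finally show ?thesis by (simp add: log_coeff1_def)
  qed
  \<comment> \<open>For m = 1 the error is that of \<open>log_zeta_near_one\<close> minus the sum of
    the errors for m \<ge> 2, which are bounded by a geometric series.\<close>
  have B1: "\<bar>log_coeff t 1 - log_coeff0 1 - t * log_coeff1 1\<bar> \<le> (K + G) * t\<^sup>2"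
    if t: "0 < t" "t \<le> 1" for t
  proof -
    let ?d = "\<lambda>n. log_coeff t (n + 2) - log_coeff0 (n + 2) - t * log_coeff1 (n + 2)"
    have d: "norm (?d n) \<le> C2 * t\<^sup>2 * (4 / 11) ^ (n + 2)" for n
      unfolding real_norm_def by (rule C2(4)) (use t in auto)
    have sd: "summable (\<lambda>n. norm (?d n))"
      by (rule summable_comparison_test'[OF summable_mult[OF geo, of "C2 * t\<^sup>2"]]) (use d in \<open>simp only: real_norm_def abs_abs\<close>)
    have "\<bar>suminf ?d\<bar> \<le> (\<Sum>n. norm (?d n))" using summable_norm[OF sd] by simp
    also have "\<dots> \<le> (\<Sum>n. C2 * t\<^sup>2 * (4 / 11) ^ (n + 2))"
      by (intro suminf_le sd summable_mult geo d)
    also have "\<dots> = G * t\<^sup>2" unfolding G_def g_def by (subst suminf_mult[OF geo]) simp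
    finally have 1: "\<bar>suminf ?d\<bar> \<le> G * t\<^sup>2" .
    have "suminf ?d = (\<Sum>n. log_coeff t (n + 2)) - (\<Sum>n. log_coeff0 (n + 2)) - t * (\<Sum>n. log_coeff1 (n + 2))"
      using log_coeff_1_eq(2)[OF t(1)] s0 s1
      by (simp add: suminf_diff[symmetric] suminf_mult[symmetric] summable_diff summable_mult)
    hence "log_coeff t 1 - log_coeff0 1 - t * log_coeff1 1 =
      (ln t + ln ((\<Sum>n. real (Suc n) powr (- (1 + t))) * (1 - 2 powr - (1 + t))) -
          (- ln 2 + (euler_mascheroni + ln 2) * t)) - suminf ?d"
      unfolding log_coeff_1_eq(1)[OF t(1)] e0 e1 by (simp add: algebra_simps)
    thus ?thesis using K(2)[OF t] 1 unfolding distrib_right by linarith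
  qed
  \<comment> \<open>The factor 3 exceeds 11/4, which compensates the ratio 4/11 occurring in the
    bounds for m = 1.\<close>
  define C where "C = 3 * (C2 + (K + G) + \<bar>log_coeff0 1\<bar> + \<bar>log_coeff1 1\<bar>)"
  have C0: "C > 0" using C2 K G0 by (simp add: C_def add_pos_nonneg)
  have CC: "C2 \<le> C" and CC1: "11 / 4 * (K + G) \<le> C"
    and CC2: "11 / 4 * \<bar>log_coeff0 1\<bar> \<le> C" and CC3: "11 / 4 * \<bar>log_coeff1 1\<bar> \<le> C"
    using C2(1) K(1) G0 unfolding C_def by - (simp_all add: algebra_simps add_pos_nonneg)
  have lift: "C2 * (4 / 11) ^ m \<le> C * (4 / 11) ^ m" for m using CC by (intro mult_right_mono) auto
  have "\<bar>log_coeff0 m\<bar> \<le> C * (4 / 11) ^ m \<and> \<bar>log_coeff1 m\<bar> \<le> C * (4 / 11) ^ m \<and>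
     (\<forall>t. 0 < t \<and> t \<le> 1 \<longrightarrow> \<bar>log_coeff t m - log_coeff0 m - t * log_coeff1 m\<bar> \<le> C * t\<^sup>2 * (4 / 11) ^ m)" for m
  proof -
    consider "m = 0" | "m = 1" | "m \<ge> 2" by linarith
    thus ?thesis
    proof cases
      case 1 thus ?thesis using C0 by (simp add: log_coeff0_def log_coeff1_def log_coeff_def)
    next
      case 2
      have "\<bar>log_coeff t 1 - log_coeff0 1 - t * log_coeff1 1\<bar> \<le> C * t\<^sup>2 * (4 / 11)" if "0 < t" "t \<le> 1" for t
      proof -
        have "(K + G) * t\<^sup>2 \<le> (C * (4 / 11)) * t\<^sup>2" using CC1 by (intro mult_right_mono) auto
        thus ?thesis using B1[OF that] by (simp add: mult_ac)
      qed
      thus ?thesis using 2 CC2 CC3 by (simp add: mult.commute)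
    next
      case 3
      have "C2 * t\<^sup>2 * (4 / 11) ^ m \<le> C * t\<^sup>2 * (4 / 11) ^ m" for t
        using CC by (intro mult_right_mono) auto
      thus ?thesis using C2(2-4)[OF 3] lift[of m] by (meson order_trans)
    qed
  qed
  with C0 that show ?thesis by blast
qed

section \<open>The regularised Euler product\<close>

definition complex_fps :: "(nat \<Rightarrow> real) \<Rightarrow> complex fps" where
  "complex_fps f = Abs_fps (\<lambda>n. of_real (f n))"

lemma complex_fps_nth [simp]: "complex_fps f $ n = of_real (f n)"
  by (simp add: complex_fps_def)

lemma complex_fps_conv_radius:
  assumes "\<And>n. \<bar>f n\<bar> \<le> B * (4 / 11) ^ n"
  shows "fps_conv_radius (complex_fps f) \<ge> ereal (11 / 4)"
  by (rule fps_conv_radius_geI[where K = B]) (use assms in auto)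

text \<open>On this disc the ratio is at most (4/11) (5/2) = 10/11, and the geometric series sums to
  11.\<close>

lemma norm_eval_complex_fps_le:
  assumes bd: "\<And>n. \<bar>f n\<bar> \<le> B * (4 / 11) ^ n" and w: "norm w \<le> 5 / 2"
  shows "norm (eval_fps (complex_fps f) w) \<le> 11 * B"
proof -
  have B: "(\<lambda>n. B * (10 / 11) ^ n) sums (B * (1 / (1 - 10 / 11)))"
    by (intro sums_mult geometric_sums) auto
  have le: "norm (complex_fps f $ n * w ^ n) \<le> B * (10 / 11) ^ n" for n
  proof -
    have "norm (complex_fps f $ n * w ^ n) = \<bar>f n\<bar> * norm w ^ n"
      by (simp add: norm_mult norm_power)
    also have "\<dots> \<le> (B * (4 / 11) ^ n) * (5 / 2) ^ n"
      using w order_trans[OF abs_ge_zero bd] by (intro mult_mono bd power_mono) auto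
    also have "\<dots> = B * (10 / 11) ^ n"
      by (simp add: mult.assoc power_mult_distrib[symmetric])
    finally show ?thesis .
  qed
  have "norm (eval_fps (complex_fps f) w) \<le> (\<Sum>n. B * (10 / 11) ^ n)"
    unfolding eval_fps_def by (rule norm_suminf_le[OF le]) (use B in \<open>auto simp: sums_iff\<close>)
  thus ?thesis using B by (simp add: sums_iff)
qed

text \<open>Converts bounds for functions on |w| \<le> 5/2 into bounds for coefficients, so that
  exponentials and products can be estimated pointwise. The larger open ball ensures continuity up
  to the circle.\<close>

lemma fps_coeff_Cauchy_bound:
  fixes F :: "complex fps"
  assumes "f has_fps_expansion F" "f holomorphic_on ball 0 (11 / 4)"
    and "\<And>w. norm w \<le> 5 / 2 \<Longrightarrow> norm (f w) \<le> B"
  shows "norm (F $ n) \<le> B * (2 / 5) ^ n"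
proof -
  have "norm ((deriv ^^ n) f 0) \<le> fact n * B / (5 / 2) ^ n"
  proof (rule Cauchy_inequality)
    show "f holomorphic_on ball 0 (5 / 2)"
      using assms(2) by (rule holomorphic_on_subset) auto
    show "continuous_on (cball 0 (5 / 2)) f"
      using holomorphic_on_imp_continuous_on[OF assms(2)] by (rule continuous_on_subset) auto
  qed (use assms(3) in auto)
  thus ?thesis
    by (simp add: fps_nth_fps_expansion[OF assms(1)] norm_divide power_divide field_simps)
qed

definition exp_fps :: "(nat \<Rightarrow> real) \<Rightarrow> complex fps" where
  "exp_fps f = fps_exp 1 oo complex_fps f"

lemma
  assumes bd: "\<And>n. \<bar>f n\<bar> \<le> B * (4 / 11) ^ n"
  shows complex_fps_expansion: "eval_fps (complex_fps f) has_fps_expansion complex_fps f"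
    and complex_fps_holomorphic: "eval_fps (complex_fps f) holomorphic_on ball 0 (11 / 4)"
proof -
  have "(0 :: ereal) < ereal (11 / 4)" by simp
  also note complex_fps_conv_radius[OF bd]
  finally show "eval_fps (complex_fps f) has_fps_expansion complex_fps f"
    by (rule eval_fps_has_fps_expansion)
  have "ereal (norm w) < fps_conv_radius (complex_fps f)" if "norm w < 11 / 4" for w :: complex
  proof -
    have "ereal (norm w) < ereal (11 / 4)" using that by simp
    also note complex_fps_conv_radius[OF bd]
    finally show ?thesis .
  qed
  thus "eval_fps (complex_fps f) holomorphic_on ball 0 (11 / 4)"
    by (intro holomorphic_intros) auto
qed

lemma
  assumes bd: "\<And>n. \<bar>f n\<bar> \<le> B * (4 / 11) ^ n" and 0: "f 0 = 0"
  shows exp_fps_expansion: "(\<lambda>w. exp (eval_fps (complex_fps f) w)) has_fps_expansion exp_fps f"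
    and exp_fps_holomorphic: "(\<lambda>w. exp (eval_fps (complex_fps f) w)) holomorphic_on ball 0 (11 / 4)"
proof -
  have "(exp \<circ> eval_fps (complex_fps f)) has_fps_expansion exp_fps f"
    unfolding exp_fps_def
    by (intro has_fps_expansion_compose has_fps_expansion_exp1 complex_fps_expansion[OF bd]) (simp add: 0)
  thus "(\<lambda>w. exp (eval_fps (complex_fps f) w)) has_fps_expansion exp_fps f" by (simp add: o_def)
  show "(\<lambda>w. exp (eval_fps (complex_fps f) w)) holomorphic_on ball 0 (11 / 4)"
    using holomorphic_on_compose[OF complex_fps_holomorphic[OF bd] holomorphic_on_exp] by (simp add: o_def)
qed

text \<open>\<open>reg_coeff t\<close> are the Taylor coefficients in \<open>w\<close> of
  \<open>t powr w * (\<Prod>p>2. inverse (1 - w * p powr - (1 + t)))\<close>.\<close>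

definition reg_coeff :: "real \<Rightarrow> nat \<Rightarrow> real" where
  "reg_coeff t n = Re (exp_fps (log_coeff t) $ n)"

definition reg_coeff0 :: "nat \<Rightarrow> real" where
  "reg_coeff0 n = Re (exp_fps log_coeff0 $ n)"

text \<open>If U and V have the coefficients \<open>log_coeff0\<close> and
  \<open>log_coeff1\<close>, then V exp U is the derivative of exp (U + t V) at t = 0. The series
  are complex to make Cauchy's inequality available; their coefficients are real.\<close>

definition reg_coeff1 :: "nat \<Rightarrow> real" where
  "reg_coeff1 n = Re ((complex_fps log_coeff1 * exp_fps log_coeff0) $ n)"

lemma log_coeff_0 [simp]: "log_coeff t 0 = 0" "log_coeff0 0 = 0" "log_coeff1 0 = 0"
  by (simp_all add: log_coeff_def log_coeff0_def log_coeff1_def)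

text \<open>The exponent for parameter t is U + y with y = t V + R and R = O(t^2), so the error is
  exp U ((exp y - 1 - y) + R), and it suffices to know y = O(t) on the disc |w| \<le> 5/2.\<close>

lemma reg_coeff_expansion:
  obtains C :: real where "C > 0"
    "\<And>n. \<bar>reg_coeff0 n\<bar> \<le> C * (2 / 5) ^ n" "\<And>n. \<bar>reg_coeff1 n\<bar> \<le> C * (2 / 5) ^ n"
    "\<And>n t. 0 < t \<Longrightarrow> t \<le> 1 \<Longrightarrow>
       \<bar>reg_coeff t n - reg_coeff0 n - t * reg_coeff1 n\<bar> \<le> C * t\<^sup>2 * (2 / 5) ^ n"
proof -
  obtain B :: real where B: "B > 0"
    "\<And>m. \<bar>log_coeff0 m\<bar> \<le> B * (4 / 11) ^ m" "\<And>m. \<bar>log_coeff1 m\<bar> \<le> B * (4 / 11) ^ m"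
    "\<And>m t. 0 < t \<Longrightarrow> t \<le> 1 \<Longrightarrow>
       \<bar>log_coeff t m - log_coeff0 m - t * log_coeff1 m\<bar> \<le> B * t\<^sup>2 * (4 / 11) ^ m"
    using log_coeff_expansion by blast
  let ?U = "eval_fps (complex_fps log_coeff0)" and ?V = "eval_fps (complex_fps log_coeff1)"
  define M where "M = exp (11 * B)"
  have exp_le: "norm (exp (?U w)) \<le> M" if "norm w \<le> 5 / 2" for w
  proof -
    have "norm (exp (?U w)) \<le> exp (norm (?U w))" by (rule norm_exp)
    also have "\<dots> \<le> M" unfolding M_def using norm_eval_complex_fps_le[OF B(2) that] by simp
    finally show ?thesis .
  qed
  have M0: "M > 0" by (simp add: M_def)
  have b0: "\<bar>reg_coeff0 n\<bar> \<le> M * (2 / 5) ^ n" for n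
    unfolding reg_coeff0_def
    by (rule order_trans[OF abs_Re_le_cmod]) 
       (rule fps_coeff_Cauchy_bound[OF exp_fps_expansion exp_fps_holomorphic exp_le], auto intro: B)
  have X1: "(\<lambda>w. ?V w * exp (?U w)) has_fps_expansion (complex_fps log_coeff1 * exp_fps log_coeff0)"
    by (intro has_fps_expansion_mult complex_fps_expansion exp_fps_expansion) (auto intro: B)
  have H1: "(\<lambda>w. ?V w * exp (?U w)) holomorphic_on ball 0 (11 / 4)"
    by (intro holomorphic_on_mult complex_fps_holomorphic exp_fps_holomorphic) (auto intro: B)
  have b1: "\<bar>reg_coeff1 n\<bar> \<le> 11 * B * M * (2 / 5) ^ n" for n
    unfolding reg_coeff1_def
  proof (rule order_trans[OF abs_Re_le_cmod], rule fps_coeff_Cauchy_bound[OF X1 H1])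
    fix w :: complex assume w: "norm w \<le> 5 / 2"
    show "norm (?V w * exp (?U w)) \<le> 11 * B * M"
      unfolding norm_mult using B by (intro mult_mono norm_eval_complex_fps_le[OF B(3) w] exp_le w) auto
  qed
  \<comment> \<open>Collects the bound exp (22 B) (22 B t)^2 for exp y - 1 - y, coming from |y|
    \<le> 22 B t, and 11 B t^2 for the remainder of the logarithm.\<close>
  define D where "D = M * (exp (22 * B) * (22 * B)\<^sup>2 + 11 * B)"
  have D0: "D > 0" using M0 B by (simp add: D_def add_nonneg_pos)
  have b2: "\<bar>reg_coeff t n - reg_coeff0 n - t * reg_coeff1 n\<bar> \<le> D * t\<^sup>2 * (2 / 5) ^ n"
    if t: "0 < t" "t \<le> 1" for t n
  proof -
    define r where "r m = log_coeff t m - log_coeff0 m - t * log_coeff1 m" for m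
    let ?E = "eval_fps (complex_fps (log_coeff t))" and ?R = "eval_fps (complex_fps r)"
    have r: "\<bar>r m\<bar> \<le> B * t\<^sup>2 * (4 / 11) ^ m" for m unfolding r_def by (rule B(4)[OF t])
    have t2: "t\<^sup>2 \<le> t" using t by (simp add: power2_eq_square mult_left_le)
    \<comment> \<open>A crude bound that makes the exponent for parameter t itself analytic on the
      ball.\<close>
    have lt: "\<bar>log_coeff t m\<bar> \<le> 3 * B * (4 / 11) ^ m" for m
    proof -
      have "\<bar>log_coeff t m\<bar> \<le> \<bar>r m\<bar> + \<bar>log_coeff0 m\<bar> + t * \<bar>log_coeff1 m\<bar>"
      proof -
        have "\<bar>t * log_coeff1 m\<bar> = t * \<bar>log_coeff1 m\<bar>" using t by (simp add: abs_mult)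
        thus ?thesis unfolding r_def by linarith
      qed
      also have "\<dots> \<le> B * 1 * (4 / 11) ^ m + B * (4 / 11) ^ m + 1 * (B * (4 / 11) ^ m)"
      proof (intro add_mono mult_mono B(2,3))
        have "B * t\<^sup>2 * (4 / 11) ^ m \<le> B * 1 * (4 / 11) ^ m"
          using t2 t B by (intro mult_right_mono mult_left_mono) auto
        with r[of m] show "\<bar>r m\<bar> \<le> B * 1 * (4 / 11) ^ m" by linarith
      qed (use t in auto)
      finally show ?thesis by simp
    qed
    have Esplit: "?E w = ?U w + of_real t * ?V w + ?R w" if w: "norm w \<le> 5 / 2" for w
    proof -
      have sm: "summable (\<lambda>n. complex_fps f $ n * w ^ n)" if "\<And>n. \<bar>f n\<bar> \<le> K * (4 / 11) ^ n" for f K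
      proof (rule summable_fps)
        have "ereal (norm w) < ereal (11 / 4)" using w by simp
        also note complex_fps_conv_radius[OF that]
        finally show "ereal (norm w) < fps_conv_radius (complex_fps f)" .
      qed
      have s0: "(\<lambda>n. complex_fps log_coeff0 $ n * w ^ n) sums ?U w"
        unfolding eval_fps_def by (rule summable_sums[OF sm[OF B(2)]])
      have s1: "(\<lambda>n. complex_fps log_coeff1 $ n * w ^ n) sums ?V w"
        unfolding eval_fps_def by (rule summable_sums[OF sm[OF B(3)]])
      have s2: "(\<lambda>n. complex_fps r $ n * w ^ n) sums ?R w"
        unfolding eval_fps_def by (rule summable_sums[OF sm[OF r]])
      have "(\<lambda>n. complex_fps log_coeff0 $ n * w ^ n + of_real t * (complex_fps log_coeff1 $ n * w ^ n) +
         complex_fps r $ n * w ^ n) = (\<lambda>n. complex_fps (log_coeff t) $ n * w ^ n)"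
        by (rule ext) (simp add: r_def algebra_simps)
      with sums_add[OF sums_add[OF s0 sums_mult[OF s1]] s2]
      have "(\<lambda>n. complex_fps (log_coeff t) $ n * w ^ n) sums (?U w + of_real t * ?V w + ?R w)"
        by metis
      thus ?thesis by (subst eval_fps_def) (simp only: sums_iff)
    qed
    let ?f = "\<lambda>w. exp (?E w) - exp (?U w) - of_real t * (?V w * exp (?U w))"
    let ?F = "exp_fps (log_coeff t) - exp_fps log_coeff0 - fps_const (of_real t) * (complex_fps log_coeff1 * exp_fps log_coeff0)"
    have X: "?f has_fps_expansion ?F"
      by (intro has_fps_expansion_diff has_fps_expansion_cmult_left X1 exp_fps_expansion) (auto intro: B lt)
    have H: "?f holomorphic_on ball 0 (11 / 4)"
      by (intro holomorphic_on_diff holomorphic_on_mult[OF holomorphic_on_const] H1 exp_fps_holomorphic) (auto intro: B lt)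
    have "norm (?F $ n) \<le> D * t\<^sup>2 * (2 / 5) ^ n"
    proof (rule fps_coeff_Cauchy_bound[OF X H])
      fix w :: complex assume w: "norm w \<le> 5 / 2"
      define y where "y = of_real t * ?V w + ?R w"
      have R: "norm (?R w) \<le> 11 * (B * t\<^sup>2)" by (rule norm_eval_complex_fps_le[OF r w])
      have "norm y \<le> t * norm (?V w) + norm (?R w)"
        unfolding y_def by (rule order_trans[OF norm_triangle_ineq]) (use t in \<open>simp add: norm_mult\<close>)
      also have "\<dots> \<le> t * (11 * B) + 11 * (B * t)"
        using R norm_eval_complex_fps_le[OF B(3) w] t B t2
        by (intro add_mono mult_left_mono order_trans[OF R]) auto
      finally have y: "norm y \<le> 22 * B * t" by simp
      also have "\<dots> \<le> 22 * B" using t B by (simp add: mult_left_le)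
      finally have y': "norm y \<le> 22 * B" .
      have "norm (exp y - (1 + y)) \<le> exp (norm y) * norm y ^ 2"
        using Taylor_exp_field[of y 1] by (simp add: numeral_2_eq_2)
      also have "\<dots> \<le> exp (22 * B) * (22 * B * t) ^ 2"
        using y y' by (intro mult_mono power_mono) auto
      finally have T: "norm (exp y - (1 + y)) \<le> exp (22 * B) * (22 * B)\<^sup>2 * t\<^sup>2"
        by (simp add: power_mult_distrib mult_ac)
      have fw: "?f w = exp (?U w) * ((exp y - (1 + y)) + ?R w)"
        unfolding Esplit[OF w] y_def by (simp add: exp_add algebra_simps)
      have "norm (?f w) \<le> M * (norm (exp y - (1 + y)) + norm (?R w))"
        unfolding fw norm_mult using M0 by (intro mult_mono exp_le w norm_triangle_ineq) auto
      also have "\<dots> \<le> M * (exp (22 * B) * (22 * B)\<^sup>2 * t\<^sup>2 + 11 * (B * t\<^sup>2))"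
        using M0 by (intro mult_left_mono add_mono T R) auto
      also have "\<dots> = D * t\<^sup>2" by (simp add: D_def algebra_simps)
      finally show "norm (?f w) \<le> D * t\<^sup>2" .
    qed
    moreover have "reg_coeff t n - reg_coeff0 n - t * reg_coeff1 n = Re (?F $ n)"
      by (simp add: reg_coeff_def reg_coeff0_def reg_coeff1_def)
    ultimately show ?thesis using abs_Re_le_cmod[of "?F $ n"] by linarith
  qed
  define C where "C = M + 11 * B * M + D"
  have *: "x * c \<le> C * c" if "x \<le> C" "c \<ge> 0" for x c :: real using that by (rule mult_right_mono)
  have "M \<le> C" "11 * B * M \<le> C" "D \<le> C" "C > 0" using M0 B(1) D0 by (simp_all add: C_def add_pos_pos)
  show ?thesis
  proof (rule that[of C])
    show "C > 0" by fact
    show "\<bar>reg_coeff0 n\<bar> \<le> C * (2 / 5) ^ n" for n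
      by (rule order_trans[OF b0 *[OF \<open>M \<le> C\<close>]]) simp
    show "\<bar>reg_coeff1 n\<bar> \<le> C * (2 / 5) ^ n" for n
      by (rule order_trans[OF b1 *[OF \<open>11 * B * M \<le> C\<close>]]) simp
    show "\<bar>reg_coeff t n - reg_coeff0 n - t * reg_coeff1 n\<bar> \<le> C * t\<^sup>2 * (2 / 5) ^ n"
      if "0 < t" "t \<le> 1" for t n
      by (rule order_trans[OF b2[OF that]], unfold mult.assoc, rule *[OF \<open>D \<le> C\<close>], simp)
  qed
qed

text \<open>The summand w ln t that regularises \<open>log_coeff\<close> is removed again: it
  amounts to the factor t^-w, whose coefficients are those of \<open>fps_exp (- ln t)\<close>. The
  factorisation is checked by comparing logarithmic derivatives.\<close>

lemma almost_prime_zeta_eq_coeff: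
  assumes t: "t > 0"
  shows "almost_prime_zeta k (1 + t) =
    (fps_exp (- ln t) * fps_geometric (2 powr - (1 + t)) * Abs_fps (reg_coeff t)) $ k"
proof -
  define l where "l = ln t"
  define c where "c = 2 powr - (1 + t)"
  let ?L = "odd_log_fps (1 + t)"
  have L: "complex_fps (log_coeff t) = ?L + fps_const (of_real l) * fps_X"
    by (rule fps_ext) (auto simp: log_coeff_def odd_log_fps_def l_def)
  have neg: "fps_const (- complex_of_real l) = - fps_const (of_real l)" by simp
  have *: "(fps_exp 1 oo ?L) = fps_exp (- of_real l) * exp_fps (log_coeff t)"
  proof (rule fps_linear_ode_unique)
    show "fps_deriv (fps_exp 1 oo ?L) = fps_deriv ?L * (fps_exp 1 oo ?L)"
      by (simp add: fps_compose_deriv odd_log_fps_def mult.commute)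
    have "fps_deriv (fps_exp (- of_real l) * exp_fps (log_coeff t)) =
      (fps_deriv (complex_fps (log_coeff t)) - fps_const (of_real l)) * (fps_exp (- of_real l) * exp_fps (log_coeff t))"
      by (simp add: exp_fps_def fps_compose_deriv neg algebra_simps del: fps_const_neg)
    thus "fps_deriv (fps_exp (- of_real l) * exp_fps (log_coeff t)) =
          fps_deriv ?L * (fps_exp (- of_real l) * exp_fps (log_coeff t))"
      by (simp add: L)
  qed (simp add: exp_fps_def)
  have re: "(fps_exp (- complex_of_real l) * fps_geometric (of_real c)) $ n =
    of_real ((fps_exp (- l) * fps_geometric c) $ n)" for n
    by (simp add: fps_mult_nth)
  have "of_real (almost_prime_zeta k (1 + t)) = Abs_fps (\<lambda>k. complex_of_real (almost_prime_zeta k (1 + t))) $ k"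
    by simp
  also have "\<dots> = ((fps_exp (- of_real l) * exp_fps (log_coeff t)) * fps_geometric (of_real c)) $ k"
    using t by (subst almost_prime_zeta_fps) (auto simp: * c_def)
  also have "(fps_exp (- of_real l) * exp_fps (log_coeff t)) * fps_geometric (of_real c) =
    (fps_exp (- complex_of_real l) * fps_geometric (of_real c)) * exp_fps (log_coeff t)" by (simp only: mult_ac)
  also have "\<dots> $ k = (\<Sum>i=0..k. of_real ((fps_exp (- l) * fps_geometric c) $ i) * exp_fps (log_coeff t) $ (k - i))"
    by (subst fps_mult_nth) (simp only: re)
  finally have "almost_prime_zeta k (1 + t) =
     Re (\<Sum>i=0..k. of_real ((fps_exp (- l) * fps_geometric c) $ i) * exp_fps (log_coeff t) $ (k - i))"
    by (metis Re_complex_of_real)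
  also have "\<dots> = (\<Sum>i=0..k. (fps_exp (- l) * fps_geometric c) $ i * reg_coeff t (k - i))"
    by (simp add: reg_coeff_def)
  also have "\<dots> = (fps_exp (- l) * fps_geometric c * Abs_fps (reg_coeff t)) $ k"
    by (subst fps_mult_nth[of _ "Abs_fps (reg_coeff t)"]) simp
  finally show ?thesis by (simp add: l_def c_def)
qed

section \<open>Values of the first two coefficients\<close>

text \<open>Fubini for the double series over exponents and odd primes. Weights of growth (5/2)^n
  meet 3^-n, so powers of 5/6 times the convergent sum of (ln p)^2 / p^2 form an absolute
  majorant.\<close>

lemma odd_prime_series_swap:
  fixes w :: "nat \<Rightarrow> real"
  assumes w: "\<And>n. \<bar>w n\<bar> \<le> B * (5 / 2) ^ n" and j: "j \<le> 2"
  obtains S where "(\<lambda>n. w n * odd_prime_log_sum j (n + 2)) sums S"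
    "((\<lambda>p. ln (real p) ^ j * (\<Sum>n. w n * real p powr (- real (n + 2)))) has_sum S) odd_primes"
proof -
  define f where "f = (\<lambda>(n, p). w n * (ln (real p) ^ j * real p powr (- real (n + 2))))"
  define g where "g = (\<lambda>(n::nat, p). B * (5 / 6) ^ n * (ln (real p) ^ 2 * real p powr (- real 2)))"
  have B0: "B \<ge> 0" using w[of 0] by simp
  have fg: "norm (f (n, p)) \<le> g (n, p)" if p: "p \<in> odd_primes" for n p
  proof -
    have "norm (f (n, p)) = \<bar>w n\<bar> * (ln (real p) ^ j * real p powr (- real (n + 2)))"
      using ln_odd_prime_ge_1[OF p] by (simp add: f_def abs_mult)
    also have "\<dots> \<le> (B * (5 / 2) ^ n) * (9 * (1 / 3) ^ (n + 2) * (ln (real p) ^ 2 * real p powr (- real 2)))"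
      using B0 ln_odd_prime_ge_1[OF p] j by (intro mult_mono w odd_prime_log_power_le p) auto
    also have "\<dots> = B * ((5 / 2) ^ n * (1 / 3) ^ n) * (ln (real p) ^ 2 * real p powr (- real 2))"
      by (simp add: power_add power2_eq_square)
    also have "(5 / 2) ^ n * (1 / 3) ^ n = (5 / 6 :: real) ^ n" by (simp add: power_mult_distrib[symmetric])
    finally show ?thesis by (simp add: g_def)
  qed
  have gi: "((\<lambda>p. g (n, p)) has_sum B * (5 / 6) ^ n * odd_prime_log_sum 2 2) odd_primes" for n
    unfolding g_def prod.case by (intro has_sum_cmult_right odd_prime_log_sum_has_sum) auto
  have "summable (\<lambda>n. B * (5 / 6) ^ n * odd_prime_log_sum 2 2)"
    by (intro summable_mult summable_mult2 summable_geometric) auto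
  hence "(\<lambda>n. B * (5 / 6) ^ n * odd_prime_log_sum 2 2) summable_on UNIV"
    using B0 odd_prime_log_sum_bounds(1)[of 2 2] by (subst summable_on_UNIV_nonneg_real_iff) auto
  from summable_on_SigmaI[OF gi this] have "g summable_on UNIV \<times> odd_primes"
    using B0 by (auto simp: g_def)
  hence fa: "(\<lambda>x. norm (f x)) summable_on UNIV \<times> odd_primes"
    by (rule Infinite_Sum.abs_summable_on_comparison_test') (use fg in auto)
  hence "f summable_on UNIV \<times> odd_primes" by (rule abs_summable_summable)
  then obtain S where S: "(f has_sum S) (UNIV \<times> odd_primes)" by (auto simp: summable_on_def)
  have "((\<lambda>n. w n * odd_prime_log_sum j (n + 2)) has_sum S) UNIV"
  proof (rule has_sum_SigmaD[OF S])
    show "((\<lambda>p. f (n, p)) has_sum w n * odd_prime_log_sum j (n + 2)) odd_primes" for n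
      unfolding f_def prod.case using j by (intro has_sum_cmult_right odd_prime_log_sum_has_sum) auto
  qed
  hence 1: "(\<lambda>n. w n * odd_prime_log_sum j (n + 2)) sums S" by (rule has_sum_imp_sums)
  have S': "((\<lambda>(p, n). f (n, p)) has_sum S) (odd_primes \<times> UNIV)"
    using S by (subst (asm) has_sum_swap)
  have 2: "((\<lambda>p. ln (real p) ^ j * (\<Sum>n. w n * real p powr (- real (n + 2)))) has_sum S) odd_primes"
  proof (rule has_sum_SigmaD[OF S'])
    fix p assume p: "p \<in> odd_primes"
    have p3: "real p \<ge> 3" by (rule odd_primes_ge_3[OF p])
    let ?h = "\<lambda>n. w n * real p powr (- real (n + 2))"
    have hb: "norm (?h n) \<le> B * (5 / 6) ^ n" for n
    proof -
      have "real p powr (- real (n + 2)) \<le> 3 powr (- real (n + 2))"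
        using p3 by (intro powr_mono2') auto
      also have "\<dots> \<le> 3 powr (- real n)" by (intro powr_mono) auto
      also have "\<dots> = (1 / 3) ^ n" by (simp add: powr_minus powr_realpow power_divide inverse_eq_divide)
      finally have "\<bar>w n\<bar> * real p powr (- real (n + 2)) \<le> (B * (5 / 2) ^ n) * (1 / 3) ^ n"
        using B0 by (intro mult_mono w) auto
      also have "\<dots> = B * (5 / 6) ^ n" by (simp add: mult.assoc power_mult_distrib[symmetric])
      finally show ?thesis by (simp add: abs_mult)
    qed
    have hs: "summable (\<lambda>n. norm (?h n))"
      by (rule summable_comparison_test'[of "\<lambda>n. B * (5 / 6) ^ n"])
         (use hb in \<open>auto intro!: summable_mult summable_geometric\<close>)
    have "(?h has_sum suminf ?h) UNIV"
      by (rule norm_summable_imp_has_sum[OF hs summable_sums[OF summable_norm_cancel[OF hs]]])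
    hence "((\<lambda>n. ln (real p) ^ j * ?h n) has_sum ln (real p) ^ j * suminf ?h) UNIV"
      by (rule has_sum_cmult_right)
    thus "((\<lambda>n. (\<lambda>(p, n). f (n, p)) (p, n)) has_sum ln (real p) ^ j * suminf ?h) UNIV"
      by (simp add: f_def mult_ac)
  qed
  show ?thesis using that 1 2 by blast
qed

lemma log_series_tail_sums:
  fixes q :: real
  assumes "\<bar>q\<bar> < 1"
  shows "(\<lambda>n. q ^ (n + 2) / real (n + 2)) sums (- ln (1 - q) - q)"
proof -
  have "(\<lambda>n. - ((- (- q)) ^ n) / real n) sums ln (1 + (- q))"
    by (rule Complex_Transcendental.ln_series') (use assms in auto)
  from sums_minus[OF this] have "(\<lambda>n. q ^ n / real n) sums (- ln (1 - q))" by simp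
  hence "(\<lambda>n. q ^ (n + 2) / real (n + 2)) sums (- ln (1 - q) - (\<Sum>i<2. q ^ i / real i))"
    by (rule sums_split_initial_segment)
  thus ?thesis by (simp add: numeral_2_eq_2)
qed

lemma geometric_tail_sums:
  fixes q :: real
  assumes "\<bar>q\<bar> < 1"
  shows "(\<lambda>n. q ^ (n + 2)) sums (q\<^sup>2 / (1 - q))"
proof -
  have "(\<lambda>n. q\<^sup>2 * q ^ n) sums (q\<^sup>2 * (1 / (1 - q)))"
    by (intro sums_mult geometric_sums) (use assms in auto)
  thus ?thesis by (simp add: power2_eq_square mult_ac)
qed

lemma power_diff_bound:
  assumes "0 < x" "x \<le> (5 / 2 :: real)"
  shows "\<bar>x ^ (n + 2) - x\<bar> \<le> 10 * (5 / 2) ^ n"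
proof -
  have "x ^ (n + 2) \<le> (5 / 2) ^ (n + 2)" using assms by (intro power_mono) auto
  also have "\<dots> = 25 / 4 * (5 / 2) ^ n" by (simp add: power_add power2_eq_square)
  finally have 1: "x ^ (n + 2) \<le> 25 / 4 * (5 / 2) ^ n" .
  have 2: "x \<le> 5 / 2 * (5 / 2) ^ n"
  proof -
    have "(1 :: real) \<le> (5 / 2) ^ n" by (rule one_le_power) simp
    thus ?thesis using assms by linarith
  qed
  have "0 \<le> x ^ (n + 2)" using assms by simp
  thus ?thesis using 1 2 assms by linarith
qed

text \<open>The logarithm of the factor at p in \<open>d_fun x\<close>.\<close>

definition log_euler_factor :: "real \<Rightarrow> nat \<Rightarrow> real" where
  "log_euler_factor x p = x * ln (1 - 1 / real p) - ln (1 - x / real p)"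

text \<open>The value at w = x of the series with coefficients \<open>log_coeff1\<close>, that is,
  the derivative in t at 0 of the logarithm of the regularised product.\<close>

definition first_order_sum :: "real \<Rightarrow> real" where
  "first_order_sum x = x * (euler_mascheroni + ln 2) +
     (\<Sum>\<^sub>\<infinity>p\<in>odd_primes. x * (1 - x) * ln (real p) / ((real p - 1) * (real p - x)))"

text \<open>The coefficient at m = 1 contains minus the sum of the values
  \<open>odd_prime_log_sum 0 m / m\<close> for m \<ge> 2. Merging it with the others turns the
  weights x^m / m into (x^m - x) / m, and summing over m gives the logarithm of (1 - x/p)^-1 (1 -
  1/p)^x.\<close>

lemma log_coeff0_sums:
  assumes x: "0 < x" "x < (5 / 2 :: real)"
  shows "(\<lambda>m. log_coeff0 m * x ^ m) sums (- (x * ln 2) + (\<Sum>\<^sub>\<infinity>p\<in>odd_primes. log_euler_factor x p))"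
    and "log_euler_factor x summable_on odd_primes"
proof -
  have bd: "\<bar>(x ^ (n + 2) - x) / real (n + 2)\<bar> \<le> 10 * (5 / 2) ^ n" for n
  proof -
    have "\<bar>(x ^ (n + 2) - x) / real (n + 2)\<bar> \<le> \<bar>x ^ (n + 2) - x\<bar> / 1"
      unfolding abs_divide by (intro divide_left_mono) auto
    thus ?thesis using power_diff_bound[of x n] x by simp
  qed
  from odd_prime_series_swap[where j = 0, OF bd]
  obtain S where S: "(\<lambda>n. (x ^ (n + 2) - x) / real (n + 2) * odd_prime_log_sum 0 (n + 2)) sums S"
    "((\<lambda>p. ln (real p) ^ 0 * (\<Sum>n. (x ^ (n + 2) - x) / real (n + 2) * real p powr (- real (n + 2)))) has_sum S) odd_primes"
    by auto
  have inner: "ln (real p) ^ 0 * (\<Sum>n. (x ^ (n + 2) - x) / real (n + 2) * real p powr (- real (n + 2))) = log_euler_factor x p"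
    if p: "p \<in> odd_primes" for p
  proof -
    have p3: "real p \<ge> 3" by (rule odd_primes_ge_3[OF p])
    have pw: "real p powr (- real (n + 2)) = (1 / real p) ^ (n + 2)" for n
      using p3 by (simp only: powr_minus powr_realpow power_divide inverse_eq_divide) simp
    have "(\<lambda>n. (x / real p) ^ (n + 2) / real (n + 2) - x * ((1 / real p) ^ (n + 2) / real (n + 2))) sums
      ((- ln (1 - x / real p) - x / real p) - x * (- ln (1 - 1 / real p) - 1 / real p))"
      by (intro sums_diff sums_mult log_series_tail_sums) (use p3 x in auto)
    also have "(\<lambda>n. (x / real p) ^ (n + 2) / real (n + 2) - x * ((1 / real p) ^ (n + 2) / real (n + 2))) =
      (\<lambda>n. (x ^ (n + 2) - x) / real (n + 2) * real p powr (- real (n + 2)))"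
      unfolding pw by (rule ext) (simp add: power_divide diff_divide_distrib left_diff_distrib mult_ac del: power_Suc power_Suc2 of_nat_Suc of_nat_add)
    finally show ?thesis by (simp add: sums_iff log_euler_factor_def algebra_simps)
  qed
  have le: "(log_euler_factor x has_sum S) odd_primes"
    using S(2) by (subst (asm) has_sum_cong[OF inner]) auto
  thus "log_euler_factor x summable_on odd_primes" by (auto simp: summable_on_def)
  have S_eq: "S = (\<Sum>\<^sub>\<infinity>p\<in>odd_primes. log_euler_factor x p)"
    using infsumI[OF le] by simp
  have ols: "summable (\<lambda>n. odd_prime_log_sum 0 (n + 2) / real (n + 2))"
  proof (rule summable_comparison_test')
    show "summable (\<lambda>n. 9 * odd_prime_log_sum 2 2 * (1 / 3) ^ n)"
      by (intro summable_mult summable_geometric) auto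
    show "norm (odd_prime_log_sum 0 (n + 2) / real (n + 2)) \<le> 9 * odd_prime_log_sum 2 2 * (1 / 3) ^ n" for n
    proof -
      have b: "0 \<le> odd_prime_log_sum 0 (n + 2)" "0 \<le> odd_prime_log_sum 2 2"
        by (rule odd_prime_log_sum_bounds; simp)+
      have "odd_prime_log_sum 0 (n + 2) / real (n + 2) \<le> odd_prime_log_sum 0 (n + 2) / 1"
        using b by (intro divide_left_mono) auto
      also have "\<dots> \<le> 9 * odd_prime_log_sum 2 2 * (1 / 3) ^ (n + 2)"
        using odd_prime_log_sum_bounds(2)[of 0 "n + 2"] by simp
      also have "\<dots> \<le> 9 * odd_prime_log_sum 2 2 * (1 / 3) ^ n"
        using b by (intro mult_left_mono power_decreasing) auto
      finally show ?thesis using b by simp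
    qed
  qed
  from summable_sums[OF this]
  have T: "(\<lambda>n. odd_prime_log_sum 0 (n + 2) / real (n + 2)) sums (\<Sum>n. odd_prime_log_sum 0 (n + 2) / real (n + 2))" (is "_ sums ?T") .
  \<comment> \<open>The part x T split off here cancels against the coefficient at m = 1.\<close>
  have "(\<lambda>n. log_coeff0 (n + 2) * x ^ (n + 2)) sums (S + x * ?T)"
    using sums_add[OF S(1) sums_mult[OF T, of x]]
    by (rule back_subst[where P = "\<lambda>f. f sums _"])
       (rule ext, simp add: log_coeff0_def diff_divide_distrib left_diff_distrib del: power_Suc power_Suc2 of_nat_Suc of_nat_add)
  hence "(\<lambda>m. log_coeff0 m * x ^ m) sums (S + x * ?T + (\<Sum>i<2. log_coeff0 i * x ^ i))"
    by (subst sums_iff_shift'[symmetric, where n = 2]) simp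
  also have "S + x * ?T + (\<Sum>i<2. log_coeff0 i * x ^ i) = - (x * ln 2) + S"
    by (simp add: numeral_2_eq_2 log_coeff0_def lessThan_Suc algebra_simps)
  finally show "(\<lambda>m. log_coeff0 m * x ^ m) sums (- (x * ln 2) + (\<Sum>\<^sub>\<infinity>p\<in>odd_primes. log_euler_factor x p))"
    unfolding S_eq .
qed

text \<open>The same merging at m = 1, now with weights x - x^m. Geometric series replace
  logarithmic ones and produce the rational function of p in \<open>first_order_sum\<close>.\<close>

lemma log_coeff1_sums:
  assumes x: "0 < x" "x < (5 / 2 :: real)"
  shows "(\<lambda>m. log_coeff1 m * x ^ m) sums first_order_sum x"
    and "(\<lambda>p. x * (1 - x) * ln (real p) / ((real p - 1) * (real p - x))) summable_on odd_primes"
proof -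
  have bd: "\<bar>x - x ^ (n + 2)\<bar> \<le> 10 * (5 / 2) ^ n" for n
    using power_diff_bound[of x n] x by linarith
  from odd_prime_series_swap[where j = 1, OF bd]
  obtain S where S: "(\<lambda>n. (x - x ^ (n + 2)) * odd_prime_log_sum 1 (n + 2)) sums S"
    "((\<lambda>p. ln (real p) ^ 1 * (\<Sum>n. (x - x ^ (n + 2)) * real p powr (- real (n + 2)))) has_sum S) odd_primes"
    by auto
  have inner: "ln (real p) ^ 1 * (\<Sum>n. (x - x ^ (n + 2)) * real p powr (- real (n + 2))) =
       x * (1 - x) * ln (real p) / ((real p - 1) * (real p - x))"
    if p: "p \<in> odd_primes" for p
  proof -
    have p3: "real p \<ge> 3" by (rule odd_primes_ge_3[OF p])
    have pw: "real p powr (- real (n + 2)) = (1 / real p) ^ (n + 2)" for n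
      using p3 by (simp only: powr_minus powr_realpow power_divide inverse_eq_divide) simp
    have "(\<lambda>n. x * (1 / real p) ^ (n + 2) - (x / real p) ^ (n + 2)) sums
      (x * ((1 / real p)\<^sup>2 / (1 - 1 / real p)) - (x / real p)\<^sup>2 / (1 - x / real p))"
      by (intro sums_diff sums_mult geometric_tail_sums) (use p3 x in auto)
    also have "(\<lambda>n. x * (1 / real p) ^ (n + 2) - (x / real p) ^ (n + 2)) =
      (\<lambda>n. (x - x ^ (n + 2)) * real p powr (- real (n + 2)))"
      unfolding pw by (rule ext) (simp add: power_divide diff_divide_distrib left_diff_distrib del: power_Suc power_Suc2)
    finally have "(\<Sum>n. (x - x ^ (n + 2)) * real p powr (- real (n + 2))) =
      x * ((1 / real p)\<^sup>2 / (1 - 1 / real p)) - (x / real p)\<^sup>2 / (1 - x / real p)" by (simp add: sums_iff)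
    also have "(1 / real p)\<^sup>2 / (1 - 1 / real p) = 1 / (real p * (real p - 1))"
      using p3 by (simp add: field_simps power2_eq_square)
    also have "(x / real p)\<^sup>2 / (1 - x / real p) = x * x / (real p * (real p - x))"
      using p3 x by (simp add: field_simps power2_eq_square)
    also have "x * (1 / (real p * (real p - 1))) - x * x / (real p * (real p - x)) =
      x * (1 - x) / ((real p - 1) * (real p - x))"
    proof -
      have "real p - x \<noteq> 0" "real p - 1 \<noteq> 0" "real p \<noteq> 0" using p3 x by auto
      thus ?thesis by (simp add: divide_simps) (simp add: algebra_simps)
    qed
    finally show ?thesis by simp
  qed
  have le: "((\<lambda>p. x * (1 - x) * ln (real p) / ((real p - 1) * (real p - x))) has_sum S) odd_primes"
    using S(2) by (subst (asm) has_sum_cong[OF inner]) auto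
  thus "(\<lambda>p. x * (1 - x) * ln (real p) / ((real p - 1) * (real p - x))) summable_on odd_primes"
    by (auto simp: summable_on_def)
  have S_eq: "S = (\<Sum>\<^sub>\<infinity>p\<in>odd_primes. x * (1 - x) * ln (real p) / ((real p - 1) * (real p - x)))"
    using infsumI[OF le] by simp
  have "summable (\<lambda>n. odd_prime_log_sum 1 (n + 2))"
  proof (rule summable_comparison_test')
    show "summable (\<lambda>n. 9 * odd_prime_log_sum 2 2 * (1 / 3) ^ n)"
      by (intro summable_mult summable_geometric) auto
    show "norm (odd_prime_log_sum 1 (n + 2)) \<le> 9 * odd_prime_log_sum 2 2 * (1 / 3) ^ n" for n
    proof -
      have b: "0 \<le> odd_prime_log_sum 1 (n + 2)" "0 \<le> odd_prime_log_sum 2 2"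
        by (rule odd_prime_log_sum_bounds; simp)+
      have "odd_prime_log_sum 1 (n + 2) \<le> 9 * odd_prime_log_sum 2 2 * (1 / 3) ^ (n + 2)"
        by (rule odd_prime_log_sum_bounds) auto
      also have "\<dots> \<le> 9 * odd_prime_log_sum 2 2 * (1 / 3) ^ n"
        using b by (intro mult_left_mono power_decreasing) auto
      finally show ?thesis using b by simp
    qed
  qed
  from summable_sums[OF this]
  have T: "(\<lambda>n. odd_prime_log_sum 1 (n + 2)) sums (\<Sum>n. odd_prime_log_sum 1 (n + 2))" (is "_ sums ?T") .
  have "(\<lambda>n. log_coeff1 (n + 2) * x ^ (n + 2)) sums (S - x * ?T)"
    using sums_diff[OF S(1) sums_mult[OF T, of x]]
    by (rule back_subst[where P = "\<lambda>f. f sums _"])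
       (rule ext, simp add: log_coeff1_def left_diff_distrib del: power_Suc power_Suc2)
  hence "(\<lambda>m. log_coeff1 m * x ^ m) sums (S - x * ?T + (\<Sum>i<2. log_coeff1 i * x ^ i))"
    by (subst sums_iff_shift'[symmetric, where n = 2]) simp
  also have "S - x * ?T + (\<Sum>i<2. log_coeff1 i * x ^ i) = first_order_sum x"
    unfolding first_order_sum_def S_eq[symmetric]
    by (simp add: numeral_2_eq_2 log_coeff1_def lessThan_Suc algebra_simps)
  finally show "(\<lambda>m. log_coeff1 m * x ^ m) sums first_order_sum x" .
qed

lemma d_fun_product:
  assumes x: "0 < x" "x < (5 / 2 :: real)"
  shows "convergent_prod (\<lambda>p::nat. if prime p \<and> p > 2 then inverse (1 - x / real p) * (1 - 1 / real p) powr x else 1)"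
    and "d_fun x = exp (- (x * ln 2) + (\<Sum>\<^sub>\<infinity>p\<in>odd_primes. log_euler_factor x p))"
proof -
  define h where "h p = (if p \<in> odd_primes then log_euler_factor x p else 0)" for p
  have "((log_euler_factor x) has_sum (\<Sum>\<^sub>\<infinity>p\<in>odd_primes. log_euler_factor x p)) odd_primes"
    by (rule has_sum_infsum[OF log_coeff0_sums(2)[OF x]])
  also have "?this \<longleftrightarrow> (h has_sum (\<Sum>\<^sub>\<infinity>p\<in>odd_primes. log_euler_factor x p)) UNIV"
    by (rule has_sum_cong_neutral) (auto simp: h_def)
  finally have h: "h sums (\<Sum>\<^sub>\<infinity>p\<in>odd_primes. log_euler_factor x p)" by (rule has_sum_imp_sums)
  have eq: "(\<lambda>p::nat. if prime p \<and> p > 2 then inverse (1 - x / real p) * (1 - 1 / real p) powr x else 1) = (\<lambda>p. exp (h p))"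
  proof
    fix p :: nat
    show "(if prime p \<and> p > 2 then inverse (1 - x / real p) * (1 - 1 / real p) powr x else 1) = exp (h p)"
    proof (cases "p \<in> odd_primes")
      case True
      have p3: "real p \<ge> 3" by (rule odd_primes_ge_3[OF True])
      hence "1 - x / real p > 0" "1 - 1 / real p > 0" using x by auto
      hence "exp (log_euler_factor x p) = inverse (1 - x / real p) * (1 - 1 / real p) powr x"
        using p3 by (simp add: log_euler_factor_def exp_diff powr_def inverse_eq_divide)
      thus ?thesis using True by (simp add: h_def odd_primes_def)
    qed (auto simp: h_def odd_primes_def)
  qed
  show "convergent_prod (\<lambda>p::nat. if prime p \<and> p > 2 then inverse (1 - x / real p) * (1 - 1 / real p) powr x else 1)"
    unfolding eq by (rule convergent_prod_exp[OF sums_summable[OF h]])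
  have "d_fun x = 2 powr (- x) * exp (suminf h)"
    unfolding d_fun_def eq by (subst prodinf_exp[OF sums_summable[OF h]]) simp
  also have "2 powr (- x) = exp (- (x * ln 2))" by (simp add: powr_def)
  finally show "d_fun x = exp (- (x * ln 2) + (\<Sum>\<^sub>\<infinity>p\<in>odd_primes. log_euler_factor x p))"
    using h by (simp only: sums_iff exp_add)
qed

text \<open>The series converge for |w| < 11/4 to exp U and V exp U, whose values at real x are
  known from \<open>log_coeff0_sums\<close> and \<open>log_coeff1_sums\<close>.\<close>

lemma reg_coeff_sums:
  assumes x: "0 < x" "x < (5 / 2 :: real)"
  shows "(\<lambda>n. reg_coeff0 n * x ^ n) sums d_fun x"
    and "(\<lambda>n. reg_coeff1 n * x ^ n) sums (first_order_sum x * d_fun x)"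
proof -
  obtain B :: real where B: "B > 0"
    "\<And>m. \<bar>log_coeff0 m\<bar> \<le> B * (4 / 11) ^ m" "\<And>m. \<bar>log_coeff1 m\<bar> \<le> B * (4 / 11) ^ m"
    using log_coeff_expansion by metis
  let ?U = "eval_fps (complex_fps log_coeff0)" and ?V = "eval_fps (complex_fps log_coeff1)"
  have ev: "eval_fps (complex_fps f) (of_real x) = of_real s" if "(\<lambda>m. f m * x ^ m) sums s" for f s
  proof -
    have "(\<lambda>m. complex_of_real (f m * x ^ m)) sums of_real s" using that by (subst sums_of_real_iff)
    thus ?thesis by (simp add: eval_fps_def sums_iff)
  qed
  have re: "(\<lambda>n. Re (F $ n) * x ^ n) sums s"
    if X: "f has_fps_expansion F" "f holomorphic_on ball 0 (11 / 4)" "f (of_real x) = of_real s" for f F s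
  proof -
    have "f holomorphic_on eball 0 (ereal (11 / 4))" using X(2) by simp
    from has_fps_expansion_imp_sums_complex[OF X(1) this, of "of_real x"]
    have "(\<lambda>n. F $ n * of_real x ^ n) sums of_real s" using x X(3) by simp
    from sums_Re[OF this] show ?thesis by (simp flip: of_real_power)
  qed
  have e0: "exp (?U (of_real x)) = of_real (d_fun x)"
    unfolding ev[OF log_coeff0_sums(1)[OF x]] d_fun_product(2)[OF x] by (simp only: exp_of_real)
  show "(\<lambda>n. reg_coeff0 n * x ^ n) sums d_fun x"
    unfolding reg_coeff0_def
    by (rule re[OF exp_fps_expansion exp_fps_holomorphic e0]) (auto intro: B)
  show "(\<lambda>n. reg_coeff1 n * x ^ n) sums (first_order_sum x * d_fun x)"
    unfolding reg_coeff1_def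
  proof (rule re[where f = "\<lambda>w. ?V w * exp (?U w)"])
    show "(\<lambda>w. ?V w * exp (?U w)) has_fps_expansion complex_fps log_coeff1 * exp_fps log_coeff0"
      by (intro has_fps_expansion_mult complex_fps_expansion exp_fps_expansion) (auto intro: B)
    show "(\<lambda>w. ?V w * exp (?U w)) holomorphic_on ball 0 (11 / 4)"
      by (intro holomorphic_on_mult complex_fps_holomorphic exp_fps_holomorphic) (auto intro: B)
    show "?V (of_real x) * exp (?U (of_real x)) = of_real (first_order_sum x * d_fun x)"
      unfolding e0 ev[OF log_coeff1_sums(1)[OF x]] by simp
  qed
qed

lemma d_fun_1: "d_fun 1 = 1 / 2"
proof -
  have "(\<lambda>p::nat. if prime p \<and> p > 2 then inverse (1 - 1 / real p) * (1 - 1 / real p) powr 1 else 1) = (\<lambda>_. 1)"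
    by (rule ext) auto
  thus ?thesis by (simp add: d_fun_def powr_minus)
qed

text \<open>The two products differ at the prime 2 only: there \<open>d_fun\<close> carries (1 -
  1/2)^z as its factor 2^-z but omits (1 - z/2)^-1.\<close>

lemma G_fun_eq_d_fun:
  assumes z: "0 < z" "z < 2"
  shows "G_fun z = d_fun z / ((1 - z / 2) * Gamma (1 + z))"
proof -
  define g where "g = (\<lambda>p::nat. if prime p \<and> p > 2 then inverse (1 - z / real p) * (1 - 1 / real p) powr z else 1)"
  define h where "h = (\<lambda>p::nat. if p = 2 then inverse (1 - z / 2) * (1 / 2) powr z else 1)"
  have h: "convergent_prod h" "prodinf h = inverse (1 - z / 2) * (1 / 2) powr z"
    using convergent_prod_finite[of "{2}" h] prodinf_finite[of "{2}" h] by (simp_all add: h_def)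
  have g: "convergent_prod g" unfolding g_def by (rule d_fun_product) (use z in auto)
  have "(\<lambda>p::nat. if prime p then inverse (1 - z / real p) * (1 - 1 / real p) powr z else 1) = (\<lambda>p. g p * h p)"
  proof
    fix p :: nat
    have "prime p \<Longrightarrow> p \<noteq> 2 \<Longrightarrow> p > 2" using prime_ge_2_nat[of p] by linarith
    thus "(if prime p then inverse (1 - z / real p) * (1 - 1 / real p) powr z else 1) = g p * h p"
      by (auto simp: g_def h_def)
  qed
  hence "(\<Prod>p. if prime p then inverse (1 - z / real p) * (1 - 1 / real p) powr z else 1) = prodinf g * prodinf h"
    by (simp add: prodinf_mult[OF g h(1)])
  also have "(1 / 2) powr z = 2 powr (- z)" by (simp add: powr_divide powr_minus_divide)
  hence "prodinf g * prodinf h = d_fun z * inverse (1 - z / 2)"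
    unfolding h(2) d_fun_def g_def by (simp add: mult_ac)
  finally show ?thesis by (simp add: G_fun_def divide_simps)
qed

section \<open>Coefficients after restoring the prime 2\<close>

text \<open>Dividing by \<open>1 - w * 2 powr - (1 + t)\<close> turns \<open>reg_coeff t\<close> into \<open>\<lambda>n. pole_coeff t n / 2 ^ n\<close>;
  \<open>pole_coeff0\<close> and \<open>pole_coeff1\<close> are the value and the derivative of \<open>pole_coeff\<close> at \<open>t = 0\<close>.\<close>

definition pole_coeff :: "real \<Rightarrow> nat \<Rightarrow> real" where
  "pole_coeff t n = (\<Sum>i\<le>n. reg_coeff t i * 2 ^ i * exp (- (t * ln 2 * real (n - i))))"

definition pole_coeff0 :: "nat \<Rightarrow> real" where
  "pole_coeff0 n = (\<Sum>i\<le>n. reg_coeff0 i * 2 ^ i)"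

definition pole_coeff1 :: "nat \<Rightarrow> real" where
  "pole_coeff1 n = (\<Sum>i\<le>n. (reg_coeff1 i - ln 2 * real (n - i) * reg_coeff0 i) * 2 ^ i)"

text \<open>Multiplying by 2^k moves the singularity of the factor at 2 close to 1, because twice
  2^-(1 + t) is exp (- t ln 2); the factor t^-w contributes weights of Poisson type.\<close>

lemma almost_prime_zeta_eq_pole_coeff:
  assumes t: "t > 0"
  shows "2 ^ k * almost_prime_zeta k (1 + t) = (\<Sum>m\<le>k. (2 * - ln t) ^ m / fact m * pole_coeff t (k - m))"
proof -
  define c where "c = 2 powr - (1 + t)"
  have c2: "2 * c = exp (- (t * ln 2))"
  proof -
    have "2 * c = 2 powr 1 * 2 powr - (1 + t)" by (simp add: c_def)
    also have "\<dots> = 2 powr (1 + - (1 + t))" by (rule powr_add[symmetric])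
    finally show ?thesis by (simp add: powr_def)
  qed
  have inner: "2 ^ n * (fps_geometric c * Abs_fps (reg_coeff t)) $ n = pole_coeff t n" for n
  proof -
    have "(fps_geometric c * Abs_fps (reg_coeff t)) $ n = (\<Sum>i=0..n. reg_coeff t i * c ^ (n - i))"
      by (subst mult.commute) (simp add: fps_mult_nth)
    also have "2 ^ n * \<dots> = (\<Sum>i=0..n. reg_coeff t i * 2 ^ i * (2 * c) ^ (n - i))"
      unfolding sum_distrib_left
    proof (intro sum.cong refl)
      fix i assume "i \<in> {0..n}"
      hence "(2::real) ^ n = 2 ^ i * 2 ^ (n - i)" by (simp flip: power_add)
      thus "2 ^ n * (reg_coeff t i * c ^ (n - i)) = reg_coeff t i * 2 ^ i * (2 * c) ^ (n - i)"
        by (simp add: power_mult_distrib mult_ac)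
    qed
    also have "\<dots> = pole_coeff t n"
      unfolding pole_coeff_def c2 atMost_atLeast0
      by (intro sum.cong refl) (simp add: exp_of_nat_mult[symmetric] mult_ac)
    finally show ?thesis .
  qed
  have "2 ^ k * almost_prime_zeta k (1 + t) =
     2 ^ k * (fps_exp (- ln t) * (fps_geometric c * Abs_fps (reg_coeff t))) $ k"
    unfolding almost_prime_zeta_eq_coeff[OF t] c_def by (simp only: mult.assoc)
  also have "\<dots> = (\<Sum>m\<le>k. 2 ^ k * ((- ln t) ^ m / fact m * (fps_geometric c * Abs_fps (reg_coeff t)) $ (k - m)))"
    by (subst fps_mult_nth) (simp only: sum_distrib_left atMost_atLeast0 fps_exp_nth of_nat_fact)
  also have "\<dots> = (\<Sum>m\<le>k. (2 * - ln t) ^ m / fact m * pole_coeff t (k - m))"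
  proof (intro sum.cong refl)
    fix m assume "m \<in> {..k}"
    hence "(2::real) ^ k = 2 ^ m * 2 ^ (k - m)" by (simp flip: power_add)
    thus "2 ^ k * ((- ln t) ^ m / fact m * (fps_geometric c * Abs_fps (reg_coeff t)) $ (k - m)) =
      (2 * - ln t) ^ m / fact m * pole_coeff t (k - m)"
      unfolding inner[symmetric] power_mult_distrib by (simp add: mult_ac)
  qed
  finally show ?thesis .
qed

lemma sum_geometric_le_5: "(\<Sum>i\<le>n. (4 / 5 :: real) ^ i) \<le> 5"
  using sum_le_suminf[OF summable_geometric[of "4 / 5 :: real"], of "{..n}"]
  by (simp add: suminf_geometric)

text \<open>After scaling, the ratio 2/5 becomes 4/5, so the sums over i are bounded uniformly in n.
  The powers of n + 1 stem from expanding exp (- t ln 2 (n - i)) in t.\<close>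

lemma pole_coeff_bounds:
  obtains C :: real where "C > 0"
    "\<And>n. \<bar>pole_coeff0 n\<bar> \<le> C" "\<And>n. \<bar>pole_coeff1 n\<bar> \<le> C * (real n + 1)"
    "\<And>n t. 0 < t \<Longrightarrow> t \<le> 1 \<Longrightarrow> \<bar>pole_coeff t n\<bar> \<le> C"
    "\<And>n t. 0 < t \<Longrightarrow> t \<le> 1 \<Longrightarrow>
       \<bar>pole_coeff t n - (pole_coeff0 n + t * pole_coeff1 n)\<bar> \<le> C * t\<^sup>2 * (real n + 1)\<^sup>2"
proof -
  obtain B :: real where B: "B > 0"
    "\<And>n. \<bar>reg_coeff0 n\<bar> \<le> B * (2 / 5) ^ n" "\<And>n. \<bar>reg_coeff1 n\<bar> \<le> B * (2 / 5) ^ n"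
    "\<And>n t. 0 < t \<Longrightarrow> t \<le> 1 \<Longrightarrow>
       \<bar>reg_coeff t n - reg_coeff0 n - t * reg_coeff1 n\<bar> \<le> B * t\<^sup>2 * (2 / 5) ^ n"
    using reg_coeff_expansion by blast
  have L: "0 \<le> ln (2 :: real)" "ln 2 \<le> (1 :: real)" using ln_2_less_1 by auto
  have scale: "(2 / 5) ^ i * 2 ^ i = (4 / 5 :: real) ^ i" for i
    by (simp add: power_mult_distrib[symmetric])
  have sum_bound: "\<bar>\<Sum>i\<le>n. f i * 2 ^ i\<bar> \<le> 5 * K" if "\<And>i. i \<le> n \<Longrightarrow> \<bar>f i\<bar> \<le> K * (2 / 5) ^ i" "K \<ge> 0"
    for f :: "nat \<Rightarrow> real" and K n
  proof -
    have "\<bar>\<Sum>i\<le>n. f i * 2 ^ i\<bar> \<le> (\<Sum>i\<le>n. K * (4 / 5) ^ i)"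
    proof (rule order_trans[OF sum_abs], rule sum_mono)
      fix i assume "i \<in> {..n}"
      hence "\<bar>f i\<bar> * 2 ^ i \<le> K * (2 / 5) ^ i * 2 ^ i" using that by (intro mult_right_mono) auto
      thus "\<bar>f i * 2 ^ i\<bar> \<le> K * (4 / 5) ^ i" by (simp only: abs_mult mult.assoc scale) simp
    qed
    also have "\<dots> \<le> K * 5" unfolding sum_distrib_left[symmetric]
      by (intro mult_left_mono sum_geometric_le_5 that)
    finally show ?thesis by simp
  qed
  have b0: "\<bar>pole_coeff0 n\<bar> \<le> 5 * B" for n
    unfolding pole_coeff0_def by (rule sum_bound) (use B in auto)
  have b1: "\<bar>pole_coeff1 n\<bar> \<le> 5 * (B * (real n + 1))" for n
    unfolding pole_coeff1_def
  proof (rule sum_bound)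
    fix i assume i: "i \<le> n"
    have "\<bar>reg_coeff1 i - ln 2 * real (n - i) * reg_coeff0 i\<bar> \<le>
          \<bar>reg_coeff1 i\<bar> + ln 2 * real (n - i) * \<bar>reg_coeff0 i\<bar>"
      using L by (intro order_trans[OF abs_triangle_ineq4]) (simp add: abs_mult)
    also have "\<dots> \<le> B * (2 / 5) ^ i + 1 * real n * (B * (2 / 5) ^ i)"
      using L B by (intro add_mono mult_mono B) auto
    finally show "\<bar>reg_coeff1 i - ln 2 * real (n - i) * reg_coeff0 i\<bar> \<le> B * (real n + 1) * (2 / 5) ^ i"
      by (simp add: algebra_simps)
  qed (use B in auto)
  have bt: "\<bar>pole_coeff t n\<bar> \<le> 5 * (3 * B)" if t: "0 < t" "t \<le> 1" for t n
  proof -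
    have "pole_coeff t n = (\<Sum>i\<le>n. (reg_coeff t i * exp (- (t * ln 2 * real (n - i)))) * 2 ^ i)"
      by (simp add: pole_coeff_def mult_ac)
    also have "\<bar>\<dots>\<bar> \<le> 5 * (3 * B)"
    proof (rule sum_bound)
      fix i
      have "\<bar>t * reg_coeff1 i\<bar> \<le> 1 * (B * (2 / 5) ^ i)"
        unfolding abs_mult using t by (intro mult_mono B) auto
      moreover have "B * t\<^sup>2 * (2 / 5) ^ i \<le> B * 1 * (2 / 5) ^ i"
        using t B by (intro mult_right_mono mult_left_mono) (auto simp: power_le_one)
      ultimately have "\<bar>reg_coeff t i\<bar> \<le> 3 * B * (2 / 5) ^ i"
        using B(2)[of i] B(4)[OF t, of i] by linarith
      hence "\<bar>reg_coeff t i\<bar> * exp (- (t * ln 2 * real (n - i))) \<le> 3 * B * (2 / 5) ^ i * 1"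
        using t L B by (intro mult_mono) auto
      thus "\<bar>reg_coeff t i * exp (- (t * ln 2 * real (n - i)))\<bar> \<le> 3 * B * (2 / 5) ^ i"
        by (simp add: abs_mult)
    qed (use B in auto)
    finally show ?thesis .
  qed
  have b2: "\<bar>pole_coeff t n - (pole_coeff0 n + t * pole_coeff1 n)\<bar> \<le> 5 * (B * t\<^sup>2 * (real n + 1)\<^sup>2)"
    if t: "0 < t" "t \<le> 1" for t n
  proof -
    define y where "y i = t * ln 2 * real (n - i)" for i
    define r where "r i = reg_coeff t i - reg_coeff0 i - t * reg_coeff1 i" for i
    \<comment> \<open>With y = t ln 2 (n - i), the difference consists of the second order error of
      exp (- y) on \<open>reg_coeff0\<close>, the first order error on t times
      \<open>reg_coeff1\<close>, and the error of \<open>reg_coeff t\<close> itself; each is O(t^2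
      (n + 1)^2).\<close>
    have "pole_coeff t n - (pole_coeff0 n + t * pole_coeff1 n) =
      (\<Sum>i\<le>n. (reg_coeff0 i * (exp (- y i) - 1 + y i) + t * reg_coeff1 i * (exp (- y i) - 1) + r i * exp (- y i)) * 2 ^ i)"
      unfolding pole_coeff_def pole_coeff0_def pole_coeff1_def sum_distrib_left sum.distrib[symmetric] sum_subtractf[symmetric]
      by (intro sum.cong refl) (simp add: y_def r_def algebra_simps)
    also have "\<bar>\<dots>\<bar> \<le> 5 * (B * t\<^sup>2 * (real n + 1)\<^sup>2)"
    proof (rule sum_bound)
      fix i assume i: "i \<le> n"
      have y0: "y i \<ge> 0" using t L by (simp add: y_def)
      have yn: "y i \<le> t * real n"
        unfolding y_def using t L by (intro mult_mono) (auto simp: mult_left_le)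
      have e1: "\<bar>exp (- y i) - 1 + y i\<bar> \<le> (t * real n)\<^sup>2"
      proof -
        have "(y i)\<^sup>2 \<le> (t * real n)\<^sup>2" using y0 yn by (intro power_mono)
        thus ?thesis using exp_minus_Taylor_bounds[OF y0] by simp
      qed
      have rb: "\<bar>r i\<bar> \<le> B * t\<^sup>2 * (2 / 5) ^ i" unfolding r_def by (rule B(4)[OF t])
      have e2: "\<bar>exp (- y i) - 1\<bar> \<le> t * real n"
        using exp_minus_Taylor_bounds(1)[OF y0] yn y0 by (simp add: abs_le_iff)
      have "\<bar>reg_coeff0 i * (exp (- y i) - 1 + y i) + t * reg_coeff1 i * (exp (- y i) - 1) + r i * exp (- y i)\<bar> \<le>
         \<bar>reg_coeff0 i\<bar> * \<bar>exp (- y i) - 1 + y i\<bar> + t * \<bar>reg_coeff1 i\<bar> * \<bar>exp (- y i) - 1\<bar> + \<bar>r i\<bar> * exp (- y i)"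
        by (intro order_trans[OF abs_triangle_ineq] add_mono) (use t in \<open>auto simp: abs_mult\<close>)
      also have "\<dots> \<le> (B * (2 / 5) ^ i) * (t * real n)\<^sup>2 + t * (B * (2 / 5) ^ i) * (t * real n) + (B * t\<^sup>2 * (2 / 5) ^ i) * 1"
        using t y0 B(1) by (intro add_mono mult_mono B(2,3) rb e1 e2) auto
      also have "\<dots> = B * t\<^sup>2 * (2 / 5) ^ i * ((real n)\<^sup>2 + real n + 1)"
        by (simp add: power2_eq_square algebra_simps)
      also have "\<dots> \<le> B * t\<^sup>2 * (2 / 5) ^ i * (real n + 1)\<^sup>2"
        using B(1) by (intro mult_left_mono) (auto simp: power2_sum)
      finally show "\<bar>reg_coeff0 i * (exp (- y i) - 1 + y i) + t * reg_coeff1 i * (exp (- y i) - 1) + r i * exp (- y i)\<bar>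
         \<le> B * t\<^sup>2 * (real n + 1)\<^sup>2 * (2 / 5) ^ i" by (simp add: mult_ac)
    qed (use B in auto)
    finally show ?thesis .
  qed
  show ?thesis
  proof (rule that[of "15 * B"])
    show "15 * B > 0" using B by simp
    show "\<bar>pole_coeff0 n\<bar> \<le> 15 * B" for n using b0[of n] B(1) by linarith
    show "\<bar>pole_coeff1 n\<bar> \<le> 15 * B * (real n + 1)" for n
    proof -
      have "0 \<le> B * (real n + 1)" using B(1) by simp
      thus ?thesis using b1[of n] by linarith
    qed
    show "\<bar>pole_coeff t n\<bar> \<le> 15 * B" if "0 < t" "t \<le> 1" for t n using bt[OF that, of n] by linarith
    show "\<bar>pole_coeff t n - (pole_coeff0 n + t * pole_coeff1 n)\<bar> \<le> 15 * B * t\<^sup>2 * (real n + 1)\<^sup>2"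
      if "0 < t" "t \<le> 1" for t n
    proof -
      have "0 \<le> B * t\<^sup>2 * (real n + 1)\<^sup>2" using B(1) by simp
      thus ?thesis using b2[OF that, of n] by linarith
    qed
  qed
qed

section \<open>Sums weighted by x^m / m!\<close>

lemma sum_power_fact_le_exp:
  fixes x :: real
  assumes "x \<ge> 0"
  shows "(\<Sum>m\<le>k. x ^ m / fact m) \<le> exp x"
proof -
  have "(\<lambda>m. x ^ m / fact m) sums exp x"
    using exp_converges[of x] by (simp add: divide_inverse mult.commute)
  hence "summable (\<lambda>m. x ^ m / fact m)" "(\<Sum>m. x ^ m / fact m) = exp x" by (simp_all add: sums_iff)
  thus ?thesis using sum_le_suminf[of "\<lambda>m. x ^ m / fact m" "{..k}"] assms by simp
qed

lemma exp_convolution_bound: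
  fixes x K :: real
  assumes "x \<ge> 0" "\<And>m. m \<le> k \<Longrightarrow> \<bar>f m\<bar> \<le> K"
  shows "\<bar>\<Sum>m\<le>k. x ^ m / fact m * f m\<bar> \<le> exp x * K"
proof -
  have K0: "K \<ge> 0" using assms(2)[of 0] by linarith
  have "\<bar>\<Sum>m\<le>k. x ^ m / fact m * f m\<bar> \<le> (\<Sum>m\<le>k. x ^ m / fact m * K)"
  proof (rule order_trans[OF sum_abs], rule sum_mono)
    fix m assume "m \<in> {..k}"
    hence "x ^ m / fact m * \<bar>f m\<bar> \<le> x ^ m / fact m * K"
      using assms by (intro mult_left_mono) auto
    thus "\<bar>x ^ m / fact m * f m\<bar> \<le> x ^ m / fact m * K"
      using assms(1) by (simp add: abs_mult)
  qed
  also have "\<dots> \<le> exp x * K" unfolding sum_distrib_right[symmetric]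
    by (intro mult_right_mono sum_power_fact_le_exp assms K0)
  finally show ?thesis .
qed

text \<open>The weights have sum at most exp (2 ln (1/t)) = t^-2. Bounded coefficients give the
  first estimate, and in the second one the factor t^2 of the coefficient error is
  cancelled.\<close>

lemma almost_prime_zeta_near_one:
  obtains C :: real where "C > 0"
    "\<And>k t. 0 < t \<Longrightarrow> t \<le> 1 \<Longrightarrow> 2 ^ k * almost_prime_zeta k (1 + t) \<le> C / t\<^sup>2"
    "\<And>k t. 0 < t \<Longrightarrow> t \<le> 1 \<Longrightarrow> \<bar>2 ^ k * almost_prime_zeta k (1 + t) -
        (\<Sum>m\<le>k. (2 * - ln t) ^ m / fact m * (pole_coeff0 (k - m) + t * pole_coeff1 (k - m)))\<bar> \<le> C * (real k + 1)\<^sup>2"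
proof -
  obtain C :: real where C: "C > 0"
    "\<And>n. \<bar>pole_coeff0 n\<bar> \<le> C" "\<And>n. \<bar>pole_coeff1 n\<bar> \<le> C * (real n + 1)"
    "\<And>n t. 0 < t \<Longrightarrow> t \<le> 1 \<Longrightarrow> \<bar>pole_coeff t n\<bar> \<le> C"
    "\<And>n t. 0 < t \<Longrightarrow> t \<le> 1 \<Longrightarrow>
       \<bar>pole_coeff t n - (pole_coeff0 n + t * pole_coeff1 n)\<bar> \<le> C * t\<^sup>2 * (real n + 1)\<^sup>2"
    using pole_coeff_bounds by blast
  have ex: "exp (2 * - ln t) = 1 / t\<^sup>2" if "t > 0" for t :: real
  proof -
    have "exp (2 * - ln t) = inverse (exp (ln t) * exp (ln t))"
      by (simp only: exp_add[symmetric] exp_minus[symmetric]) simp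
    thus ?thesis using that by (simp add: power2_eq_square inverse_eq_divide)
  qed
  show ?thesis
  proof (rule that[OF C(1)])
    fix k :: nat and t :: real assume t: "0 < t" "t \<le> 1"
    have l: "2 * - ln t \<ge> 0" using t by simp
    show "2 ^ k * almost_prime_zeta k (1 + t) \<le> C / t\<^sup>2"
      using exp_convolution_bound[OF l, of k "\<lambda>m. pole_coeff t (k - m)" C] C(4)[OF t]
      unfolding almost_prime_zeta_eq_pole_coeff[OF t(1)] ex[OF t(1)] by (simp add: abs_le_iff)
    have "\<bar>\<Sum>m\<le>k. (2 * - ln t) ^ m / fact m * (pole_coeff t (k - m) - (pole_coeff0 (k - m) + t * pole_coeff1 (k - m)))\<bar>
       \<le> exp (2 * - ln t) * (C * t\<^sup>2 * (real k + 1)\<^sup>2)"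
    proof (rule exp_convolution_bound[OF l])
      fix m
      have "C * t\<^sup>2 * (real (k - m) + 1)\<^sup>2 \<le> C * t\<^sup>2 * (real k + 1)\<^sup>2"
        using C(1) by (intro mult_left_mono power_mono) auto
      with C(5)[OF t, of "k - m"]
      show "\<bar>pole_coeff t (k - m) - (pole_coeff0 (k - m) + t * pole_coeff1 (k - m))\<bar> \<le> C * t\<^sup>2 * (real k + 1)\<^sup>2"
        by linarith
    qed
    thus "\<bar>2 ^ k * almost_prime_zeta k (1 + t) -
        (\<Sum>m\<le>k. (2 * - ln t) ^ m / fact m * (pole_coeff0 (k - m) + t * pole_coeff1 (k - m)))\<bar> \<le> C * (real k + 1)\<^sup>2"
      unfolding almost_prime_zeta_eq_pole_coeff[OF t(1)] ex[OF t(1)]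
      using t by (simp add: sum_subtractf[symmetric] right_diff_distrib)
  qed
qed

section \<open>Integrals\<close>

lemma nn_integral_Gamma_scaled:
  fixes z c :: real
  assumes z: "z > 0" and c: "c > 0"
  shows "(\<integral>\<^sup>+t. ennreal (indicator {0<..} t * (t powr (z - 1) * exp (- (c * t)))) \<partial>lborel) = ennreal (Gamma z / c powr z)"
proof -
  let ?g = "\<lambda>t. ennreal (indicator {0..} t * t powr (z - 1) / exp t)"
  have "(\<integral>\<^sup>+t. ennreal (indicator {0<..} t * (t powr (z - 1) * exp (- (c * t)))) \<partial>lborel) =
        (\<integral>\<^sup>+t. ennreal (1 / c powr (z - 1)) * ?g (0 + c * t) \<partial>lborel)"
  proof (rule nn_integral_cong)
    fix t :: real
    have "(c * t) powr (z - 1) = c powr (z - 1) * t powr (z - 1)" if "t > 0"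
      using c that by (simp add: powr_mult)
    hence "indicator {0<..} t * (t powr (z - 1) * exp (- (c * t))) =
           1 / c powr (z - 1) * (indicator {0..} (0 + c * t) * (0 + c * t) powr (z - 1) / exp (0 + c * t))"
      using c by (cases "t > 0"; cases "t = 0")
        (auto simp: indicator_def exp_minus field_simps mult_less_0_iff zero_le_mult_iff)
    thus "ennreal (indicator {0<..} t * (t powr (z - 1) * exp (- (c * t)))) =
          ennreal (1 / c powr (z - 1)) * ?g (0 + c * t)"
      by (simp only:) (rule ennreal_mult', simp)
  qed
  also have "\<dots> = ennreal (1 / c powr (z - 1)) * (\<integral>\<^sup>+t. ?g (0 + c * t) \<partial>lborel)"
    by (rule nn_integral_cmult) simp
  also have "ennreal (Gamma z) = ennreal c * (\<integral>\<^sup>+t. ?g (0 + c * t) \<partial>lborel)"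
    unfolding Gamma_conv_nn_integral_real[OF z]
    using c by (subst nn_integral_real_affine[where c = c and t = 0]) auto
  hence "(\<integral>\<^sup>+t. ?g (0 + c * t) \<partial>lborel) = ennreal (1 / c) * ennreal (Gamma z)"
    using c by (simp add: mult.assoc[symmetric] ennreal_mult'[symmetric] del: ennreal_1) simp
  also have "ennreal (1 / c powr (z - 1)) * (ennreal (1 / c) * ennreal (Gamma z)) =
     ennreal (1 / c powr (z - 1) * (1 / c * Gamma z))"
    using c z by (simp add: ennreal_mult'[symmetric])
  also have "1 / c powr (z - 1) * (1 / c * Gamma z) = Gamma z / c powr z"
    using c by (simp add: powr_diff)
  finally show ?thesis .
qed

text \<open>For x = n, summed over almost primes n, this is the Mellin representation of the terms 1
  / (n (ln n)^z).\<close>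

lemma has_bochner_integral_powr_Gamma:
  fixes z x :: real
  assumes z: "z > 0" and x: "x > 1"
  shows "has_bochner_integral lborel (\<lambda>t. indicator {0<..} t * (t powr (z - 1) * x powr - (1 + t))) (Gamma z / (x * ln x powr z))"
proof (rule has_bochner_integral_nn_integral)
  have eq: "indicator {0<..} t * (t powr (z - 1) * x powr - (1 + t)) =
        1 / x * (indicator {0<..} t * (t powr (z - 1) * exp (- (ln x * t))))" for t
  proof -
    have "x powr - (1 + t) = x powr (- 1 + - t)" by simp
    also have "\<dots> = x powr (- 1) * x powr (- t)" by (rule powr_add)
    also have "x powr (- 1) = 1 / x" using x by (simp add: powr_minus_divide)
    also have "x powr (- t) = exp (- (ln x * t))" using x by (simp add: powr_def mult.commute)
    finally show ?thesis by simp
  qed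
  have "(\<integral>\<^sup>+t. ennreal (indicator {0<..} t * (t powr (z - 1) * x powr - (1 + t))) \<partial>lborel) =
    (\<integral>\<^sup>+t. ennreal (1 / x) * ennreal (indicator {0<..} t * (t powr (z - 1) * exp (- (ln x * t)))) \<partial>lborel)"
    unfolding eq using x by (intro nn_integral_cong ennreal_mult') simp
  also have "\<dots> = ennreal (1 / x) * ennreal (Gamma z / ln x powr z)"
    using nn_integral_Gamma_scaled[OF z, of "ln x"] x by (subst nn_integral_cmult) auto
  also have "\<dots> = ennreal (Gamma z / (x * ln x powr z))"
    using x by (subst ennreal_mult'[symmetric]) auto
  finally show "(\<integral>\<^sup>+t. ennreal (indicator {0<..} t * (t powr (z - 1) * x powr - (1 + t))) \<partial>lborel) =
     ennreal (Gamma z / (x * ln x powr z))" .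
  show "0 \<le> Gamma z / (x * ln x powr z)" using x Gamma_real_pos[OF z] by simp
qed auto

lemma powr_times_log_power_tendsto_0:
  fixes z :: real
  assumes "z > 0"
  shows "((\<lambda>t. t powr z * (- ln t) ^ i) \<longlongrightarrow> 0) (at_right 0)"
  using assms by real_asymp

text \<open>The value at \<tau> of the antiderivative obtained by repeated integration by parts.
  Each increase of m adds one such step, and the boundary terms at 0 vanish since z > 0.\<close>

lemma has_bochner_integral_powr_log:
  fixes z \<tau> :: real
  assumes z: "z > 0" and \<tau>: "0 < \<tau>" "\<tau> \<le> 1"
  shows "has_bochner_integral lborel (\<lambda>t. indicator {0<..<\<tau>} t * (t powr (z - 1) * ((- ln t) ^ m / fact m)))
           (\<tau> powr z * (\<Sum>i\<le>m. (- ln \<tau>) ^ i / fact i * (1 / z) ^ (m - i + 1)))"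
proof -
  define F where "F m t = t powr z * (\<Sum>i\<le>m. (- ln t) ^ i / fact i * (1 / z) ^ (m - i + 1))" for m and t :: real
  define f where "f t = t powr (z - 1) * ((- ln t) ^ m / fact m)" for t
  have F_Suc: "F (Suc n) t = 1 / z * (t powr z * ((- ln t) ^ Suc n / fact (Suc n))) + 1 / z * F n t" for n t
  proof -
    have "(\<Sum>i\<le>n. (- ln t) ^ i / fact i * (1 / z) ^ (Suc n - i + 1)) =
          1 / z * (\<Sum>i\<le>n. (- ln t) ^ i / fact i * (1 / z) ^ (n - i + 1))"
      unfolding sum_distrib_left by (intro sum.cong refl) (simp add: Suc_diff_le)
    thus ?thesis unfolding F_def sum.atMost_Suc by (simp add: algebra_simps)
  qed
  have der: "(F n has_real_derivative t powr (z - 1) * ((- ln t) ^ n / fact n)) (at t)" if t: "t > 0" for n t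
  proof (induction n)
    case 0
    have "F 0 = (\<lambda>t. t powr z * (1 / z))" by (simp add: F_def fun_eq_iff)
    thus ?case using t z by (auto intro!: derivative_eq_intros)
  next
    case (Suc n)
    have eq: "F (Suc n) = (\<lambda>t. 1 / z * (t powr z * ((- ln t) ^ Suc n / fact (Suc n))) + 1 / z * F n t)"
      by (rule ext) (rule F_Suc)
    have 1: "((\<lambda>t. t powr z) has_real_derivative z * t powr (z - 1)) (at t)"
      using t by (auto intro!: derivative_eq_intros)
    have 2: "((\<lambda>t. (- ln t) ^ Suc n / fact (Suc n)) has_real_derivative (- 1 / t) * ((- ln t) ^ n / fact n)) (at t)"
    proof -
      have a: "((\<lambda>t. - ln t) has_real_derivative (- 1 / t)) (at t)"
        using t by (auto intro!: derivative_eq_intros)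
      have f: "fact (Suc n) = real (Suc n) * fact n" by (rule fact_Suc)
      show ?thesis
        by (rule DERIV_cong[OF DERIV_cdivide[OF DERIV_power[OF a, of "Suc n"], of "fact (Suc n)"]])
           (simp add: f del: of_nat_Suc fact_Suc)
    qed
    have tz: "t powr z * (1 / t) = t powr (z - 1)" using t by (simp add: powr_diff)
    show ?case unfolding eq
    proof (rule DERIV_cong[OF DERIV_add[OF DERIV_cmult[OF DERIV_mult[OF 1 2]] DERIV_cmult[OF Suc.IH]]])
      show "1 / z * (z * t powr (z - 1) * ((- ln t) ^ Suc n / fact (Suc n)) +
          (- 1 / t) * ((- ln t) ^ n / fact n) * t powr z) +
        1 / z * (t powr (z - 1) * ((- ln t) ^ n / fact n)) =
        t powr (z - 1) * ((- ln t) ^ Suc n / fact (Suc n))"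
      proof -
        have gen: "1 / z * (z * P * A + X) + 1 / z * (P * B) = P * A" if "X = - (P * B)" for P A B X
          using z by (simp add: that diff_divide_distrib)
        show ?thesis by (rule gen) (simp add: tz[symmetric])
      qed
    qed
  qed
  have lim0: "(F m \<longlongrightarrow> 0) (at_right 0)"
  proof -
    have "((\<lambda>t. \<Sum>i\<le>m. t powr z * (- ln t) ^ i * (1 / fact i * (1 / z) ^ (m - i + 1))) \<longlongrightarrow>
          (\<Sum>i\<le>m. 0 * (1 / fact i * (1 / z) ^ (m - i + 1)))) (at_right 0)"
      by (intro tendsto_sum tendsto_mult tendsto_const powr_times_log_power_tendsto_0 z)
    thus ?thesis unfolding F_def[abs_def] by (simp add: sum_distrib_left mult_ac)
  qed
  have lim1: "(F m \<longlongrightarrow> F m \<tau>) (at_left \<tau>)"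
    using DERIV_isCont[OF der[OF \<tau>(1)], of m] unfolding isCont_def
    by (rule filterlim_mono) (auto simp: at_within_le_at)
  have cont: "isCont f x" if "ereal 0 < ereal x" "ereal x < ereal \<tau>" for x
    unfolding f_def using that by (intro continuous_intros) auto
  have dF: "(F m has_real_derivative f x) (at x)" if "ereal 0 < ereal x" "ereal x < ereal \<tau>" for x
    unfolding f_def using that by (intro der) auto
  \<comment> \<open>The integral is improper at 0. The condition \<tau> \<le> 1 makes - ln t
    nonnegative, so the fundamental theorem for nonnegative functions with one-sided limits
    applies.\<close>
  have nn: "AE x in lborel. ereal 0 < ereal x \<longrightarrow> ereal x < ereal \<tau> \<longrightarrow> 0 \<le> f x"
    using \<tau> by (intro AE_I2) (auto simp: f_def)
  have l0: "((F m \<circ> real_of_ereal) \<longlongrightarrow> 0) (at_right (ereal 0))"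
    and l1: "((F m \<circ> real_of_ereal) \<longlongrightarrow> F m \<tau>) (at_left (ereal \<tau>))"
    unfolding ereal_tendsto_simps by (fact lim0, fact lim1)
  have "ereal 0 < ereal \<tau>" using \<tau> by simp
  note FTC = interval_integral_FTC_nonneg[OF this dF cont nn l0 l1]
  have "(\<lambda>t. indicator {0<..<\<tau>} t * (t powr (z - 1) * ((- ln t) ^ m / fact m))) =
        (\<lambda>t. indicator (einterval (ereal 0) (ereal \<tau>)) t *\<^sub>R f t)"
    by (simp add: f_def einterval_def greaterThanLessThan_def greaterThan_def lessThan_def Collect_conj_eq[symmetric])
  moreover have "integral\<^sup>L lborel (\<lambda>t. indicator (einterval (ereal 0) (ereal \<tau>)) t *\<^sub>R f t) = F m \<tau>"
    using FTC(2) \<tau> by (simp add: interval_lebesgue_integral_def set_lebesgue_integral_def)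
  ultimately show ?thesis
    using FTC(1) unfolding has_bochner_integral_iff set_integrable_def F_def by simp
qed

text \<open>Integration term by term in the nonnegative extended reals. Integrability of the total
  is a hypothesis here; it is obtained in \<open>erdos_gamma_decomposition\<close> by comparison
  with explicit functions.\<close>

lemma erdos_gamma_eq_integral:
  fixes z :: real
  assumes k: "k \<ge> 1" and z: "z > 0"
    and int: "integrable lborel (\<lambda>t. indicator {0<..} t * (t powr (z - 1) * almost_prime_zeta k (1 + t)))"
  shows "Gamma z * erdos_gamma k z =
         z ^ k * (\<integral>t. indicator {0<..} t * (t powr (z - 1) * almost_prime_zeta k (1 + t)) \<partial>lborel)"
proof -
  let ?F = "\<lambda>t. indicator {0<..} t * (t powr (z - 1) * almost_prime_zeta k (1 + t))"
  define g where "g n t = (if n \<in> almost_primes k then indicator {0<..} t * (t powr (z - 1) * real n powr - (1 + t)) else 0)"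
    for n :: nat and t :: real
  define c where "c n = (if n \<in> almost_primes k then Gamma z / (real n * ln (real n) powr z) else 0)" for n
  have gt1: "real n > 1" if "n \<in> almost_primes k" for n
  proof -
    have "n \<noteq> 1" using that k by (auto simp: almost_primes_def bigomega_def)
    thus ?thesis using that by (auto simp: almost_primes_def)
  qed
  have c0: "c n \<ge> 0" for n
    using gt1[of n] Gamma_real_pos[OF z] by (simp add: c_def)
  have gc: "(\<integral>\<^sup>+t. ennreal (g n t) \<partial>lborel) = ennreal (c n)" for n
  proof (cases "n \<in> almost_primes k")
    case True
    have h: "has_bochner_integral lborel (g n) (c n)"
      unfolding g_def[abs_def] c_def using True has_bochner_integral_powr_Gamma[OF z gt1[OF True]] by simp
    show ?thesis
      using nn_integral_eq_integral[of lborel "g n"] h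
      by (simp add: has_bochner_integral_iff g_def)
  qed (simp add: g_def c_def)
  have gF: "(\<Sum>n. ennreal (g n t)) = ennreal (?F t)" for t
  proof (cases "t > 0")
    case True
    have "((\<lambda>n. t powr (z - 1) * real n powr - (1 + t)) has_sum t powr (z - 1) * almost_prime_zeta k (1 + t)) (almost_primes k)"
      using True by (intro has_sum_cmult_right almost_prime_zeta_has_sum) auto
    also have "?this \<longleftrightarrow> ((\<lambda>n. g n t) has_sum t powr (z - 1) * almost_prime_zeta k (1 + t)) UNIV"
      using True by (intro has_sum_cong_neutral) (auto simp: g_def)
    finally have "(\<lambda>n. g n t) sums (t powr (z - 1) * almost_prime_zeta k (1 + t))" by (rule has_sum_imp_sums)
    thus ?thesis using True by (subst suminf_ennreal2) (auto simp: g_def sums_iff)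
  next
    case False
    hence "g n t = 0" for n by (simp add: g_def indicator_def)
    thus ?thesis using False by simp
  qed
  have "almost_prime_zeta k s \<ge> 0" for s unfolding almost_prime_zeta_def by (rule infsum_nonneg) simp
  hence F0: "?F t \<ge> 0" for t by simp
  have "(\<Sum>n. ennreal (c n)) = (\<integral>\<^sup>+t. (\<Sum>n. ennreal (g n t)) \<partial>lborel)"
    unfolding gc[symmetric] by (rule nn_integral_suminf[symmetric]) (simp add: g_def)
  also have "\<dots> = ennreal (integral\<^sup>L lborel ?F)"
    unfolding gF by (rule nn_integral_eq_integral[OF int]) (simp add: F0)
  finally have E: "(\<Sum>n. ennreal (c n)) = ennreal (integral\<^sup>L lborel ?F)" .
  hence sc: "summable c" by (intro summable_suminf_not_top c0) simp
  have "ennreal (suminf c) = ennreal (integral\<^sup>L lborel ?F)"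
    using E suminf_ennreal2[OF c0 sc] by simp
  hence sum_c: "suminf c = integral\<^sup>L lborel ?F"
    using suminf_nonneg[OF sc c0] Bochner_Integration.integral_nonneg[of lborel ?F, OF F0]
    by (subst (asm) ennreal_inj) auto
  have "(c has_sum suminf c) UNIV"
    using sc c0 by (intro sums_nonneg_imp_has_sum summable_sums) auto
  hence "((\<lambda>n. z ^ k / Gamma z * c n) has_sum z ^ k / Gamma z * suminf c) UNIV"
    by (rule has_sum_cmult_right)
  also have "?this \<longleftrightarrow> ((\<lambda>n. z ^ k / (real n * ln (real n) powr z)) has_sum z ^ k / Gamma z * suminf c) {n. bigomega n = k}"
  proof (rule has_sum_cong_neutral)
    fix n assume "n \<in> {n. bigomega n = k} - UNIV"
    thus "z ^ k / (real n * ln (real n) powr z) = 0" by simp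
  next
    fix n assume "n \<in> UNIV - {n. bigomega n = k}"
    thus "z ^ k / Gamma z * c n = 0" by (simp add: c_def almost_primes_def)
  next
    fix n assume "n \<in> UNIV \<inter> {n. bigomega n = k}"
    \<comment> \<open>As \<open>bigomega 0 = 0\<close>, the condition k \<ge> 1 excludes n =
      0.\<close>
    hence "n \<in> almost_primes k" using k by (cases "n = 0") (auto simp: almost_primes_def bigomega_def)
    thus "z ^ k / Gamma z * c n = z ^ k / (real n * ln (real n) powr z)"
      using Gamma_real_pos[OF z] by (simp add: c_def)
  qed
  finally have "erdos_gamma k z = z ^ k / Gamma z * suminf c"
    unfolding erdos_gamma_def by (rule infsumI)
  thus ?thesis using Gamma_real_pos[OF z] by (simp add: sum_c)
qed

section \<open>Splitting the integral\<close>

definition exp_conv :: "(nat \<Rightarrow> real) \<Rightarrow> real \<Rightarrow> nat \<Rightarrow> real" where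
  "exp_conv f x n = (\<Sum>i\<le>n. x ^ i / fact i * f (n - i))"

lemma exp_conv_fps: "exp_conv f x n = (fps_exp x * Abs_fps f) $ n"
  by (simp add: exp_conv_def fps_mult_nth atMost_atLeast0)

text \<open>Both sides are T/z times coefficient k of exp (2 l w) / (1 - 2 w / z) times the series
  of f. The integral produces the exponential together with the geometric factor; regrouping the
  exponential with f prepares the completion to an infinite series.\<close>

lemma exp_conv_sum_rearrange:
  fixes z l T :: real
  assumes z: "z > 0"
  shows "(\<Sum>m\<le>k. 2 ^ m * f (k - m) * (T * (\<Sum>i\<le>m. l ^ i / fact i * (1 / z) ^ (m - i + 1)))) =
         T / z * (\<Sum>n\<le>k. exp_conv f (2 * l) n * (2 / z) ^ (k - n))"
proof -
  let ?E = "fps_exp (2 * l)" and ?G = "fps_geometric (2 / z)" and ?B = "Abs_fps f"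
  have inner: "2 ^ m * (T * (\<Sum>i\<le>m. l ^ i / fact i * (1 / z) ^ (m - i + 1))) = T / z * (?E * ?G) $ m" for m
  proof -
    have "2 ^ m * (\<Sum>i\<le>m. l ^ i / fact i * (1 / z) ^ (m - i + 1)) =
          1 / z * (\<Sum>i\<le>m. (2 * l) ^ i / fact i * (2 / z) ^ (m - i))"
      unfolding sum_distrib_left
    proof (intro sum.cong refl)
      fix i assume "i \<in> {..m}"
      hence e: "(2::real) ^ m = 2 ^ i * 2 ^ (m - i)" by (simp flip: power_add)
      have d: "(2 / z) ^ (m - i) = 2 ^ (m - i) * (1 / z) ^ (m - i)" by (simp add: power_divide)
      show "2 ^ m * (l ^ i / fact i * (1 / z) ^ (m - i + 1)) = 1 / z * ((2 * l) ^ i / fact i * (2 / z) ^ (m - i))"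
        unfolding d e power_mult_distrib by (simp add: mult_ac)
    qed
    hence "T * (2 ^ m * (\<Sum>i\<le>m. l ^ i / fact i * (1 / z) ^ (m - i + 1))) =
           T * (1 / z * (\<Sum>i\<le>m. (2 * l) ^ i / fact i * (2 / z) ^ (m - i)))" by (rule arg_cong)
    thus ?thesis by (simp add: fps_mult_nth atMost_atLeast0 mult_ac)
  qed
  have "(\<Sum>m\<le>k. 2 ^ m * f (k - m) * (T * (\<Sum>i\<le>m. l ^ i / fact i * (1 / z) ^ (m - i + 1)))) =
        (\<Sum>m\<le>k. T / z * ((?E * ?G) $ m * f (k - m)))"
  proof (intro sum.cong refl)
    fix m
    have "2 ^ m * f (k - m) * (T * (\<Sum>i\<le>m. l ^ i / fact i * (1 / z) ^ (m - i + 1))) =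
      (2 ^ m * (T * (\<Sum>i\<le>m. l ^ i / fact i * (1 / z) ^ (m - i + 1)))) * f (k - m)" by (simp only: mult_ac)
    thus "2 ^ m * f (k - m) * (T * (\<Sum>i\<le>m. l ^ i / fact i * (1 / z) ^ (m - i + 1))) =
      T / z * ((?E * ?G) $ m * f (k - m))" unfolding inner by (simp only: mult.assoc)
  qed
  also have "\<dots> = T / z * (?E * ?G * ?B) $ k"
    by (subst fps_mult_nth[of _ ?B]) (simp add: sum_distrib_left atMost_atLeast0)
  also have "?E * ?G * ?B = (?E * ?B) * ?G" by (simp only: mult_ac)
  also have "\<dots> $ k = (\<Sum>n\<le>k. exp_conv f (2 * l) n * (2 / z) ^ (k - n))"
    by (subst fps_mult_nth[of _ ?G]) (simp add: exp_conv_fps atMost_atLeast0)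
  finally show ?thesis .
qed

section \<open>Decay in s and measurability of the almost prime zeta sums\<close>

lemma power_2_le_almost_prime:
  assumes "n \<in> almost_primes k"
  shows "2 ^ k \<le> n"
proof -
  have aux: "2 ^ size M \<le> prod_mset M" if "\<And>p. p \<in># M \<Longrightarrow> 2 \<le> p" for M :: "nat multiset"
    using that by (induction M) (auto intro!: mult_le_mono)
  have "2 ^ size (prime_factorization n) \<le> prod_mset (prime_factorization n)"
    by (rule aux) (auto dest: in_prime_factors_imp_prime intro: prime_ge_2_nat)
  thus ?thesis using assms by (simp add: almost_primes_def bigomega_def prod_mset_prime_factorization_nat)
qed

lemma almost_prime_zeta_nonneg: "almost_prime_zeta k s \<ge> 0"
  unfolding almost_prime_zeta_def by (rule infsum_nonneg) simp

text \<open>All members of \<open>almost_primes k\<close> are at least 2^k, so increasing s by h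
  gains a factor 2^(-k h). This controls the range t \<ge> 1/k.\<close>

lemma almost_prime_zeta_decay:
  assumes "1 < s" "s \<le> s'"
  shows "almost_prime_zeta k s' \<le> almost_prime_zeta k s * (2 ^ k) powr (- (s' - s))"
proof (rule has_sum_mono[OF almost_prime_zeta_has_sum has_sum_cmult_left[OF almost_prime_zeta_has_sum]])
  fix n assume n: "n \<in> almost_primes k"
  have "real (2 ^ k) \<le> real n" using power_2_le_almost_prime[OF n] by (rule of_nat_mono)
  hence "real n powr (- (s' - s)) \<le> (2 ^ k) powr (- (s' - s))" using assms by (intro powr_mono2') auto
  hence "real n powr - s * real n powr (- (s' - s)) \<le> real n powr - s * (2 ^ k) powr (- (s' - s))"
    by (intro mult_left_mono) auto
  thus "real n powr - s' \<le> real n powr - s * (2 ^ k) powr (- (s' - s))"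
    by (simp add: powr_add[symmetric])
qed (use assms in auto)

lemma almost_prime_zeta_measurable:
  "(\<lambda>t. indicator {0<..} t * (t powr (z - 1) * almost_prime_zeta k (1 + t))) \<in> borel_measurable lborel"
proof -
  have "almost_prime_zeta k s = (\<Sum>n. if n \<in> almost_primes k then real n powr - s else 0)" if "s > 1" for s
  proof -
    have "((\<lambda>n. if n \<in> almost_primes k then real n powr - s else 0) has_sum almost_prime_zeta k s) UNIV
       \<longleftrightarrow> ((\<lambda>n. real n powr - s) has_sum almost_prime_zeta k s) (almost_primes k)"
      by (rule has_sum_cong_neutral) auto
    with almost_prime_zeta_has_sum[OF that, of k]
    have "((\<lambda>n. if n \<in> almost_primes k then real n powr - s else 0) has_sum almost_prime_zeta k s) UNIV" by simp
    from has_sum_imp_sums[OF this] show ?thesis by (simp add: sums_iff)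
  qed
  hence "(\<lambda>t. indicator {0<..} t * (t powr (z - 1) * almost_prime_zeta k (1 + t))) =
    (\<lambda>t. indicator {0<..} t * (t powr (z - 1) * (\<Sum>n. if n \<in> almost_primes k then real n powr - (1 + t) else 0)))"
    by (intro ext) (auto simp: indicator_def)
  also have "\<dots> \<in> borel_measurable lborel" by measurable
  finally show ?thesis .
qed

text \<open>The exact integral over (0, 1/k) of t^(z - 1) times the order zero part of the
  expansion, rearranged by \<open>exp_conv_sum_rearrange\<close>.\<close>

definition first_term :: "nat \<Rightarrow> real \<Rightarrow> real" where
  "first_term k z = real k powr (- z) / z *
     (\<Sum>n\<le>k. exp_conv pole_coeff0 (2 * ln (real k)) n * (2 / z) ^ (k - n))"

text \<open>The contribution of the order one part; its additional factor t shifts the exponent from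
  z to z + 1.\<close>

definition second_term :: "nat \<Rightarrow> real \<Rightarrow> real" where
  "second_term k z = real k powr (- (z + 1)) / (z + 1) *
     (\<Sum>n\<le>k. exp_conv pole_coeff1 (2 * ln (real k)) n * (2 / (z + 1)) ^ (k - n))"

text \<open>The integral over \<open>t \<ge> 1 / k\<close> is estimated trivially, and on \<open>(0, 1 / k)\<close> the first two
  terms of the expansion in \<open>t\<close> are integrated exactly. Cutting at \<open>1 / k\<close> balances the two errors.\<close>

lemma erdos_gamma_decomposition:
  obtains C :: real where "C > 0"
    "\<And>k z. k \<ge> 1 \<Longrightarrow> 0 < z \<Longrightarrow> z \<le> 2 \<Longrightarrow>
      \<bar>Gamma z * (2 / z) ^ k * erdos_gamma k z -
        (first_term k z + second_term k z)\<bar>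
      \<le> C * real k powr (2 - z) / z"
proof -
  obtain C :: real where C: "C > 0"
    "\<And>k t. 0 < t \<Longrightarrow> t \<le> 1 \<Longrightarrow> 2 ^ k * almost_prime_zeta k (1 + t) \<le> C / t\<^sup>2"
    "\<And>k t. 0 < t \<Longrightarrow> t \<le> 1 \<Longrightarrow> \<bar>2 ^ k * almost_prime_zeta k (1 + t) -
        (\<Sum>m\<le>k. (2 * - ln t) ^ m / fact m * (pole_coeff0 (k - m) + t * pole_coeff1 (k - m)))\<bar> \<le> C * (real k + 1)\<^sup>2"
    using almost_prime_zeta_near_one by blast
  \<comment> \<open>4 C comes from (k + 1)^2 \<le> 4 k^2 on (0, 1/k); the tail gives 2 C / (ln 2)^2,
    doubled to insert the factor 2 / z, which is at least 1.\<close>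
  define D where "D = 4 * C + 4 * C / (ln 2)\<^sup>2"
  have D0: "D > 0" using C(1) by (simp add: D_def add_pos_nonneg)
  have main: "\<bar>Gamma z * (2 / z) ^ k * erdos_gamma k z -
        (first_term k z + second_term k z)\<bar>
      \<le> D * real k powr (2 - z) / z"
    if k: "k \<ge> 1" and z: "0 < z" "z \<le> 2" for k z
  proof -
    define \<tau> where "\<tau> = 1 / real k"
    have \<tau>: "0 < \<tau>" "\<tau> \<le> 1" using k by (auto simp: \<tau>_def)
    have l\<tau>: "- ln \<tau> = ln (real k)" using k by (simp add: \<tau>_def ln_div)
    have p\<tau>: "\<tau> powr a = real k powr (- a)" for a using k by (simp add: \<tau>_def powr_divide powr_minus_divide)
    define J where "J a m t = indicator {0<..<\<tau>} t * (t powr (a - 1) * ((- ln t) ^ m / fact m))" for a :: real and m :: nat and t :: real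
    define I where "I a m = \<tau> powr a * (\<Sum>i\<le>m. (- ln \<tau>) ^ i / fact i * (1 / a) ^ (m - i + 1))" for a :: real and m
    have J: "has_bochner_integral lborel (J a m) (I a m)" if "a > 0" for a m
      unfolding J_def I_def by (rule has_bochner_integral_powr_log[OF that \<tau>])
    define G where "G t = 2 ^ k * (indicator {0<..} t * (t powr (z - 1) * almost_prime_zeta k (1 + t)))" for t :: real
    define g where "g t = (\<Sum>m\<le>k. 2 ^ m * pole_coeff0 (k - m) * J z m t + 2 ^ m * pole_coeff1 (k - m) * J (z + 1) m t)" for t
    define X where "X = (2 :: real) ^ k"
    have X1: "X > 1" using k by (simp add: X_def)
    have lnX: "ln X = real k * ln 2" by (simp add: X_def ln_realpow)
    define h1 where "h1 t = C * (real k + 1)\<^sup>2 * J z 0 t" for t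
    \<comment> \<open>For t \<ge> 1/k and z \<le> 2 one has t^(z - 1) \<le> k^(2 - z) t, so the tail
      is majorised by a Gamma integral with exponent 2, taken over all t > 0.\<close>
    define h2 where "h2 t = 2 * C * (real k)\<^sup>2 * X * real k powr (2 - z) * (indicator {0<..} t * (t powr (2 - 1) * X powr - (1 + t)))" for t :: real
    have ig: "has_bochner_integral lborel g
       (\<Sum>m\<le>k. 2 ^ m * pole_coeff0 (k - m) * I z m + 2 ^ m * pole_coeff1 (k - m) * I (z + 1) m)"
      unfolding g_def[abs_def]
      by (intro has_bochner_integral_sum has_bochner_integral_add has_bochner_integral_mult_right J) (use z in auto)
    have ih1: "has_bochner_integral lborel h1 (C * (real k + 1)\<^sup>2 * I z 0)"
      unfolding h1_def[abs_def] by (intro has_bochner_integral_mult_right J) (use z in auto)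
    have ih2: "has_bochner_integral lborel h2
        (2 * C * (real k)\<^sup>2 * X * real k powr (2 - z) * (Gamma 2 / (X * ln X powr 2)))"
      unfolding h2_def[abs_def] by (intro has_bochner_integral_mult_right has_bochner_integral_powr_Gamma X1) auto
    have h1_nn: "h1 t \<ge> 0" for t unfolding h1_def J_def using C(1) by (simp add: indicator_def)
    have h2_nn: "h2 t \<ge> 0" for t unfolding h2_def using C(1) X1 by simp
    have bd: "\<bar>G t - g t\<bar> \<le> h1 t + h2 t" for t
    proof -
      consider "t \<le> 0" | "0 < t" "t < \<tau>" | "\<tau> \<le> t" by linarith
      thus ?thesis
      proof cases
        case 1
        hence "G t = 0" "g t = 0" by (auto simp: G_def g_def J_def)
        thus ?thesis using h1_nn[of t] h2_nn[of t] by simp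
      next
        case 2
        hence t1: "t \<le> 1" using \<tau> by linarith
        have tz: "t powr z = t powr (z - 1) * t" using 2 by (simp add: powr_diff)
        have gt: "g t = t powr (z - 1) * (\<Sum>m\<le>k. (2 * - ln t) ^ m / fact m * (pole_coeff0 (k - m) + t * pole_coeff1 (k - m)))"
          unfolding g_def J_def power_mult_distrib[of 2] sum_distrib_left using 2
          by (intro sum.cong refl) (simp add: tz algebra_simps add_divide_distrib)
        have Gt: "G t = t powr (z - 1) * (2 ^ k * almost_prime_zeta k (1 + t))"
          unfolding G_def using 2 by simp
        have "\<bar>G t - g t\<bar> = t powr (z - 1) * \<bar>2 ^ k * almost_prime_zeta k (1 + t) -
           (\<Sum>m\<le>k. (2 * - ln t) ^ m / fact m * (pole_coeff0 (k - m) + t * pole_coeff1 (k - m)))\<bar>"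
          unfolding gt Gt right_diff_distrib[symmetric] abs_mult by simp
        also have "\<dots> \<le> t powr (z - 1) * (C * (real k + 1)\<^sup>2)"
          by (intro mult_left_mono C(3)) (use 2 t1 in auto)
        also have "\<dots> = h1 t" using 2 by (simp add: h1_def J_def)
        finally show ?thesis using h2_nn[of t] by linarith
      next
        case 3
        have t0: "t > 0" using 3 \<tau> by linarith
        have g0: "g t = 0" using 3 by (simp add: g_def J_def)
        have "almost_prime_zeta k (1 + t) \<le> almost_prime_zeta k (1 + \<tau>) * (2 ^ k) powr (- ((1 + t) - (1 + \<tau>)))"
          by (rule almost_prime_zeta_decay) (use 3 \<tau> in auto)
        hence "2 ^ k * almost_prime_zeta k (1 + t) \<le> 2 ^ k * almost_prime_zeta k (1 + \<tau>) * X powr (\<tau> - t)"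
          by (simp add: X_def mult.assoc)
        also have "\<dots> \<le> C / \<tau>\<^sup>2 * X powr (\<tau> - t)"
          by (intro mult_right_mono C(2) \<tau>) auto
        also have "X powr (\<tau> - t) = X powr \<tau> * X powr (- t)" by (simp add: powr_add[symmetric])
        \<comment> \<open>Starting the decay at \<tau> = 1/k costs only (2^k)^(1/k) = 2.\<close>
        also have "X powr \<tau> = 2"
        proof -
          have "X powr \<tau> = (2 powr real k) powr (1 / real k)" by (simp add: X_def \<tau>_def powr_realpow)
          also have "\<dots> = 2 powr (real k * (1 / real k))" by (rule powr_powr)
          finally show ?thesis using k by simp
        qed
        also have "X powr (- t) = X * X powr - (1 + t)"
        proof -
          have "X * X powr - (1 + t) = X powr 1 * X powr - (1 + t)" using X1 by simp
          also have "\<dots> = X powr (1 + - (1 + t))" by (rule powr_add[symmetric])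
          finally show ?thesis by simp
        qed
        also have "C / \<tau>\<^sup>2 * (2 * (X * X powr - (1 + t))) = 2 * C * (real k)\<^sup>2 * X * X powr - (1 + t)"
          by (simp add: \<tau>_def power_divide)
        finally have P: "2 ^ k * almost_prime_zeta k (1 + t) \<le> 2 * C * (real k)\<^sup>2 * X * X powr - (1 + t)" .
        have tz: "t powr (z - 1) \<le> real k powr (2 - z) * t"
        proof -
          have "1 \<le> t * real k" using 3 k by (simp add: \<tau>_def field_simps)
          hence "(t * real k) powr (z - 1) \<le> (t * real k) powr 1" using z by (intro powr_mono) auto
          hence le: "t powr (z - 1) * real k powr (z - 1) \<le> t * real k" using t0 by (simp add: powr_mult)
          have "t powr (z - 1) = t powr (z - 1) * real k powr (z - 1) * real k powr (1 - z)"
            using k by (simp add: mult.assoc powr_add[symmetric])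
          also have "\<dots> \<le> t * real k * real k powr (1 - z)" by (intro mult_right_mono le) auto
          also have "\<dots> = t * (real k powr 1 * real k powr (1 - z))" by simp
          also have "real k powr 1 * real k powr (1 - z) = real k powr (1 + (1 - z))" by (rule powr_add[symmetric])
          also have "1 + (1 - z) = 2 - z" by simp
          finally show ?thesis by (simp add: mult.commute)
        qed
        have "\<bar>G t - g t\<bar> = t powr (z - 1) * (2 ^ k * almost_prime_zeta k (1 + t))"
          using t0 almost_prime_zeta_nonneg[of k "1 + t"] unfolding g0 G_def by simp
        also have "\<dots> \<le> (real k powr (2 - z) * t) * (2 * C * (real k)\<^sup>2 * X * X powr - (1 + t))"
          using t0 C(1) X1 by (intro mult_mono tz P mult_nonneg_nonneg almost_prime_zeta_nonneg) auto
        also have "\<dots> = h2 t" using t0 by (simp add: h2_def mult_ac)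
        finally show ?thesis using h1_nn[of t] by linarith
      qed
    qed
    have mG: "G \<in> borel_measurable lborel"
      unfolding G_def[abs_def] by (intro borel_measurable_times borel_measurable_const almost_prime_zeta_measurable)
    have ih: "has_bochner_integral lborel (\<lambda>t. h1 t + h2 t) (C * (real k + 1)\<^sup>2 * I z 0 +
        2 * C * (real k)\<^sup>2 * X * real k powr (2 - z) * (Gamma 2 / (X * ln X powr 2)))"
      by (rule has_bochner_integral_add[OF ih1 ih2])
    \<comment> \<open>Integrability of G itself is derived from that of g and of the majorant of G -
      g.\<close>
    have iGg: "integrable lborel (\<lambda>t. G t - g t)"
    proof (rule Bochner_Integration.integrable_bound)
      show "integrable lborel (\<lambda>t. h1 t + h2 t)" using ih by (simp add: has_bochner_integral_iff)
      show "(\<lambda>t. G t - g t) \<in> borel_measurable lborel"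
        using mG ig by (intro borel_measurable_diff) (auto simp: has_bochner_integral_iff)
      show "AE t in lborel. norm (G t - g t) \<le> norm (h1 t + h2 t)"
      proof (rule AE_I2)
        fix t :: real
        show "norm (G t - g t) \<le> norm (h1 t + h2 t)"
          unfolding real_norm_def using bd[of t] abs_ge_self[of "h1 t + h2 t"] by (rule order_trans)
      qed
    qed
    have ig': "integrable lborel g" using ig by (simp add: has_bochner_integral_iff)
    have iG: "integrable lborel G"
      using Bochner_Integration.integrable_add[OF iGg ig'] by simp
    have est: "\<bar>integral\<^sup>L lborel G - integral\<^sup>L lborel g\<bar> \<le> C * (real k + 1)\<^sup>2 * I z 0 +
        2 * C * (real k)\<^sup>2 * X * real k powr (2 - z) * (Gamma 2 / (X * ln X powr 2))"
    proof -
      have "\<bar>integral\<^sup>L lborel (\<lambda>t. G t - g t)\<bar> \<le> integral\<^sup>L lborel (\<lambda>t. h1 t + h2 t)"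
        using iGg ih bd by (intro integral_abs_bound_integral) (auto simp: has_bochner_integral_iff)
      thus ?thesis using Bochner_Integration.integral_diff[OF iG ig'] ih by (simp add: has_bochner_integral_iff)
    qed
    have intF: "integrable lborel (\<lambda>t. indicator {0<..} t * (t powr (z - 1) * almost_prime_zeta k (1 + t)))"
      using integrable_mult_right[of "1 / 2 ^ k" lborel G] iG unfolding G_def[abs_def] by (simp add: mult.assoc[symmetric])
    have Gval: "integral\<^sup>L lborel G = Gamma z * (2 / z) ^ k * erdos_gamma k z"
    proof -
      have "integral\<^sup>L lborel G = 2 ^ k * (\<integral>t. indicator {0<..} t * (t powr (z - 1) * almost_prime_zeta k (1 + t)) \<partial>lborel)"
        unfolding G_def[abs_def] by (rule Bochner_Integration.integral_mult_right) (use intF in auto)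
      also have "(\<integral>t. indicator {0<..} t * (t powr (z - 1) * almost_prime_zeta k (1 + t)) \<partial>lborel) =
         Gamma z * erdos_gamma k z / z ^ k"
        unfolding erdos_gamma_eq_integral[OF k z(1) intF] using z by simp
      finally show ?thesis by (simp add: power_divide)
    qed
    have gval: "integral\<^sup>L lborel g =
        first_term k z + second_term k z"
    proof -
      have z1: "z + 1 > 0" using z by simp
      have "integral\<^sup>L lborel g = (\<Sum>m\<le>k. 2 ^ m * pole_coeff0 (k - m) * I z m) + (\<Sum>m\<le>k. 2 ^ m * pole_coeff1 (k - m) * I (z + 1) m)"
        using ig by (simp add: has_bochner_integral_iff sum.distrib)
      thus ?thesis unfolding first_term_def second_term_def I_def l\<tau> p\<tau>
          exp_conv_sum_rearrange[OF z(1)] exp_conv_sum_rearrange[OF z1] .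
    qed
    have e1: "C * (real k + 1)\<^sup>2 * I z 0 \<le> 4 * C * real k powr (2 - z) / z"
    proof -
      have "(real k + 1)\<^sup>2 \<le> (2 * real k)\<^sup>2" using k by (intro power_mono) auto
      hence "C * (real k + 1)\<^sup>2 * (real k powr (- z) / z) \<le> C * (2 * real k)\<^sup>2 * (real k powr (- z) / z)"
        using C(1) z by (intro mult_right_mono mult_left_mono) auto
      also have "\<dots> = 4 * C * ((real k)\<^sup>2 * real k powr (- z)) / z" by (simp add: power_mult_distrib)
      also have "(real k)\<^sup>2 * real k powr (- z) = real k powr (2 - z)"
        using k by (simp add: powr_diff powr_minus_divide)
      also have "I z 0 = real k powr (- z) / z" by (simp add: I_def p\<tau>)
      ultimately show ?thesis by simp
    qed
    have e2: "2 * C * (real k)\<^sup>2 * X * real k powr (2 - z) * (Gamma 2 / (X * ln X powr 2)) \<le> 4 * C / (ln 2)\<^sup>2 * real k powr (2 - z) / z"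
    proof -
      have "ln X powr 2 = (real k * ln 2)\<^sup>2" unfolding lnX using k by simp
      moreover have "Gamma (2::real) = 1" using Gamma_fact[of 1, where ?'a = real] by simp
      ultimately have "2 * C * (real k)\<^sup>2 * X * real k powr (2 - z) * (Gamma 2 / (X * ln X powr 2)) =
         2 * C / (ln 2)\<^sup>2 * real k powr (2 - z) * 1"
        using X1 k by (simp add: power_mult_distrib)
      also have "\<dots> \<le> 2 * C / (ln 2)\<^sup>2 * real k powr (2 - z) * (2 / z)"
        using C(1) z by (intro mult_left_mono) auto
      finally show ?thesis by simp
    qed
    have "D * real k powr (2 - z) / z = 4 * C * real k powr (2 - z) / z + 4 * C / (ln 2)\<^sup>2 * real k powr (2 - z) / z"
      by (simp add: D_def distrib_right add_divide_distrib)
    thus ?thesis using est e1 e2 unfolding Gval gval by linarith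
  qed
  show ?thesis using that[OF D0 main] by blast
qed

section \<open>The main term\<close>

lemma Cauchy_product_sums':
  fixes a b :: "nat \<Rightarrow> real"
  assumes "a sums A" "b sums B" "summable (\<lambda>n. \<bar>a n\<bar>)" "summable (\<lambda>n. \<bar>b n\<bar>)"
  shows "(\<lambda>n. \<Sum>i\<le>n. a i * b (n - i)) sums (A * B)"
  using Cauchy_product_sums[of a b] assms by (simp add: sums_iff)

lemma reg_coeff_abs_summable:
  assumes "0 < x" "x \<le> 2"
  shows "summable (\<lambda>n. \<bar>reg_coeff0 n * x ^ n\<bar>)" "summable (\<lambda>n. \<bar>reg_coeff1 n * x ^ n\<bar>)"
proof -
  obtain B :: real where B: "B > 0"
    "\<And>n. \<bar>reg_coeff0 n\<bar> \<le> B * (2 / 5) ^ n" "\<And>n. \<bar>reg_coeff1 n\<bar> \<le> B * (2 / 5) ^ n"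
    using reg_coeff_expansion by metis
  have *: "summable (\<lambda>n. \<bar>f n * x ^ n\<bar>)" if f: "\<And>n. \<bar>f n\<bar> \<le> B * (2 / 5) ^ n" for f :: "nat \<Rightarrow> real"
  proof (rule summable_comparison_test')
    show "summable (\<lambda>n. B * (4 / 5) ^ n)" by (intro summable_mult summable_geometric) auto
    fix n
    have "\<bar>f n\<bar> * x ^ n \<le> (B * (2 / 5) ^ n) * 2 ^ n"
      using assms B(1) by (intro mult_mono f power_mono) auto
    also have "\<dots> = B * (4 / 5) ^ n" by (simp add: mult.assoc power_mult_distrib[symmetric])
    finally show "norm \<bar>f n * x ^ n\<bar> \<le> B * (4 / 5) ^ n" using assms by (simp add: abs_mult)
  qed
  show "summable (\<lambda>n. \<bar>reg_coeff0 n * x ^ n\<bar>)" "summable (\<lambda>n. \<bar>reg_coeff1 n * x ^ n\<bar>)"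
    by (rule *, rule B)+
qed

lemma half_power_split:
  assumes "i \<le> n"
  shows "(x :: real) ^ i * (x / 2) ^ (n - i) = 2 ^ i * (x / 2) ^ n"
proof -
  have "(x / 2) ^ n = (x / 2) ^ i * (x / 2) ^ (n - i)" using assms by (simp flip: power_add)
  moreover have "x ^ i = 2 ^ i * (x / 2) ^ i" by (simp add: power_divide)
  ultimately show ?thesis by simp
qed

text \<open>\<open>pole_coeff0\<close> consists of partial sums of the scaled coefficients, so its
  series is the product of the series of \<open>reg_coeff0\<close> at x with the geometric series of
  ratio x/2.\<close>

lemma pole_coeff0_sums:
  assumes x: "0 < x" "x < 2"
  shows "(\<lambda>n. pole_coeff0 n * (x / 2) ^ n) sums (d_fun x / (1 - x / 2))"
proof -
  have g: "(\<lambda>n. (x / 2) ^ n) sums (1 / (1 - x / 2))" "summable (\<lambda>n. \<bar>(x / 2) ^ n\<bar>)"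
    using x by (auto intro!: geometric_sums summable_geometric simp: power_abs)
  have "(\<lambda>n. \<Sum>i\<le>n. reg_coeff0 i * x ^ i * (x / 2) ^ (n - i)) sums (d_fun x * (1 / (1 - x / 2)))"
    using x by (intro Cauchy_product_sums' reg_coeff_sums reg_coeff_abs_summable g) auto
  also have "(\<lambda>n. \<Sum>i\<le>n. reg_coeff0 i * x ^ i * (x / 2) ^ (n - i)) = (\<lambda>n. pole_coeff0 n * (x / 2) ^ n)"
    unfolding pole_coeff0_def sum_distrib_right
    by (intro ext sum.cong refl) (simp add: mult.assoc half_power_split)
  finally show ?thesis by simp
qed

text \<open>Differentiating (1 - w 2^-(1 + t))^-1 in t at 0 gives - ln 2 (w/2) / (1 - w/2)^2, which
  is the second contribution besides that of \<open>reg_coeff1\<close>.\<close>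

lemma pole_coeff1_sums:
  assumes x: "0 < x" "x < 2"
  shows "(\<lambda>n. pole_coeff1 n * (x / 2) ^ n) sums
    (d_fun x / (1 - x / 2) * (first_order_sum x - ln 2 * (x / 2) / (1 - x / 2)))"
proof -
  define q where "q = x / 2"
  have q: "0 < q" "q < 1" using x by (auto simp: q_def)
  have g: "(\<lambda>n. q ^ n) sums (1 / (1 - q))" "summable (\<lambda>n. \<bar>q ^ n\<bar>)"
    using q by (auto intro!: geometric_sums summable_geometric simp: power_abs)
  have "(\<lambda>n. real (Suc n) * q ^ n) sums (1 / (1 - q)\<^sup>2)"
    using geometric_deriv_sums[of q] q by simp
  hence "(\<lambda>n. q * (real (Suc n) * q ^ n)) sums (q * (1 / (1 - q)\<^sup>2))" by (rule sums_mult)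
  hence "(\<lambda>n. real (Suc n) * q ^ Suc n) sums (q / (1 - q)\<^sup>2)" by (simp add: mult_ac)
  hence h: "(\<lambda>n. real n * q ^ n) sums (q / (1 - q)\<^sup>2)" by (subst (asm) sums_Suc_iff) simp
  hence h': "summable (\<lambda>n. \<bar>real n * q ^ n\<bar>)" using q by (simp add: sums_iff)
  have "(\<lambda>n. (\<Sum>i\<le>n. reg_coeff1 i * x ^ i * q ^ (n - i)) - ln 2 * (\<Sum>i\<le>n. reg_coeff0 i * x ^ i * (real (n - i) * q ^ (n - i))))
     sums (first_order_sum x * d_fun x * (1 / (1 - q)) - ln 2 * (d_fun x * (q / (1 - q)\<^sup>2)))"
    using x by (intro sums_diff sums_mult Cauchy_product_sums' reg_coeff_sums reg_coeff_abs_summable g h h') auto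
  also have "(\<lambda>n. (\<Sum>i\<le>n. reg_coeff1 i * x ^ i * q ^ (n - i)) - ln 2 * (\<Sum>i\<le>n. reg_coeff0 i * x ^ i * (real (n - i) * q ^ (n - i))))
     = (\<lambda>n. pole_coeff1 n * q ^ n)"
  proof (rule ext)
    fix n
    have s: "x ^ i * q ^ (n - i) = 2 ^ i * q ^ n" if "i \<le> n" for i
      using half_power_split[OF that] by (simp add: q_def)
    have "pole_coeff1 n * q ^ n = (\<Sum>i\<le>n. (reg_coeff1 i - ln 2 * real (n - i) * reg_coeff0 i) * (2 ^ i * q ^ n))"
      unfolding pole_coeff1_def sum_distrib_right by (simp only: mult.assoc)
    also have "\<dots> = (\<Sum>i\<le>n. (reg_coeff1 i - ln 2 * real (n - i) * reg_coeff0 i) * (x ^ i * q ^ (n - i)))"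
      by (intro sum.cong refl) (simp add: s)
    also have "\<dots> = (\<Sum>i\<le>n. reg_coeff1 i * x ^ i * q ^ (n - i)) - ln 2 * (\<Sum>i\<le>n. reg_coeff0 i * x ^ i * (real (n - i) * q ^ (n - i)))"
      unfolding sum_distrib_left sum_subtractf[symmetric] by (intro sum.cong refl) (simp add: algebra_simps)
    finally show "(\<Sum>i\<le>n. reg_coeff1 i * x ^ i * q ^ (n - i)) - ln 2 * (\<Sum>i\<le>n. reg_coeff0 i * x ^ i * (real (n - i) * q ^ (n - i)))
       = pole_coeff1 n * q ^ n" by simp
  qed
  also have "first_order_sum x * d_fun x * (1 / (1 - q)) - ln 2 * (d_fun x * (q / (1 - q)\<^sup>2)) =
     d_fun x / (1 - q) * (first_order_sum x - ln 2 * q / (1 - q))"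
    using q by (simp add: power2_eq_square right_diff_distrib mult_ac)
  finally show ?thesis unfolding q_def .
qed

lemma exp_conv_sums:
  fixes f :: "nat \<Rightarrow> real" and q y F :: real
  assumes "(\<lambda>n. f n * q ^ n) sums F" "summable (\<lambda>n. \<bar>f n * q ^ n\<bar>)"
  shows "(\<lambda>n. exp_conv f y n * q ^ n) sums (exp (y * q) * F)"
proof -
  have e: "(\<lambda>n. (y * q) ^ n / fact n) sums exp (y * q)"
    using exp_converges[of "y * q"] by (simp add: divide_inverse mult.commute)
  have "(\<lambda>n. \<bar>y * q\<bar> ^ n / fact n) sums exp \<bar>y * q\<bar>"
    using exp_converges[of "\<bar>y * q\<bar>"] by (simp add: divide_inverse mult.commute)
  hence e': "summable (\<lambda>n. \<bar>(y * q) ^ n / fact n\<bar>)" by (simp add: sums_iff power_abs)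
  have "(\<lambda>n. \<Sum>i\<le>n. (y * q) ^ i / fact i * (f (n - i) * q ^ (n - i))) sums (exp (y * q) * F)"
    by (rule Cauchy_product_sums'[OF e assms(1) e' assms(2)])
  also have "(\<lambda>n. \<Sum>i\<le>n. (y * q) ^ i / fact i * (f (n - i) * q ^ (n - i))) = (\<lambda>n. exp_conv f y n * q ^ n)"
    unfolding exp_conv_def sum_distrib_right
  proof (intro ext sum.cong refl)
    fix n i :: nat assume "i \<in> {..n}"
    hence "q ^ n = q ^ i * q ^ (n - i)" by (simp flip: power_add)
    thus "(y * q) ^ i / fact i * (f (n - i) * q ^ (n - i)) = y ^ i / fact i * f (n - i) * q ^ n"
      by (simp add: power_mult_distrib)
  qed
  finally show ?thesis .
qed

text \<open>The truncated sum is completed to a full series. The omitted terms are f(n) q^(n - k)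
  with n > k, which no longer contain the large power (1/q)^k, so their sum is at most K times the
  sum of (j + 1) q^j.\<close>

lemma truncated_series_error:
  fixes f :: "nat \<Rightarrow> real"
  assumes F: "(\<lambda>n. f n * q ^ n) sums F" and q: "0 < q" "q < 1"
    and bd: "\<And>j. \<bar>f (j + Suc k)\<bar> \<le> K * (real j + 1)"
  shows "\<bar>(\<Sum>n\<le>k. f n * (1 / q) ^ (k - n)) - (1 / q) ^ k * F\<bar> \<le> K / (1 - q)\<^sup>2"
proof -
  have K0: "K \<ge> 0" using bd[of 0] by simp
  have 1: "(\<Sum>n\<le>k. f n * (1 / q) ^ (k - n)) = (1 / q) ^ k * (\<Sum>n<Suc k. f n * q ^ n)"
    unfolding sum_distrib_left lessThan_Suc_atMost
  proof (intro sum.cong refl)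
    fix n assume "n \<in> {..k}"
    hence "(1 / q) ^ k = (1 / q) ^ (k - n) * (1 / q) ^ n" by (simp flip: power_add)
    moreover have "(1 / q) ^ n * q ^ n = 1" using q by (simp flip: power_mult_distrib)
    ultimately show "f n * (1 / q) ^ (k - n) = (1 / q) ^ k * (f n * q ^ n)" by (simp add: mult_ac)
  qed
  have tail: "(\<lambda>j. f (j + Suc k) * q ^ (j + Suc k)) sums (F - (\<Sum>n<Suc k. f n * q ^ n))"
    by (rule sums_split_initial_segment[OF F])
  hence "(\<lambda>j. (1 / q) ^ k * (f (j + Suc k) * q ^ (j + Suc k))) sums ((1 / q) ^ k * (F - (\<Sum>n<Suc k. f n * q ^ n)))"
    by (rule sums_mult)
  also have "(\<lambda>j. (1 / q) ^ k * (f (j + Suc k) * q ^ (j + Suc k))) = (\<lambda>j. f (j + Suc k) * q ^ Suc j)"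
  proof
    fix j
    have "(1 / q) ^ k * q ^ k = 1" using q by (simp flip: power_mult_distrib)
    moreover have "q ^ (j + Suc k) = q ^ Suc j * q ^ k" by (simp flip: power_add)
    hence "(1 / q) ^ k * (f (j + Suc k) * q ^ (j + Suc k)) = ((1 / q) ^ k * q ^ k) * (f (j + Suc k) * q ^ Suc j)"
      by (simp only: mult_ac)
    ultimately show "(1 / q) ^ k * (f (j + Suc k) * q ^ (j + Suc k)) = f (j + Suc k) * q ^ Suc j"
      by (simp only: mult_1_left)
  qed
  finally have T: "(\<lambda>j. f (j + Suc k) * q ^ Suc j) sums ((1 / q) ^ k * (F - (\<Sum>n<Suc k. f n * q ^ n)))" .
  have "(\<lambda>n. real (Suc n) * q ^ n) sums (1 / (1 - q)\<^sup>2)"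
    using geometric_deriv_sums[of q] q by simp
  hence M: "(\<lambda>n. K * (real (Suc n) * q ^ n)) sums (K * (1 / (1 - q)\<^sup>2))" by (rule sums_mult)
  have le: "\<bar>f (j + Suc k) * q ^ Suc j\<bar> \<le> K * (real (Suc j) * q ^ j)" for j
  proof -
    have "\<bar>f (j + Suc k)\<bar> * q ^ Suc j \<le> (K * (real j + 1)) * q ^ j"
      using q K0 by (intro mult_mono bd) (auto simp: mult_left_le_one_le)
    thus ?thesis using q by (simp add: abs_mult add_ac mult.assoc)
  qed
  have "\<bar>(1 / q) ^ k * (F - (\<Sum>n<Suc k. f n * q ^ n))\<bar> \<le> K * (1 / (1 - q)\<^sup>2)"
  proof (rule abs_leI)
    show "(1 / q) ^ k * (F - (\<Sum>n<Suc k. f n * q ^ n)) \<le> K * (1 / (1 - q)\<^sup>2)"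
      by (rule sums_le[OF _ T M]) (use le abs_le_iff in blast)
    show "- ((1 / q) ^ k * (F - (\<Sum>n<Suc k. f n * q ^ n))) \<le> K * (1 / (1 - q)\<^sup>2)"
      by (rule sums_le[OF _ sums_minus[OF T] M]) (use le abs_le_iff in blast)
  qed
  thus ?thesis unfolding 1 by (simp add: right_diff_distrib abs_minus_commute)
qed

lemma exp_2_ln: "k \<ge> 1 \<Longrightarrow> exp (2 * ln (real k)) = (real k)\<^sup>2"
  using exp_of_nat_mult[of 2 "ln (real k)"] by simp

text \<open>The weights with parameter 2 ln k have total mass at most k^2.\<close>

lemma exp_conv_bounds:
  obtains C :: real where "C > 0"
    "\<And>n k. k \<ge> 1 \<Longrightarrow> \<bar>exp_conv pole_coeff0 (2 * ln (real k)) n\<bar> \<le> C * (real k)\<^sup>2"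
    "\<And>n k. k \<ge> 1 \<Longrightarrow> \<bar>exp_conv pole_coeff1 (2 * ln (real k)) n\<bar> \<le> C * (real n + 1) * (real k)\<^sup>2"
    "\<And>n. \<bar>pole_coeff0 n\<bar> \<le> C" "\<And>n. \<bar>pole_coeff1 n\<bar> \<le> C * (real n + 1)"
proof -
  obtain C :: real where C: "C > 0"
    "\<And>n. \<bar>pole_coeff0 n\<bar> \<le> C" "\<And>n. \<bar>pole_coeff1 n\<bar> \<le> C * (real n + 1)"
    using pole_coeff_bounds by metis
  have 1: "\<bar>exp_conv pole_coeff0 (2 * ln (real k)) n\<bar> \<le> C * (real k)\<^sup>2" if "k \<ge> 1" for k n
    using exp_convolution_bound[of "2 * ln (real k)" n "\<lambda>m. pole_coeff0 (n - m)" C] C(2) that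
    by (simp add: exp_conv_def exp_2_ln mult.commute)
  have 2: "\<bar>exp_conv pole_coeff1 (2 * ln (real k)) n\<bar> \<le> C * (real n + 1) * (real k)\<^sup>2" if "k \<ge> 1" for k n
  proof -
    have "\<bar>pole_coeff1 (n - m)\<bar> \<le> C * (real n + 1)" for m
    proof -
      have "C * (real (n - m) + 1) \<le> C * (real n + 1)" using C(1) by (intro mult_left_mono) auto
      with C(3)[of "n - m"] show ?thesis by linarith
    qed
    thus ?thesis
      using exp_convolution_bound[of "2 * ln (real k)" n "\<lambda>m. pole_coeff1 (n - m)" "C * (real n + 1)"] that
      by (simp add: exp_conv_def exp_2_ln mult.commute)
  qed
  show ?thesis using that C(1-3) 1 2 by blast
qed

text \<open>Gamma has a positive minimum on the compact interval [1, 3]; the shift by 1 stays away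
  from the pole at 0.\<close>

lemma inverse_Gamma_bound:
  obtains c :: real where "c > 0" "\<And>z. 0 < z \<Longrightarrow> z \<le> 2 \<Longrightarrow> 1 / Gamma (1 + z) \<le> c"
proof -
  have "continuous_on {1..3 :: real} Gamma"
    by (intro continuous_intros) (auto elim!: nonpos_Ints_cases)
  then obtain y where y: "y \<in> {1..3 :: real}" "\<And>x. x \<in> {1..3} \<Longrightarrow> Gamma y \<le> Gamma x"
    using continuous_attains_inf[of "{1..3 :: real}" Gamma] by auto
  have y0: "Gamma y > 0" using y(1) by (intro Gamma_real_pos) auto
  show ?thesis
  proof (rule that[of "1 / Gamma y"])
    show "1 / Gamma y > 0" using y0 by simp
    show "1 / Gamma (1 + z) \<le> 1 / Gamma y" if "0 < z" "z \<le> 2" for z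
      using y(2)[of "1 + z"] y0 that by (intro divide_left_mono) auto
  qed
qed

text \<open>Completing the series at q = z/2 gives k^z d(z) / (1 - z/2). The power of k cancels
  against k^-z, and what remains is G(z). The 1/z of the first term and 1/Gamma(z) combine to
  1/Gamma(1 + z), so the estimate is uniform as z tends to 0.\<close>

lemma erdos_gamma_first_term:
  obtains C :: real where "C > 0"
    "\<And>k z. k \<ge> 1 \<Longrightarrow> 0 < z \<Longrightarrow> z < 2 \<Longrightarrow>
      \<bar>erdos_gamma k z - G_fun z - (z / 2) ^ k / Gamma z * second_term k z\<bar>
       \<le> C / (2 - z)\<^sup>2 * ((z / 2) ^ k * real k powr (2 - z))"
proof -
  obtain A :: real where A: "A > 0"
    "\<And>k z. k \<ge> 1 \<Longrightarrow> 0 < z \<Longrightarrow> z \<le> 2 \<Longrightarrow>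
      \<bar>Gamma z * (2 / z) ^ k * erdos_gamma k z -
        (first_term k z + second_term k z)\<bar>
      \<le> A * real k powr (2 - z) / z"
    using erdos_gamma_decomposition by blast
  obtain B :: real where B: "B > 0"
    "\<And>n k. k \<ge> 1 \<Longrightarrow> \<bar>exp_conv pole_coeff0 (2 * ln (real k)) n\<bar> \<le> B * (real k)\<^sup>2"
    "\<And>n. \<bar>pole_coeff0 n\<bar> \<le> B"
    using exp_conv_bounds by metis
  obtain c :: real where c: "c > 0" "\<And>z. 0 < z \<Longrightarrow> z \<le> 2 \<Longrightarrow> 1 / Gamma (1 + z) \<le> c"
    using inverse_Gamma_bound by blast
  define C where "C = c * (4 * A + 4 * B)"
  have main: "\<bar>erdos_gamma k z - G_fun z - (z / 2) ^ k / Gamma z * second_term k z\<bar>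
       \<le> C / (2 - z)\<^sup>2 * ((z / 2) ^ k * real k powr (2 - z))" if k: "k \<ge> 1" and z: "0 < z" "z < 2" for k z
  proof -
    define S where "S = (\<Sum>n\<le>k. exp_conv pole_coeff0 (2 * ln (real k)) n * (2 / z) ^ (k - n))"
    define q where "q = z / 2"
    have q: "0 < q" "q < 1" using z by (auto simp: q_def)
    have Gz: "Gamma z > 0" using z by (intro Gamma_real_pos)
    have "z \<notin> \<int>\<^sub>\<le>\<^sub>0" using z by (auto elim!: nonpos_Ints_cases)
    hence G1: "Gamma (1 + z) = z * Gamma z" using Gamma_plus1[of z] by (simp add: add.commute)
    have sm: "summable (\<lambda>n. \<bar>pole_coeff0 n * q ^ n\<bar>)"
    proof (rule summable_comparison_test')
      show "summable (\<lambda>n. B * q ^ n)" using q by (intro summable_mult summable_geometric) auto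
      show "norm \<bar>pole_coeff0 n * q ^ n\<bar> \<le> B * q ^ n" for n
        using B(3)[of n] q by (simp add: abs_mult mult_right_mono)
    qed
    have "(\<lambda>n. pole_coeff0 n * q ^ n) sums (d_fun z / (1 - q))"
      using pole_coeff0_sums[OF z] by (simp add: q_def)
    from exp_conv_sums[OF this sm, of "2 * ln (real k)"]
    have "(\<lambda>n. exp_conv pole_coeff0 (2 * ln (real k)) n * q ^ n) sums (real k powr z * (d_fun z / (1 - q)))"
      using k by (simp add: q_def powr_def mult.commute)
    from truncated_series_error[OF this q, where K = "B * (real k)\<^sup>2" and k = k]
    have "\<bar>(\<Sum>n\<le>k. exp_conv pole_coeff0 (2 * ln (real k)) n * (1 / q) ^ (k - n)) - (1 / q) ^ k * (real k powr z * (d_fun z / (1 - q)))\<bar>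
        \<le> B * (real k)\<^sup>2 / (1 - q)\<^sup>2"
    proof -
      have "\<bar>exp_conv pole_coeff0 (2 * ln (real k)) (j + Suc k)\<bar> \<le> B * (real k)\<^sup>2 * (real j + 1)" for j
      proof -
        have "B * (real k)\<^sup>2 * 1 \<le> B * (real k)\<^sup>2 * (real j + 1)" using B(1) by (intro mult_left_mono) auto
        with B(2)[OF k, of "j + Suc k"] show ?thesis by simp
      qed
      thus ?thesis
        using truncated_series_error[OF \<open>(\<lambda>n. exp_conv pole_coeff0 (2 * ln (real k)) n * q ^ n) sums (real k powr z * (d_fun z / (1 - q)))\<close> q] by blast
    qed
    hence S: "\<bar>S - (2 / z) ^ k * (real k powr z * (d_fun z / (1 - q)))\<bar> \<le> B * (real k)\<^sup>2 / (1 - q)\<^sup>2"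
      by (simp add: S_def q_def)
    \<comment> \<open>Undoes the normalisation by Gamma(z) (2/z)^k in
      \<open>erdos_gamma_decomposition\<close>.\<close>
    define W where "W = q ^ k / Gamma z"
    have W0: "W > 0" using q Gz by (simp add: W_def)
    have kz: "real k powr (- z) * real k powr z = 1" using k by (simp add: powr_add[symmetric])
    have qk: "q ^ k * (2 / z) ^ k = 1" using z by (simp add: q_def flip: power_mult_distrib)
    have Gf: "W * (real k powr (- z) / z * ((2 / z) ^ k * (real k powr z * (d_fun z / (1 - q))))) = G_fun z"
    proof -
      have "W * (real k powr (- z) / z * ((2 / z) ^ k * (real k powr z * (d_fun z / (1 - q))))) =
        (q ^ k * (2 / z) ^ k) * (real k powr (- z) * real k powr z) * (d_fun z / ((1 - q) * (z * Gamma z)))"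
        unfolding W_def by (simp add: mult_ac)
      thus ?thesis unfolding qk kz using z by (simp add: G_fun_eq_d_fun q_def G1)
    qed
    have Ge: "W * (Gamma z * (2 / z) ^ k * erdos_gamma k z) = erdos_gamma k z"
    proof -
      have "W * (Gamma z * (2 / z) ^ k * erdos_gamma k z) = (q ^ k * (2 / z) ^ k) * erdos_gamma k z"
        using Gz by (simp add: W_def)
      thus ?thesis unfolding qk by simp
    qed
    let ?e1 = "Gamma z * (2 / z) ^ k * erdos_gamma k z - (real k powr (- z) / z * S + second_term k z)"
    let ?e2 = "real k powr (- z) / z * (S - (2 / z) ^ k * (real k powr z * (d_fun z / (1 - q))))"
    have "erdos_gamma k z - G_fun z - (z / 2) ^ k / Gamma z * second_term k z = W * ?e1 + W * ?e2"
      unfolding right_diff_distrib distrib_left Ge Gf by (simp add: W_def q_def)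
    hence "\<bar>erdos_gamma k z - G_fun z - (z / 2) ^ k / Gamma z * second_term k z\<bar> \<le> W * \<bar>?e1\<bar> + W * \<bar>?e2\<bar>"
      using W0 abs_triangle_ineq[of "W * ?e1" "W * ?e2"] by (simp add: abs_mult)
    also have "\<dots> \<le> W * (A * real k powr (2 - z) / z) + W * (B * real k powr (2 - z) / (1 - q)\<^sup>2 / z)"
    proof (intro add_mono mult_left_mono)
      show "\<bar>?e1\<bar> \<le> A * real k powr (2 - z) / z"
        using A(2)[OF k] z unfolding S_def first_term_def by simp
      have "\<bar>?e2\<bar> \<le> real k powr (- z) / z * (B * (real k)\<^sup>2 / (1 - q)\<^sup>2)"
        unfolding abs_mult using z by (intro mult_mono S) auto
      also have "\<dots> = B * ((real k)\<^sup>2 * real k powr (- z)) / (1 - q)\<^sup>2 / z" by (simp add: mult_ac)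
      also have "(real k)\<^sup>2 * real k powr (- z) = real k powr (2 - z)"
        using k by (simp add: powr_diff powr_minus_divide)
      finally show "\<bar>?e2\<bar> \<le> B * real k powr (2 - z) / (1 - q)\<^sup>2 / z" .
    qed (use W0 in auto)
    also have "\<dots> = (1 / Gamma (1 + z)) * ((A + B / (1 - q)\<^sup>2) * (q ^ k * real k powr (2 - z)))"
      unfolding G1 W_def by (simp add: add_divide_distrib algebra_simps)
    also have "\<dots> \<le> c * ((4 * A + 4 * B) / (2 - z)\<^sup>2 * (q ^ k * real k powr (2 - z)))"
    proof (intro mult_mono)
      have e: "1 / (1 - q)\<^sup>2 = 4 / (2 - z)\<^sup>2"
        by (simp add: q_def power2_eq_square field_simps)
      \<comment> \<open>Since 1 \<le> 4 / (2 - z)^2, the bounded constant A can be merged with the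
        one that blows up at z = 2.\<close>
      have "(2 - z)\<^sup>2 \<le> 2\<^sup>2" using z by (intro power_mono) auto
      hence "1 \<le> 4 / (2 - z)\<^sup>2" using z by simp
      hence "A * 1 \<le> A * (4 / (2 - z)\<^sup>2)" using A(1) by (intro mult_left_mono) auto
      moreover have "B / (1 - q)\<^sup>2 = B * (4 / (2 - z)\<^sup>2)" using e by (simp add: divide_inverse)
      moreover have "(4 * A + 4 * B) / (2 - z)\<^sup>2 = A * (4 / (2 - z)\<^sup>2) + B * (4 / (2 - z)\<^sup>2)"
        by (simp add: add_divide_distrib mult.commute)
      ultimately show "A + B / (1 - q)\<^sup>2 \<le> (4 * A + 4 * B) / (2 - z)\<^sup>2" by simp
    qed (use c z q A(1) B(1) in auto)
    also have "\<dots> = C / (2 - z)\<^sup>2 * ((z / 2) ^ k * real k powr (2 - z))"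
      by (simp add: C_def q_def)
    finally show ?thesis .
  qed
  have "C > 0" using c A(1) B(1) by (simp add: C_def)
  with main that show ?thesis by blast
qed

section \<open>The second term\<close>

lemma sum_times_power_bound:
  assumes f: "\<And>n. \<bar>f n\<bar> \<le> K * (real n + 1)" and r: "r \<ge> 0"
  shows "\<bar>\<Sum>n\<le>k. f n * r ^ (k - n)\<bar> \<le> K * (real k + 1) * (\<Sum>n\<le>k. r ^ n)"
proof -
  have K0: "K \<ge> 0" using f[of 0] by simp
  have "\<bar>\<Sum>n\<le>k. f n * r ^ (k - n)\<bar> \<le> (\<Sum>n\<le>k. K * (real k + 1) * r ^ (k - n))"
  proof (rule order_trans[OF sum_abs], rule sum_mono)
    fix n assume "n \<in> {..k}"
    hence "K * (real n + 1) \<le> K * (real k + 1)" using K0 by (intro mult_left_mono) auto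
    hence "\<bar>f n\<bar> * r ^ (k - n) \<le> K * (real k + 1) * r ^ (k - n)"
      using f[of n] r by (intro mult_right_mono) auto
    thus "\<bar>f n * r ^ (k - n)\<bar> \<le> K * (real k + 1) * r ^ (k - n)" using r by (simp add: abs_mult)
  qed
  also have "\<dots> = K * (real k + 1) * (\<Sum>n\<le>k. r ^ (k - n))" by (simp only: sum_distrib_left)
  also have "(\<Sum>n\<le>k. r ^ (k - n)) = (\<Sum>n\<le>k. r ^ n)" by (rule sum.nat_diff_reindex[of _ "Suc k", unfolded lessThan_Suc_atMost, simplified])
  finally show ?thesis .
qed

text \<open>For z > 1 the ratio 2 / (z + 1) is below 1 and the geometric sum is at most (z + 1) / (z
  - 1). The second bound holds across z = 1 by estimating every power by the largest one; it serves
  where there is exponential room.\<close>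

lemma second_term_bounds:
  obtains C :: real where "C > 0"
    "\<And>k z. k \<ge> 1 \<Longrightarrow> 1 < z \<Longrightarrow> z \<le> 2 \<Longrightarrow> \<bar>second_term k z\<bar> \<le> C / (z - 1) * real k powr (2 - z)"
    "\<And>k z. k \<ge> 1 \<Longrightarrow> 0 < z \<Longrightarrow> z \<le> 2 \<Longrightarrow>
       \<bar>second_term k z\<bar> \<le> C * real k powr (2 - z) * real k * max 1 (2 / (z + 1)) ^ k"
proof -
  obtain B :: real where B: "B > 0"
    "\<And>n k. k \<ge> 1 \<Longrightarrow> \<bar>exp_conv pole_coeff1 (2 * ln (real k)) n\<bar> \<le> B * (real n + 1) * (real k)\<^sup>2"
    using exp_conv_bounds by metis
  have gen: "\<bar>second_term k z\<bar> \<le> 2 * B * real k powr (2 - z) / (z + 1) * (\<Sum>n\<le>k. (2 / (z + 1)) ^ n)"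
    if k: "k \<ge> 1" and z: "0 < z" "z \<le> 2" for k z
  proof -
    let ?s = "\<Sum>n\<le>k. (2 / (z + 1)) ^ n"
    have s0: "?s \<ge> 0" using z by (intro sum_nonneg) auto
    have "\<bar>\<Sum>n\<le>k. exp_conv pole_coeff1 (2 * ln (real k)) n * (2 / (z + 1)) ^ (k - n)\<bar> \<le>
      B * (real k)\<^sup>2 * (real k + 1) * ?s"
      by (rule sum_times_power_bound) (use B(2)[OF k] z in \<open>auto simp: mult_ac\<close>)
    also have "\<dots> \<le> B * (real k)\<^sup>2 * (2 * real k) * ?s"
      using B(1) s0 k by (intro mult_right_mono mult_left_mono) auto
    finally have "real k powr (- (z + 1)) / (z + 1) * \<bar>\<Sum>n\<le>k. exp_conv pole_coeff1 (2 * ln (real k)) n * (2 / (z + 1)) ^ (k - n)\<bar>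
      \<le> real k powr (- (z + 1)) / (z + 1) * (B * (real k)\<^sup>2 * (2 * real k) * ?s)"
      using z by (intro mult_left_mono) auto
    also have "\<dots> = 2 * B * (real k ^ 3 * real k powr (- (z + 1))) / (z + 1) * ?s"
      by (simp add: power2_eq_square power3_eq_cube mult_ac)
    also have "real k ^ 3 * real k powr (- (z + 1)) = real k powr (2 - z)"
    proof -
      have "real k ^ 3 * real k powr (- (z + 1)) = real k powr 3 * real k powr (- (z + 1))" using k by simp
      also have "\<dots> = real k powr (3 + - (z + 1))" by (rule powr_add[symmetric])
      finally show ?thesis by simp
    qed
    finally show ?thesis using z by (simp add: second_term_def abs_mult)
  qed
  show ?thesis
  proof (rule that[of "4 * B"])
    show "4 * B > 0" using B(1) by simp
    fix k :: nat and z :: real assume k: "k \<ge> 1"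
    show "\<bar>second_term k z\<bar> \<le> 4 * B / (z - 1) * real k powr (2 - z)" if z: "1 < z" "z \<le> 2"
    proof -
      have r: "0 \<le> 2 / (z + 1)" "2 / (z + 1) < 1" using z by auto
      have "(\<Sum>n\<le>k. (2 / (z + 1)) ^ n) \<le> (\<Sum>n. (2 / (z + 1)) ^ n)"
        using r by (intro sum_le_suminf summable_geometric) auto
      also have "\<dots> = 1 / (1 - 2 / (z + 1))" using r by (intro suminf_geometric) auto
      also have "\<dots> = (z + 1) / (z - 1)" using z by (simp add: field_simps)
      finally have s: "(\<Sum>n\<le>k. (2 / (z + 1)) ^ n) \<le> (z + 1) / (z - 1)" .
      have "\<bar>second_term k z\<bar> \<le> 2 * B * real k powr (2 - z) / (z + 1) * (\<Sum>n\<le>k. (2 / (z + 1)) ^ n)"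
        using z by (intro gen k) auto
      also have "\<dots> \<le> 2 * B * real k powr (2 - z) / (z + 1) * ((z + 1) / (z - 1))"
        using B(1) z by (intro mult_left_mono s) auto
      also have "\<dots> = 2 * (B / (z - 1) * real k powr (2 - z))" using z by simp
      also have "\<dots> \<le> 4 * (B / (z - 1) * real k powr (2 - z))"
        using z B(1) by (intro mult_right_mono mult_nonneg_nonneg) auto
      finally show ?thesis by simp
    qed
    show "\<bar>second_term k z\<bar> \<le> 4 * B * real k powr (2 - z) * real k * max 1 (2 / (z + 1)) ^ k" if z: "0 < z" "z \<le> 2"
    proof -
      let ?M = "max 1 (2 / (z + 1))"
      have "(\<Sum>n\<le>k. (2 / (z + 1)) ^ n) \<le> (\<Sum>n\<le>k. ?M ^ k)"
      proof (rule sum_mono)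
        fix n assume "n \<in> {..k}"
        have "(2 / (z + 1)) ^ n \<le> ?M ^ n" using z by (intro power_mono) auto
        also have "\<dots> \<le> ?M ^ k" using \<open>n \<in> {..k}\<close> by (intro power_increasing) auto
        finally show "(2 / (z + 1)) ^ n \<le> ?M ^ k" .
      qed
      also have "\<dots> = (real k + 1) * ?M ^ k" by simp
      also have "\<dots> \<le> (2 * real k) * ?M ^ k" using k by (intro mult_right_mono) (auto simp: le_max_iff_disj)
      finally have s: "(\<Sum>n\<le>k. (2 / (z + 1)) ^ n) \<le> (2 * real k) * ?M ^ k" .
      have "\<bar>second_term k z\<bar> \<le> 2 * B * real k powr (2 - z) / (z + 1) * (\<Sum>n\<le>k. (2 / (z + 1)) ^ n)"
        by (rule gen[OF k z])
      also have "\<dots> \<le> 2 * B * real k powr (2 - z) / 1 * ((2 * real k) * ?M ^ k)"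
        using B(1) z by (intro mult_mono s divide_left_mono mult_nonneg_nonneg sum_nonneg) (auto simp: le_max_iff_disj)
      finally show ?thesis by simp
    qed
  qed
qed

definition second_const :: "real \<Rightarrow> real" where
  "second_const z = euler_mascheroni - z * ln 2 / (1 - z) -
     (\<Sum>\<^sub>\<infinity>p\<in>{p::nat. prime p \<and> p > 2}. z * ln (real p) / ((real p - 1) * (real p - z - 1)))"

text \<open>At x = z + 1 the factor 1 - x in \<open>first_order_sum\<close> is - z, and ln 2
  combines with the contribution of the prime 2 to - z ln 2 / (1 - z).\<close>

lemma second_const_eq:
  assumes z: "0 < z" "z < 1"
  shows "first_order_sum (z + 1) - ln 2 * ((z + 1) / 2) / (1 - (z + 1) / 2) = (z + 1) * second_const z"
proof -
  have "(\<Sum>\<^sub>\<infinity>p\<in>odd_primes. (z + 1) * (1 - (z + 1)) * ln (real p) / ((real p - 1) * (real p - (z + 1)))) =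
    (\<Sum>\<^sub>\<infinity>p\<in>odd_primes. (- (z + 1)) * (z * ln (real p) / ((real p - 1) * (real p - z - 1))))"
  proof (rule infsum_cong)
    fix p :: nat
    have "real p - (z + 1) = real p - z - 1" "(z + 1) * (1 - (z + 1)) * ln (real p) = - (z + 1) * (z * ln (real p))"
      by (simp_all add: algebra_simps)
    thus "(z + 1) * (1 - (z + 1)) * ln (real p) / ((real p - 1) * (real p - (z + 1))) =
      - (z + 1) * (z * ln (real p) / ((real p - 1) * (real p - z - 1)))"
      by (simp only: times_divide_eq_right)
  qed
  also have "\<dots> = - (z + 1) * (\<Sum>\<^sub>\<infinity>p\<in>odd_primes. z * ln (real p) / ((real p - 1) * (real p - z - 1)))"
    by (rule infsum_cmult_right')
  finally have 1: "first_order_sum (z + 1) = (z + 1) * (euler_mascheroni + ln 2 -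
     (\<Sum>\<^sub>\<infinity>p\<in>odd_primes. z * ln (real p) / ((real p - 1) * (real p - z - 1))))"
    by (simp only: first_order_sum_def) (simp add: algebra_simps)
  have 2: "ln 2 * ((z + 1) / 2) / (1 - (z + 1) / 2) = (z + 1) * (ln 2 / (1 - z))"
    using z by (simp add: divide_simps)
  have 3: "ln 2 - ln 2 / (1 - z) = - (z * ln 2 / (1 - z))" using z by (simp add: divide_simps) (simp add: algebra_simps)
  show ?thesis
    unfolding 1 2 right_diff_distrib[symmetric] second_const_def odd_primes_def[symmetric]
    using 3 by simp
qed

text \<open>Completion of the series again, now at q = (z + 1) / 2, which is below 1 exactly when z
  < 1. The completed value carries k^(z + 1), cancelled by k^-(z + 1).\<close>

lemma second_term_lt_1:
  obtains C :: real where "C > 0"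
    "\<And>k z. k \<ge> 1 \<Longrightarrow> 0 < z \<Longrightarrow> z < 1 \<Longrightarrow>
      \<bar>second_term k z - (2 / (z + 1)) ^ k * (2 * d_fun (z + 1) / (1 - z) * second_const z)\<bar>
        \<le> C / (1 - z)\<^sup>2 * real k powr (2 - z)"
proof -
  obtain B :: real where B: "B > 0"
    "\<And>n k. k \<ge> 1 \<Longrightarrow> \<bar>exp_conv pole_coeff1 (2 * ln (real k)) n\<bar> \<le> B * (real n + 1) * (real k)\<^sup>2"
    "\<And>n. \<bar>pole_coeff1 n\<bar> \<le> B * (real n + 1)"
    using exp_conv_bounds by metis
  have main: "\<bar>second_term k z - (2 / (z + 1)) ^ k * (2 * d_fun (z + 1) / (1 - z) * second_const z)\<bar>
        \<le> 12 * B / (1 - z)\<^sup>2 * real k powr (2 - z)" if k: "k \<ge> 1" and z: "0 < z" "z < 1" for k z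
  proof -
    define q where "q = (z + 1) / 2"
    have q: "0 < q" "q < 1" using z by (auto simp: q_def)
    define D where "D = d_fun (z + 1) / (1 - q) * ((z + 1) * second_const z)"
    let ?f = "exp_conv pole_coeff1 (2 * ln (real k))"
    have sm: "summable (\<lambda>n. \<bar>pole_coeff1 n * q ^ n\<bar>)"
    proof (rule summable_comparison_test')
      show "summable (\<lambda>n. B * (real (Suc n) * q ^ n))"
        using geometric_deriv_sums[of q] q by (intro summable_mult) (auto simp: sums_iff)
      show "norm \<bar>pole_coeff1 n * q ^ n\<bar> \<le> B * (real (Suc n) * q ^ n)" for n
      proof -
        have "\<bar>pole_coeff1 n\<bar> * q ^ n \<le> (B * (real n + 1)) * q ^ n"
          using B(3) q by (intro mult_right_mono) auto
        thus ?thesis using q by (simp add: abs_mult add_ac mult.assoc)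
      qed
    qed
    have "(\<lambda>n. pole_coeff1 n * q ^ n) sums D"
      using pole_coeff1_sums[of "z + 1"] z second_const_eq[OF z] by (simp add: q_def D_def)
    from exp_conv_sums[OF this sm, of "2 * ln (real k)"]
    have sF: "(\<lambda>n. ?f n * q ^ n) sums (real k powr (z + 1) * D)"
      using k by (simp add: q_def powr_def mult.commute)
    have bd: "\<bar>?f (j + Suc k)\<bar> \<le> 3 * B * real k ^ 3 * (real j + 1)" for j
    proof -
      \<comment> \<open>The growth j + k + 2 \<le> 3 k (j + 1) is split into a power of k and the
        linear growth in j that \<open>truncated_series_error\<close> permits.\<close>
      have "real (j + Suc k) + 1 \<le> (3 * real k) * (real j + 1)"
      proof -
        have "real j * 1 \<le> real j * real k" using k by (intro mult_left_mono) auto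
        thus ?thesis using k by (simp add: algebra_simps)
      qed
      hence "B * (real (j + Suc k) + 1) * (real k)\<^sup>2 \<le> B * ((3 * real k) * (real j + 1)) * (real k)\<^sup>2"
        using B(1) by (intro mult_right_mono mult_left_mono) auto
      also have "\<dots> = 3 * B * real k ^ 3 * (real j + 1)" by (simp add: power2_eq_square power3_eq_cube)
      finally show ?thesis using B(2)[OF k, of "j + Suc k"] by linarith
    qed
    have "\<bar>(\<Sum>n\<le>k. ?f n * (1 / q) ^ (k - n)) - (1 / q) ^ k * (real k powr (z + 1) * D)\<bar> \<le> 3 * B * real k ^ 3 / (1 - q)\<^sup>2"
      by (rule truncated_series_error[OF sF q bd])
    hence S: "\<bar>(\<Sum>n\<le>k. ?f n * (2 / (z + 1)) ^ (k - n)) - (2 / (z + 1)) ^ k * (real k powr (z + 1) * D)\<bar> \<le> 3 * B * real k ^ 3 / (1 - q)\<^sup>2"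
      by (simp add: q_def)
    let ?w = "real k powr (- (z + 1)) / (z + 1)"
    have kz: "real k powr (- (z + 1)) * real k powr (z + 1) = 1" using k by (simp add: powr_add[symmetric])
    have e: "?w * ((2 / (z + 1)) ^ k * (real k powr (z + 1) * D)) = (2 / (z + 1)) ^ k * (2 * d_fun (z + 1) / (1 - z) * second_const z)"
    proof -
      have "?w * ((2 / (z + 1)) ^ k * (real k powr (z + 1) * D)) =
        (real k powr (- (z + 1)) * real k powr (z + 1)) * ((2 / (z + 1)) ^ k * (D / (z + 1)))" by (simp only: mult_ac times_divide_eq_left times_divide_eq_right)
      also have "D / (z + 1) = 2 * d_fun (z + 1) / (1 - z) * second_const z"
      proof -
        have qz: "1 - q = (1 - z) / 2" by (simp add: q_def field_simps)
        show ?thesis unfolding D_def qz using z by (simp add: mult_ac)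
      qed
      finally show ?thesis unfolding kz by simp
    qed
    have "\<bar>second_term k z - (2 / (z + 1)) ^ k * (2 * d_fun (z + 1) / (1 - z) * second_const z)\<bar> =
      ?w * \<bar>(\<Sum>n\<le>k. ?f n * (2 / (z + 1)) ^ (k - n)) - (2 / (z + 1)) ^ k * (real k powr (z + 1) * D)\<bar>"
      unfolding e[symmetric] second_term_def right_diff_distrib[symmetric] abs_mult using z by simp
    also have "\<dots> \<le> real k powr (- (z + 1)) / 1 * (3 * B * real k ^ 3 / (1 - q)\<^sup>2)"
      using z B(1) by (intro mult_mono S divide_left_mono) auto
    also have "\<dots> = 3 * B * (real k ^ 3 * real k powr (- (z + 1))) * (1 / (1 - q)\<^sup>2)" by (simp add: mult_ac)
    also have "real k ^ 3 * real k powr (- (z + 1)) = real k powr (2 - z)"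
    proof -
      have "real k ^ 3 * real k powr (- (z + 1)) = real k powr 3 * real k powr (- (z + 1))" using k by simp
      also have "\<dots> = real k powr (3 + - (z + 1))" by (rule powr_add[symmetric])
      finally show ?thesis by simp
    qed
    also have "1 / (1 - q)\<^sup>2 = 4 / (1 - z)\<^sup>2" by (simp add: q_def power2_eq_square field_simps)
    finally show ?thesis by (simp add: mult_ac)
  qed
  show ?thesis by (rule that[of "12 * B"]) (use B(1) main in auto)
qed

section \<open>Factorial moments and truncation of the exponential weights\<close>

lemma exponential_moments:
  fixes y :: real
  shows "(\<lambda>i. y ^ i / fact i) sums exp y"
    and "(\<lambda>i. y ^ i / fact i * real i) sums (y * exp y)"
    and "(\<lambda>i. y ^ i / fact i * (real i * (real i - 1))) sums (y\<^sup>2 * exp y)"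
proof -
  show e: "(\<lambda>i. y ^ i / fact i) sums exp y"
    using exp_converges[of y] by (simp add: divide_inverse mult.commute)
  have s: "y ^ Suc i / fact (Suc i) * real (Suc i) = y * (y ^ i / fact i)" for i
    by (simp add: divide_simps del: of_nat_Suc)
  have "(\<lambda>i. y ^ Suc i / fact (Suc i) * real (Suc i)) sums (y * exp y)"
    unfolding s by (intro sums_mult e)
  thus m: "(\<lambda>i. y ^ i / fact i * real i) sums (y * exp y)" by (subst (asm) sums_Suc_iff) simp
  have "y ^ Suc i / fact (Suc i) * (real (Suc i) * (real (Suc i) - 1)) = y * (y ^ i / fact i * real i)" for i
    unfolding mult.assoc[symmetric] s by simp
  hence "(\<lambda>i. y ^ Suc i / fact (Suc i) * (real (Suc i) * (real (Suc i) - 1))) sums (y * (y * exp y))"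
    by (simp only:) (intro sums_mult m)
  thus "(\<lambda>i. y ^ i / fact i * (real i * (real i - 1))) sums (y\<^sup>2 * exp y)"
    by (subst (asm) sums_Suc_iff) (simp add: power2_eq_square mult.assoc)
qed

text \<open>The terms beyond k are bounded by the tail of h, hence by its full sum H, which is an
  explicit moment in the applications.\<close>

lemma partial_sum_error:
  fixes g h :: "nat \<Rightarrow> real"
  assumes g: "g sums S" and h: "h sums H" "\<And>i. h i \<ge> 0" and le: "\<And>i. i > k \<Longrightarrow> \<bar>g i\<bar> \<le> h i"
  shows "\<bar>(\<Sum>i\<le>k. g i) - S\<bar> \<le> H"
proof -
  have G: "(\<lambda>i. g (i + Suc k)) sums (S - (\<Sum>i<Suc k. g i))" by (rule sums_split_initial_segment[OF g])
  have Hs: "(\<lambda>i. h (i + Suc k)) sums (H - (\<Sum>i<Suc k. h i))" by (rule sums_split_initial_segment[OF h(1)])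
  have gh: "\<bar>g (i + Suc k)\<bar> \<le> h (i + Suc k)" for i by (rule le) simp
  have "S - (\<Sum>i<Suc k. g i) \<le> H - (\<Sum>i<Suc k. h i)"
    by (rule sums_le[OF _ G Hs]) (use gh abs_le_iff in blast)
  moreover have "- (S - (\<Sum>i<Suc k. g i)) \<le> H - (\<Sum>i<Suc k. h i)"
    by (rule sums_le[OF _ sums_minus[OF G] Hs]) (use gh abs_le_iff in blast)
  moreover have "0 \<le> (\<Sum>i<Suc k. h i)" by (rule sum_nonneg) (rule h(2))
  ultimately show ?thesis by (simp only: lessThan_Suc_atMost)
qed

text \<open>As exp (2 ln k) = k^2, the sums are k^2 times truncated Poisson expectations of mean y =
  2 ln k. The full sums are evaluated by factorial moments; the terms with i > k are dominated by i
  (i - 1), divided by k in the first case, whose moment y^2 exp y is O(k^3).\<close>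

lemma poisson_sums:
  assumes k: "k \<ge> 1"
  shows "\<bar>(\<Sum>i\<le>k. (2 * ln (real k)) ^ i / fact i * (real (k - i) + 1)) - (real k)\<^sup>2 * (real k - 2 * ln (real k))\<bar>
           \<le> 17 * (real k)\<^sup>2"
    and "\<bar>(\<Sum>i\<le>k. (2 * ln (real k)) ^ i / fact i * (real (k - i) * (real (k - i) + 1))) -
           (real k)\<^sup>2 * ((real k)\<^sup>2 - 4 * real k * ln (real k))\<bar> \<le> 33 * (real k) ^ 3"
proof -
  define y where "y = 2 * ln (real k)"
  have y0: "y \<ge> 0" using k by (simp add: y_def)
  have ey: "exp y = (real k)\<^sup>2" using exp_2_ln[OF k] by (simp add: y_def)
  have y2: "y\<^sup>2 \<le> 16 * real k"
  proof -
    have "ln (real k) \<le> real k powr (1/2) / (1/2)" using k by (intro ln_powr_bound) auto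
    hence "y \<le> 4 * sqrt (real k)" by (simp add: y_def powr_half_sqrt)
    hence "y\<^sup>2 \<le> (4 * sqrt (real k))\<^sup>2" using y0 by (intro power_mono)
    thus ?thesis by (simp add: power_mult_distrib)
  qed
  note mom = exponential_moments[of y]
  have a: "(\<lambda>i. (real k + 1) * (y ^ i / fact i) - y ^ i / fact i * real i) sums ((real k + 1) * exp y - y * exp y)"
    by (intro sums_diff sums_mult mom)
  have h: "(\<lambda>i. y ^ i / fact i * (real i * (real i - 1)) * (1 / real k)) sums (y\<^sup>2 * exp y * (1 / real k))"
    by (intro sums_mult2 mom)
  have nn: "0 \<le> y ^ i / fact i * (real i * (real i - 1))" for i
    using y0 by (cases i) auto
  have "\<bar>(\<Sum>i\<le>k. (real k + 1) * (y ^ i / fact i) - y ^ i / fact i * real i) - ((real k + 1) * exp y - y * exp y)\<bar>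
     \<le> y\<^sup>2 * exp y * (1 / real k)"
  proof (rule partial_sum_error[OF a h])
    show "0 \<le> y ^ i / fact i * (real i * (real i - 1)) * (1 / real k)" for i
      by (rule mult_nonneg_nonneg[OF nn]) simp
    fix i assume i: "i > k"
    \<comment> \<open>The absolute value is below i, and i - 1 \<ge> k converts this into the second
      factorial moment divided by k.\<close>
    have "\<bar>real k + 1 - real i\<bar> \<le> real i * (real i - 1) * (1 / real k)"
    proof -
      have "real i - 1 \<ge> real k" using i by simp
      hence "real i * real k \<le> real i * (real i - 1)" by (intro mult_left_mono) auto
      hence "real i \<le> real i * (real i - 1) * (1 / real k)" using k by (simp add: pos_le_divide_eq)
      thus ?thesis using i by simp
    qed
    hence "y ^ i / fact i * \<bar>real k + 1 - real i\<bar> \<le> y ^ i / fact i * (real i * (real i - 1) * (1 / real k))"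
      using y0 by (intro mult_left_mono) auto
    moreover have "\<bar>(real k + 1) * (y ^ i / fact i) - y ^ i / fact i * real i\<bar> = y ^ i / fact i * \<bar>real k + 1 - real i\<bar>"
    proof -
      have "(real k + 1) * (y ^ i / fact i) - y ^ i / fact i * real i = y ^ i / fact i * (real k + 1 - real i)"
        by (simp only: right_diff_distrib mult.commute)
      thus ?thesis using y0 by (simp only: abs_mult) simp
    qed
    ultimately show "\<bar>(real k + 1) * (y ^ i / fact i) - y ^ i / fact i * real i\<bar> \<le> y ^ i / fact i * (real i * (real i - 1)) * (1 / real k)"
      by (simp only: mult.assoc)
  qed
  moreover have "(\<Sum>i\<le>k. (real k + 1) * (y ^ i / fact i) - y ^ i / fact i * real i) =
     (\<Sum>i\<le>k. y ^ i / fact i * (real (k - i) + 1))"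
    by (intro sum.cong refl) (simp add: of_nat_diff algebra_simps add_divide_distrib)
  moreover have "y\<^sup>2 * exp y * (1 / real k) \<le> 16 * (real k)\<^sup>2"
  proof -
    have "y\<^sup>2 * exp y * (1 / real k) \<le> 16 * real k * exp y * (1 / real k)"
      using y2 by (intro mult_right_mono) auto
    thus ?thesis using k by (simp add: ey)
  qed
  moreover have "(real k + 1) * exp y - y * exp y = (real k)\<^sup>2 * (real k - y) + (real k)\<^sup>2"
    by (simp add: ey algebra_simps)
  ultimately show "\<bar>(\<Sum>i\<le>k. (2 * ln (real k)) ^ i / fact i * (real (k - i) + 1)) - (real k)\<^sup>2 * (real k - 2 * ln (real k))\<bar>
           \<le> 17 * (real k)\<^sup>2" unfolding y_def[symmetric] using zero_le_power2[of "real k"] by linarith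
  let ?g = "\<lambda>i. y ^ i / fact i * ((real k - real i) * (real k - real i + 1))"
  have "(\<lambda>i. real k * (real k + 1) * (y ^ i / fact i) - 2 * real k * (y ^ i / fact i * real i) + y ^ i / fact i * (real i * (real i - 1)))
    sums (real k * (real k + 1) * exp y - 2 * real k * (y * exp y) + y\<^sup>2 * exp y)"
    by (intro sums_add sums_diff sums_mult mom)
  also have "(\<lambda>i. real k * (real k + 1) * (y ^ i / fact i) - 2 * real k * (y ^ i / fact i * real i) + y ^ i / fact i * (real i * (real i - 1))) = ?g"
  proof
    fix i
    have "c * c1 * e - 2 * c * (e * x) + e * (x * (x - 1)) = e * ((c - x) * (c - x + 1))" if "c1 = c + 1" for c c1 e x :: real
      using that by (simp add: algebra_simps)
    from this[of "real k + 1" "real k" "y ^ i / fact i" "real i"]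
    show "real k * (real k + 1) * (y ^ i / fact i) - 2 * real k * (y ^ i / fact i * real i) + y ^ i / fact i * (real i * (real i - 1)) = ?g i"
      by blast
  qed
  finally have b: "?g sums (real k * (real k + 1) * exp y - 2 * real k * (y * exp y) + y\<^sup>2 * exp y)" .
  have f1: "\<bar>(\<Sum>i\<le>k. ?g i) - (real k * (real k + 1) * exp y - 2 * real k * (y * exp y) + y\<^sup>2 * exp y)\<bar> \<le> y\<^sup>2 * exp y"
  proof (rule partial_sum_error[OF b mom(3) nn])
    fix i assume i: "i > k"
    \<comment> \<open>Past k the first factor is negative and the second is negative or zero, so the
      product is nonnegative; it is bounded by i (i - 1).\<close>
    have "(real k - real i) * (real k - real i + 1) = (real i - real k) * (real i - 1 - real k)" by (simp add: algebra_simps)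
    moreover have "0 \<le> (real i - real k) * (real i - 1 - real k)" using i by (intro mult_nonneg_nonneg) auto
    moreover have "(real i - real k) * (real i - 1 - real k) \<le> real i * (real i - 1)"
      using i by (intro mult_mono) auto
    ultimately have "\<bar>(real k - real i) * (real k - real i + 1)\<bar> \<le> real i * (real i - 1)" by linarith
    hence "y ^ i / fact i * \<bar>(real k - real i) * (real k - real i + 1)\<bar> \<le> y ^ i / fact i * (real i * (real i - 1))"
      using y0 by (intro mult_left_mono) auto
    moreover have "\<bar>?g i\<bar> = y ^ i / fact i * \<bar>(real k - real i) * (real k - real i + 1)\<bar>"
      using y0 unfolding abs_mult[of "y ^ i / fact i"] by simp
    ultimately show "\<bar>?g i\<bar> \<le> y ^ i / fact i * (real i * (real i - 1))" by (simp only:)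
  qed
  have f2: "(\<Sum>i\<le>k. ?g i) = (\<Sum>i\<le>k. y ^ i / fact i * (real (k - i) * (real (k - i) + 1)))"
    by (intro sum.cong refl) (simp add: of_nat_diff)
  have f3: "y\<^sup>2 * exp y \<le> 16 * real k ^ 3"
  proof -
    have "y\<^sup>2 * exp y \<le> 16 * real k * exp y" using y2 by (intro mult_right_mono) auto
    thus ?thesis by (simp add: ey power2_eq_square power3_eq_cube)
  qed
  have f4: "real k * (real k + 1) * exp y - 2 * real k * (y * exp y) =
     (real k)\<^sup>2 * ((real k)\<^sup>2 - 2 * real k * y) + real k ^ 3"
    by (simp add: ey power2_eq_square power3_eq_cube algebra_simps)
  have y4: "4 * real k * ln (real k) = 2 * real k * y" by (simp add: y_def)
  \<comment> \<open>33 = 16 + 16 + 1: the moment Q occurs in the value of the full sum and in the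
    tail bound, and P differs from R by c = k^3.\<close>
  have "\<bar>s' - R\<bar> \<le> 33 * c" if "\<bar>s - (P + Q)\<bar> \<le> Q" "s = s'" "Q \<le> 16 * c" "P = R + c" "0 \<le> c"
    for s s' P Q R c :: real using that by linarith
  from this[OF f1 f2 f3 f4] show "\<bar>(\<Sum>i\<le>k. (2 * ln (real k)) ^ i / fact i * (real (k - i) * (real (k - i) + 1))) -
           (real k)\<^sup>2 * ((real k)\<^sup>2 - 4 * real k * ln (real k))\<bar> \<le> 33 * (real k) ^ 3"
    unfolding y_def[symmetric] y4 by simp
qed

section \<open>The confluent cases\<close>

text \<open>Summation is multiplication by the geometric series of ratio 1, which may be attached to
  f instead of to the exponential. This is the confluent case, where the ratio 2/z or 2/(z + 1) is
  1.\<close>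

lemma sum_exp_conv: "(\<Sum>n\<le>k. exp_conv f y n) = (\<Sum>i\<le>k. y ^ i / fact i * (\<Sum>j\<le>k - i. f j))"
proof -
  let ?E = "fps_exp y" and ?F = "Abs_fps f" and ?G = "fps_geometric (1 :: real)"
  have s: "(\<Sum>n\<le>m. a $ n) = (a * ?G) $ m" for a :: "real fps" and m
    by (simp add: fps_mult_nth atMost_atLeast0)
  have "(\<Sum>n\<le>k. exp_conv f y n) = (\<Sum>n\<le>k. (?E * ?F) $ n)" by (simp only: exp_conv_fps)
  also have "\<dots> = (?E * (?F * ?G)) $ k" unfolding s by (simp only: mult.assoc)
  also have "\<dots> = (\<Sum>i\<le>k. y ^ i / fact i * (?F * ?G) $ (k - i))"
    by (subst fps_mult_nth) (simp add: atMost_atLeast0)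
  also have "\<dots> = (\<Sum>i\<le>k. y ^ i / fact i * (\<Sum>j\<le>k - i. f j))"
    unfolding s[symmetric] by simp
  finally show ?thesis .
qed

text \<open>\<open>pole_coeff0\<close> converges geometrically to \<open>d_fun 2\<close>, the value
  of the regularised product at w = 2, and \<open>pole_coeff1 n\<close> is - ln 2 times n times this
  value up to a bounded error. Summation gives linear and quadratic growth.\<close>

lemma pole_coeff_partial_sums:
  obtains C :: real where "C > 0"
    "\<And>m. \<bar>(\<Sum>j\<le>m. pole_coeff0 j) - d_fun 2 * (real m + 1)\<bar> \<le> C"
    "\<And>m. \<bar>(\<Sum>j\<le>m. pole_coeff1 j) + ln 2 * d_fun 2 / 2 * (real m * (real m + 1))\<bar> \<le> C * (real m + 1)"
proof -
  obtain B :: real where B: "B > 0"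
    "\<And>n. \<bar>reg_coeff0 n\<bar> \<le> B * (2 / 5) ^ n" "\<And>n. \<bar>reg_coeff1 n\<bar> \<le> B * (2 / 5) ^ n"
    using reg_coeff_expansion by metis
  have sc: "\<bar>f n * 2 ^ n\<bar> \<le> B * (4 / 5) ^ n" if "\<And>n. \<bar>f n\<bar> \<le> B * (2 / 5) ^ n" for f :: "nat \<Rightarrow> real" and n
  proof -
    have "\<bar>f n\<bar> * 2 ^ n \<le> B * (2 / 5) ^ n * 2 ^ n" using that by (intro mult_right_mono) auto
    also have "\<dots> = B * (4 / 5) ^ n" by (simp add: mult.assoc power_mult_distrib[symmetric])
    finally show ?thesis by (simp add: abs_mult)
  qed
  have d0: "\<bar>pole_coeff0 n - d_fun 2\<bar> \<le> 5 * B * (4 / 5) ^ n" for n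
  proof -
    have g: "(\<lambda>n. reg_coeff0 n * 2 ^ n) sums d_fun 2" by (rule reg_coeff_sums) auto
    have G: "(\<lambda>i. reg_coeff0 (i + Suc n) * 2 ^ (i + Suc n)) sums (d_fun 2 - pole_coeff0 n)"
      using sums_split_initial_segment[OF g, of "Suc n"] by (simp only: pole_coeff0_def lessThan_Suc_atMost)
    have "B * (4 / 5) ^ (i + Suc n) = B * (4 / 5) ^ Suc n * (4 / 5) ^ i" for i
      by (simp only: power_add mult_ac)
    hence "(\<lambda>i. B * (4 / 5) ^ (i + Suc n)) sums (B * (4 / 5) ^ Suc n * (1 / (1 - 4 / 5)))"
      by (simp only:) (intro sums_mult geometric_sums, simp)
    hence M: "(\<lambda>i. B * (4 / 5) ^ (i + Suc n)) sums (4 * B * (4 / 5) ^ n)" by (simp add: mult.assoc)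
    have le: "\<bar>reg_coeff0 (i + Suc n) * 2 ^ (i + Suc n)\<bar> \<le> B * (4 / 5) ^ (i + Suc n)" for i
      by (rule sc[OF B(2)])
    have "d_fun 2 - pole_coeff0 n \<le> 4 * B * (4 / 5) ^ n"
      by (rule sums_le[OF _ G M]) (use le abs_le_iff in blast)
    moreover have "- (d_fun 2 - pole_coeff0 n) \<le> 4 * B * (4 / 5) ^ n"
      by (rule sums_le[OF _ sums_minus[OF G] M]) (use le abs_le_iff in blast)
    moreover have "4 * B * (4 / 5) ^ n \<le> 5 * B * (4 / 5) ^ n" using B(1) by (intro mult_right_mono) auto
    ultimately show ?thesis by linarith
  qed
  have n4: "real n * (4 / 5) ^ n \<le> 4" for n
  proof -
    have "real n \<le> 4 * (5 / 4) ^ n" using Bernoulli_inequality[of "1 / 4 :: real" n] by simp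
    hence "real n * (4 / 5) ^ n \<le> 4 * (5 / 4) ^ n * (4 / 5) ^ n" by (intro mult_right_mono) auto
    also have "\<dots> = 4" by (simp add: mult.assoc power_mult_distrib[symmetric])
    finally show ?thesis .
  qed
  have L: "0 < ln (2 :: real)" "ln 2 \<le> (1 :: real)" using ln_2_less_1 by auto
  have d1: "\<bar>pole_coeff1 n + ln 2 * d_fun 2 * real n\<bar> \<le> 50 * B" for n
  proof -
    define S1 where "S1 = (\<Sum>i\<le>n. reg_coeff1 i * 2 ^ i)"
    define S2 where "S2 = (\<Sum>i\<le>n. real i * (reg_coeff0 i * 2 ^ i))"
    \<comment> \<open>The factor n - i is split so that n meets
      \<open>pole_coeff0 n - d_fun 2\<close>, whose geometric decay absorbs it.\<close>
    have "pole_coeff1 n = S1 - ln 2 * (real n * pole_coeff0 n) + ln 2 * S2"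
      unfolding pole_coeff1_def S1_def S2_def pole_coeff0_def sum_distrib_left sum_subtractf[symmetric] sum.distrib[symmetric]
      by (intro sum.cong refl) (simp add: of_nat_diff algebra_simps)
    hence eq: "pole_coeff1 n + ln 2 * d_fun 2 * real n = S1 - ln 2 * (real n * (pole_coeff0 n - d_fun 2)) + ln 2 * S2"
      by (simp add: algebra_simps)
    have b1: "\<bar>S1\<bar> \<le> 5 * B"
    proof -
      have "\<bar>S1\<bar> \<le> (\<Sum>i\<le>n. B * (4 / 5) ^ i)"
        unfolding S1_def by (rule order_trans[OF sum_abs], rule sum_mono, rule sc[OF B(3)])
      also have "\<dots> \<le> B * 5" unfolding sum_distrib_left[symmetric]
        using B(1) by (intro mult_left_mono sum_geometric_le_5) auto
      finally show ?thesis by simp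
    qed
    have b2: "\<bar>S2\<bar> \<le> 25 * B"
    proof -
      have "\<bar>S2\<bar> \<le> (\<Sum>i\<le>n. B * (real (Suc i) * (4 / 5) ^ i))"
        unfolding S2_def
      proof (rule order_trans[OF sum_abs], rule sum_mono)
        fix i
        have "real i * \<bar>reg_coeff0 i * 2 ^ i\<bar> \<le> real (Suc i) * (B * (4 / 5) ^ i)"
          by (intro mult_mono sc[OF B(2)]) auto
        thus "\<bar>real i * (reg_coeff0 i * 2 ^ i)\<bar> \<le> B * (real (Suc i) * (4 / 5) ^ i)"
          by (simp add: abs_mult mult_ac del: of_nat_Suc)
      qed
      also have "\<dots> \<le> B * 25" unfolding sum_distrib_left[symmetric]
      proof (rule mult_left_mono)
        have "(\<lambda>i. real (Suc i) * (4 / 5) ^ i) sums (25 :: real)"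
          using geometric_deriv_sums[of "4 / 5 :: real"] by (simp add: power2_eq_square)
        thus "(\<Sum>i\<le>n. real (Suc i) * (4 / 5) ^ i) \<le> (25 :: real)"
          using sum_le_suminf[of "\<lambda>i. real (Suc i) * (4 / 5) ^ i" "{..n}"] by (simp add: sums_iff)
      qed (use B in auto)
      finally show ?thesis by simp
    qed
    have b3: "\<bar>real n * (pole_coeff0 n - d_fun 2)\<bar> \<le> 20 * B"
    proof -
      have "\<bar>real n * (pole_coeff0 n - d_fun 2)\<bar> \<le> real n * (5 * B * (4 / 5) ^ n)"
        unfolding abs_mult by (simp only: abs_of_nat) (intro mult_left_mono d0, simp)
      also have "\<dots> = 5 * B * (real n * (4 / 5) ^ n)" by simp
      also have "\<dots> \<le> 5 * B * 4" using B(1) by (intro mult_left_mono n4) auto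
      finally show ?thesis by simp
    qed
    have "\<bar>ln 2 * x\<bar> \<le> K" if "\<bar>x\<bar> \<le> K" for x K :: real
    proof -
      have "ln 2 * \<bar>x\<bar> \<le> 1 * K" using L that by (intro mult_mono) auto
      thus ?thesis using L by (simp add: abs_mult)
    qed
    from this[OF b3] this[OF b2] b1 show ?thesis unfolding eq by linarith
  qed
  have "\<bar>(\<Sum>j\<le>m. pole_coeff0 j) - d_fun 2 * (real m + 1)\<bar> \<le> 50 * B" for m
  proof -
    have "(\<Sum>j\<le>m. pole_coeff0 j) - d_fun 2 * (real m + 1) = (\<Sum>j\<le>m. pole_coeff0 j - d_fun 2)"
      by (simp add: sum_subtractf algebra_simps)
    also have "\<bar>\<dots>\<bar> \<le> (\<Sum>j\<le>m. 5 * B * (4 / 5) ^ j)"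
      by (rule order_trans[OF sum_abs], rule sum_mono, rule d0)
    also have "\<dots> \<le> 5 * B * 5" unfolding sum_distrib_left[symmetric]
      using B(1) by (intro mult_left_mono sum_geometric_le_5) auto
    finally show ?thesis using B(1) by simp
  qed
  moreover have "\<bar>(\<Sum>j\<le>m. pole_coeff1 j) + ln 2 * d_fun 2 / 2 * (real m * (real m + 1))\<bar> \<le> 50 * B * (real m + 1)" for m
  proof -
    have gs: "(\<Sum>j\<le>m. real j) = real m * (real m + 1) / 2"
      by (induction m) (auto simp: field_simps)
    have "(\<Sum>j\<le>m. pole_coeff1 j) + ln 2 * d_fun 2 / 2 * (real m * (real m + 1)) =
      (\<Sum>j\<le>m. pole_coeff1 j) + ln 2 * d_fun 2 * (\<Sum>j\<le>m. real j)" unfolding gs by simp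
    also have "\<dots> = (\<Sum>j\<le>m. pole_coeff1 j + ln 2 * d_fun 2 * real j)"
      by (simp only: sum.distrib sum_distrib_left)
    also have "\<bar>\<dots>\<bar> \<le> (\<Sum>j\<le>m. 50 * B)"
      by (rule order_trans[OF sum_abs], rule sum_mono, rule d1)
    also have "\<dots> = 50 * B * (real m + 1)" by (simp add: algebra_simps)
    finally show ?thesis .
  qed
  ultimately show ?thesis using that[of "50 * B"] B(1) by simp
qed

lemma d_fun_pos: "0 < x \<Longrightarrow> x < 5 / 2 \<Longrightarrow> d_fun x > 0"
  by (simp add: d_fun_product)

text \<open>The asymptotics of the partial sums are inserted into the Poisson sums; their errors are
  multiplied by the total weight, which is at most k^2.\<close>

lemma sum_exp_conv_pole_coeff:
  obtains C :: real where "C > 0"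
    "\<And>k. k \<ge> 1 \<Longrightarrow> \<bar>(\<Sum>n\<le>k. exp_conv pole_coeff0 (2 * ln (real k)) n) -
        d_fun 2 * ((real k)\<^sup>2 * (real k - 2 * ln (real k)))\<bar> \<le> C * (real k)\<^sup>2"
    "\<And>k. k \<ge> 1 \<Longrightarrow> \<bar>(\<Sum>n\<le>k. exp_conv pole_coeff1 (2 * ln (real k)) n) +
        ln 2 * d_fun 2 / 2 * ((real k)\<^sup>2 * ((real k)\<^sup>2 - 4 * real k * ln (real k)))\<bar> \<le> C * (real k) ^ 3"
proof -
  obtain C :: real where C: "C > 0"
    "\<And>m. \<bar>(\<Sum>j\<le>m. pole_coeff0 j) - d_fun 2 * (real m + 1)\<bar> \<le> C"
    "\<And>m. \<bar>(\<Sum>j\<le>m. pole_coeff1 j) + ln 2 * d_fun 2 / 2 * (real m * (real m + 1))\<bar> \<le> C * (real m + 1)"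
    using pole_coeff_partial_sums by blast
  define d where "d = d_fun 2"
  define e where "e = ln 2 * d_fun 2 / 2"
  have d: "d > 0" using d_fun_pos[of 2] by (simp add: d_def)
  hence e: "e > 0" by (simp add: e_def d_def)
  have 1: "\<bar>(\<Sum>n\<le>k. exp_conv pole_coeff0 (2 * ln (real k)) n) - d * ((real k)\<^sup>2 * (real k - 2 * ln (real k)))\<bar> \<le> (C + 17 * d) * (real k)\<^sup>2"
    if k: "k \<ge> 1" for k
  proof -
    define y where "y = 2 * ln (real k)"
    define P where "P = (\<Sum>i\<le>k. y ^ i / fact i * (real (k - i) + 1))"
    have y0: "y \<ge> 0" using k by (simp add: y_def)
    have "\<bar>\<Sum>i\<le>k. y ^ i / fact i * ((\<Sum>j\<le>k - i. pole_coeff0 j) - d * (real (k - i) + 1))\<bar> \<le> exp y * C"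
      by (rule exp_convolution_bound[OF y0], unfold d_def, rule C(2))
    also have "(\<Sum>i\<le>k. y ^ i / fact i * ((\<Sum>j\<le>k - i. pole_coeff0 j) - d * (real (k - i) + 1))) =
      (\<Sum>n\<le>k. exp_conv pole_coeff0 y n) - d * P"
      unfolding sum_exp_conv P_def sum_distrib_left[of d] sum_subtractf[symmetric]
      by (intro sum.cong refl) (simp only: right_diff_distrib mult.left_commute)
    finally have A: "\<bar>(\<Sum>n\<le>k. exp_conv pole_coeff0 y n) - d * P\<bar> \<le> C * (real k)\<^sup>2"
      using exp_2_ln[OF k] by (simp add: y_def mult.commute)
    have "\<bar>P - (real k)\<^sup>2 * (real k - y)\<bar> \<le> 17 * (real k)\<^sup>2"
      using poisson_sums(1)[OF k] unfolding y_def P_def .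
    hence "d * \<bar>P - (real k)\<^sup>2 * (real k - y)\<bar> \<le> d * (17 * (real k)\<^sup>2)" using d by (intro mult_left_mono) auto
    moreover have "\<bar>d * P - d * ((real k)\<^sup>2 * (real k - y))\<bar> = d * \<bar>P - (real k)\<^sup>2 * (real k - y)\<bar>"
      using d by (simp only: right_diff_distrib[symmetric] abs_mult abs_of_pos)
    ultimately have "\<bar>d * P - d * ((real k)\<^sup>2 * (real k - y))\<bar> \<le> 17 * d * (real k)\<^sup>2" by simp
    thus ?thesis using A unfolding y_def distrib_right by linarith
  qed
  have 2: "\<bar>(\<Sum>n\<le>k. exp_conv pole_coeff1 (2 * ln (real k)) n) + e * ((real k)\<^sup>2 * ((real k)\<^sup>2 - 4 * real k * ln (real k)))\<bar>
     \<le> (2 * C + 33 * e) * real k ^ 3"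
    if k: "k \<ge> 1" for k
  proof -
    define y where "y = 2 * ln (real k)"
    define P where "P = (\<Sum>i\<le>k. y ^ i / fact i * (real (k - i) * (real (k - i) + 1)))"
    define R where "R = (real k)\<^sup>2 * ((real k)\<^sup>2 - 4 * real k * ln (real k))"
    have y0: "y \<ge> 0" using k by (simp add: y_def)
    have "\<bar>\<Sum>i\<le>k. y ^ i / fact i * ((\<Sum>j\<le>k - i. pole_coeff1 j) + e * (real (k - i) * (real (k - i) + 1)))\<bar> \<le> exp y * (C * (real k + 1))"
    proof (rule exp_convolution_bound[OF y0])
      fix i
      have "C * (real (k - i) + 1) \<le> C * (real k + 1)" using C(1) by (intro mult_left_mono) auto
      with C(3)[of "k - i"]
      show "\<bar>(\<Sum>j\<le>k - i. pole_coeff1 j) + e * (real (k - i) * (real (k - i) + 1))\<bar> \<le> C * (real k + 1)"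
        unfolding e_def by linarith
    qed
    also have "(\<Sum>i\<le>k. y ^ i / fact i * ((\<Sum>j\<le>k - i. pole_coeff1 j) + e * (real (k - i) * (real (k - i) + 1)))) =
      (\<Sum>n\<le>k. exp_conv pole_coeff1 y n) + e * P"
      unfolding sum_exp_conv P_def sum_distrib_left[of e] sum.distrib[symmetric]
      by (intro sum.cong refl) (simp only: distrib_left mult.left_commute)
    finally have "\<bar>(\<Sum>n\<le>k. exp_conv pole_coeff1 y n) + e * P\<bar> \<le> (real k)\<^sup>2 * (C * (real k + 1))"
      using exp_2_ln[OF k] by (simp add: y_def)
    also have "\<dots> \<le> (real k)\<^sup>2 * (C * (2 * real k))" using C(1) k by (intro mult_left_mono) auto
    also have "\<dots> = 2 * C * real k ^ 3" by (simp add: power2_eq_square power3_eq_cube)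
    finally have A: "\<bar>(\<Sum>n\<le>k. exp_conv pole_coeff1 y n) + e * P\<bar> \<le> 2 * C * real k ^ 3" .
    have "\<bar>P - R\<bar> \<le> 33 * real k ^ 3"
      using poisson_sums(2)[OF k] unfolding y_def P_def R_def .
    hence "e * \<bar>P - R\<bar> \<le> e * (33 * real k ^ 3)" using e by (intro mult_left_mono) auto
    moreover have "\<bar>e * P - e * R\<bar> = e * \<bar>P - R\<bar>"
      using e by (simp only: right_diff_distrib[symmetric] abs_mult abs_of_pos)
    ultimately have "\<bar>e * P - e * R\<bar> \<le> 33 * e * real k ^ 3" by simp
    thus ?thesis using A unfolding y_def R_def[symmetric] distrib_right by linarith
  qed
  show ?thesis
  proof (rule that[of "2 * C + 17 * d + 33 * e"])
    show "2 * C + 17 * d + 33 * e > 0" using C(1) d e by linarith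
    fix k :: nat assume k: "k \<ge> 1"
    have "(C + 17 * d) * (real k)\<^sup>2 \<le> (2 * C + 17 * d + 33 * e) * (real k)\<^sup>2"
      using C(1) e by (intro mult_right_mono) auto
    with 1[OF k] show "\<bar>(\<Sum>n\<le>k. exp_conv pole_coeff0 (2 * ln (real k)) n) -
        d_fun 2 * ((real k)\<^sup>2 * (real k - 2 * ln (real k)))\<bar> \<le> (2 * C + 17 * d + 33 * e) * (real k)\<^sup>2"
      unfolding d_def by (rule order_trans)
    have "(2 * C + 33 * e) * real k ^ 3 \<le> (2 * C + 17 * d + 33 * e) * real k ^ 3"
      using d by (intro mult_right_mono) auto
    with 2[OF k] show "\<bar>(\<Sum>n\<le>k. exp_conv pole_coeff1 (2 * ln (real k)) n) +
        ln 2 * d_fun 2 / 2 * ((real k)\<^sup>2 * ((real k)\<^sup>2 - 4 * real k * ln (real k)))\<bar> \<le> (2 * C + 17 * d + 33 * e) * (real k) ^ 3"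
      unfolding e_def by (rule order_trans)
  qed
qed

lemma Gamma_real_2: "Gamma (2 :: real) = 1"
  using Gamma_fact[of 1, where ?'a = real] by simp

text \<open>For z = 2 the ratio 2/z is 1, so the first term is a confluent sum, while the second one
  is O(1). The resulting error is bounded, sharper than the sqrt (ln k) asked for.\<close>

lemma erdos_gamma_at_2:
  obtains C :: real where "C > 0"
    "\<And>k. k \<ge> 1 \<Longrightarrow> \<bar>erdos_gamma k 2 - d_fun 2 / 2 * (real k - 2 * ln (real k))\<bar> \<le> C"
proof -
  obtain A :: real where A: "A > 0"
    "\<And>k z. k \<ge> 1 \<Longrightarrow> 0 < z \<Longrightarrow> z \<le> 2 \<Longrightarrow>
      \<bar>Gamma z * (2 / z) ^ k * erdos_gamma k z -
        (first_term k z + second_term k z)\<bar>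
      \<le> A * real k powr (2 - z) / z"
    using erdos_gamma_decomposition by blast
  obtain B :: real where B: "B > 0"
    "\<And>k z. k \<ge> 1 \<Longrightarrow> 1 < z \<Longrightarrow> z \<le> 2 \<Longrightarrow> \<bar>second_term k z\<bar> \<le> B / (z - 1) * real k powr (2 - z)"
    using second_term_bounds by metis
  obtain C :: real where C: "C > 0"
    "\<And>k. k \<ge> 1 \<Longrightarrow> \<bar>(\<Sum>n\<le>k. exp_conv pole_coeff0 (2 * ln (real k)) n) -
        d_fun 2 * ((real k)\<^sup>2 * (real k - 2 * ln (real k)))\<bar> \<le> C * (real k)\<^sup>2"
    using sum_exp_conv_pole_coeff by metis
  have main: "\<bar>erdos_gamma k 2 - d_fun 2 / 2 * (real k - 2 * ln (real k))\<bar> \<le> A + B + C" if k: "k \<ge> 1" for k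
  proof -
    define S where "S = (\<Sum>n\<le>k. exp_conv pole_coeff0 (2 * ln (real k)) n)"
    have k2: "real k powr (- 2) = 1 / (real k)\<^sup>2" using k by (simp add: powr_minus_divide)
    have 1: "\<bar>erdos_gamma k 2 - (1 / (real k)\<^sup>2 / 2 * S + second_term k 2)\<bar> \<le> A / 2"
      using A(2)[OF k, of 2] k unfolding first_term_def S_def k2 by (simp add: Gamma_real_2)
    have 2: "\<bar>second_term k 2\<bar> \<le> B" using B(2)[OF k, of 2] k by simp
    have "\<bar>1 / (real k)\<^sup>2 / 2 * S - d_fun 2 / 2 * (real k - 2 * ln (real k))\<bar> =
       1 / (real k)\<^sup>2 / 2 * \<bar>S - d_fun 2 * ((real k)\<^sup>2 * (real k - 2 * ln (real k)))\<bar>"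
    proof -
      have "1 / (real k)\<^sup>2 / 2 * S - d_fun 2 / 2 * (real k - 2 * ln (real k)) =
         1 / (real k)\<^sup>2 / 2 * (S - d_fun 2 * ((real k)\<^sup>2 * (real k - 2 * ln (real k))))"
        using k unfolding right_diff_distrib[of "1 / (real k)\<^sup>2 / 2"] by simp
      thus ?thesis by (simp only: abs_mult) simp
    qed
    also have "\<dots> \<le> 1 / (real k)\<^sup>2 / 2 * (C * (real k)\<^sup>2)"
      using C(2)[OF k] unfolding S_def by (intro mult_left_mono) auto
    also have "\<dots> = C / 2" using k by simp
    finally have 3: "\<bar>1 / (real k)\<^sup>2 / 2 * S - d_fun 2 / 2 * (real k - 2 * ln (real k))\<bar> \<le> C / 2" .
    have "\<bar>e - d\<bar> \<le> A + B + C" if "\<bar>e - (a + s)\<bar> \<le> A / 2" "\<bar>s\<bar> \<le> B" "\<bar>a - d\<bar> \<le> C / 2" for a e d s :: real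
      using that A(1) C(1) by linarith
    from this[OF 1 2 3] show ?thesis .
  qed
  show ?thesis by (rule that[OF _ main]) (use A(1) B(1) C(1) in auto)
qed

lemma G_fun_1: "G_fun 1 = 1"
  by (simp add: G_fun_eq_d_fun d_fun_1 Gamma_real_2)

text \<open>For z = 1 the completed first term gives G(1) = 1, and the ratio 2 / (z + 1) of the
  second term is 1, so that term is the confluent one. The error O(k) saves the factor sqrt (ln
  k).\<close>

lemma erdos_gamma_at_1:
  obtains C :: real where "C > 0"
    "\<And>k. k \<ge> 1 \<Longrightarrow> \<bar>2 ^ k * (1 - erdos_gamma k 1) -
        d_fun 2 / 4 * ln 2 * ((real k)\<^sup>2 - 4 * real k * ln (real k))\<bar> \<le> C * real k"
proof -
  obtain A :: real where A: "A > 0"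
    "\<And>k z. k \<ge> 1 \<Longrightarrow> 0 < z \<Longrightarrow> z < 2 \<Longrightarrow>
      \<bar>erdos_gamma k z - G_fun z - (z / 2) ^ k / Gamma z * second_term k z\<bar>
       \<le> A / (2 - z)\<^sup>2 * ((z / 2) ^ k * real k powr (2 - z))"
    using erdos_gamma_first_term by blast
  obtain C :: real where C: "C > 0"
    "\<And>k. k \<ge> 1 \<Longrightarrow> \<bar>(\<Sum>n\<le>k. exp_conv pole_coeff1 (2 * ln (real k)) n) +
        ln 2 * d_fun 2 / 2 * ((real k)\<^sup>2 * ((real k)\<^sup>2 - 4 * real k * ln (real k)))\<bar> \<le> C * (real k) ^ 3"
    using sum_exp_conv_pole_coeff by metis
  have main: "\<bar>2 ^ k * (1 - erdos_gamma k 1) - d_fun 2 / 4 * ln 2 * ((real k)\<^sup>2 - 4 * real k * ln (real k))\<bar> \<le> (A + C) * real k"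
    if k: "k \<ge> 1" for k
  proof -
    define S where "S = (\<Sum>n\<le>k. exp_conv pole_coeff1 (2 * ln (real k)) n)"
    define R where "R = (real k)\<^sup>2 - 4 * real k * ln (real k)"
    define T where "T = second_term k 1"
    have "\<bar>erdos_gamma k 1 - 1 - (1 / 2) ^ k * T\<bar> \<le> A * ((1 / 2) ^ k * real k)"
      using A(2)[OF k, of 1] k by (simp add: G_fun_1 T_def)
    hence "2 ^ k * \<bar>erdos_gamma k 1 - 1 - (1 / 2) ^ k * T\<bar> \<le> 2 ^ k * (A * ((1 / 2) ^ k * real k))"
      by (intro mult_left_mono) auto
    moreover have "(2 :: real) ^ k * (1 / 2) ^ k = 1" by (simp flip: power_mult_distrib)
    hence PQ: "(2 :: real) ^ k * ((1 / 2) ^ k * x) = x" for x by (simp only: mult.assoc[symmetric] mult_1_left)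
    have "2 ^ k * (A * ((1 / 2) ^ k * real k)) = A * real k"
      by (subst mult.left_commute) (simp only: PQ)
    moreover have "2 ^ k * (erdos_gamma k 1 - 1 - (1 / 2) ^ k * T) = - (2 ^ k * (1 - erdos_gamma k 1) + T)"
      by (simp only: right_diff_distrib PQ)
    moreover have "2 ^ k * \<bar>erdos_gamma k 1 - 1 - (1 / 2) ^ k * T\<bar> = \<bar>2 ^ k * (erdos_gamma k 1 - 1 - (1 / 2) ^ k * T)\<bar>"
      by (simp add: abs_mult)
    ultimately have 1: "\<bar>2 ^ k * (1 - erdos_gamma k 1) + T\<bar> \<le> A * real k" by simp
    have "real k powr (- 2) = 1 / (real k)\<^sup>2" using k by (simp add: powr_minus_divide)
    hence T: "T = 1 / (real k)\<^sup>2 / 2 * S" by (simp add: T_def second_term_def S_def)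
    have "T + d_fun 2 / 4 * ln 2 * R = 1 / (real k)\<^sup>2 / 2 * (S + ln 2 * d_fun 2 / 2 * ((real k)\<^sup>2 * R))"
      using k unfolding T distrib_left[of "1 / (real k)\<^sup>2 / 2"] by simp
    hence "\<bar>T + d_fun 2 / 4 * ln 2 * R\<bar> = 1 / (real k)\<^sup>2 / 2 * \<bar>S + ln 2 * d_fun 2 / 2 * ((real k)\<^sup>2 * R)\<bar>"
      by (simp only: abs_mult) simp
    also have "\<dots> \<le> 1 / (real k)\<^sup>2 / 2 * (C * real k ^ 3)"
      using C(2)[OF k] unfolding S_def R_def by (intro mult_left_mono) auto
    also have "\<dots> = C * real k / 2" using k by (simp add: power2_eq_square power3_eq_cube)
    finally have 2: "\<bar>T + d_fun 2 / 4 * ln 2 * R\<bar> \<le> C * real k / 2" .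
    have "0 \<le> C * real k" using C(1) by simp
    with 1 2 show ?thesis unfolding R_def[symmetric] distrib_right by linarith
  qed
  show ?thesis by (rule that[OF _ main]) (use A(1) C(1) in auto)
qed

section \<open>Comparison of error terms\<close>

lemma ln_le_half: "k \<ge> 1 \<Longrightarrow> ln (real k) \<le> real k / 2"
  using ln_le_minus_one[of "real k / 2"] ln_2_less_1 by (simp add: ln_div)

text \<open>Put y = 2 - \<epsilon> - z. Passing from 1 - \<epsilon>/2 to z/2 gains at least exp (- y
  k / 2), whereas the power of k grows by k^y only, and ln k \<le> k/2. Thus the error is largest at
  z = 2 - \<epsilon>.\<close>

lemma error_term_mono:
  fixes z \<epsilon> :: real
  assumes k: "k \<ge> 1" and z: "0 < z" "z \<le> 2 - \<epsilon>" and eps: "0 < \<epsilon>" "\<epsilon> < 1"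
  shows "(z / 2) ^ k * real k powr (2 - z) \<le> (1 - \<epsilon> / 2) ^ k * real k powr \<epsilon>"
proof -
  define \<kappa> where "\<kappa> = 1 - \<epsilon> / 2"
  define y where "y = 2 - \<epsilon> - z"
  have y: "y \<ge> 0" using z by (simp add: y_def)
  have kap: "0 < \<kappa>" "\<kappa> \<le> 1" using eps by (auto simp: \<kappa>_def)
  have z2: "z / 2 = \<kappa> - y / 2" by (simp add: \<kappa>_def y_def field_simps)
  have "\<kappa> * (y / 2) \<le> 1 * (y / 2)" using kap y by (intro mult_right_mono) auto
  hence "z / 2 \<le> \<kappa> * (1 + - (y / 2))" unfolding z2 by (simp add: algebra_simps)
  also have "\<dots> \<le> \<kappa> * exp (- (y / 2))" using kap by (intro mult_left_mono exp_ge_add_one_self) auto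
  finally have "(z / 2) ^ k \<le> (\<kappa> * exp (- (y / 2))) ^ k" using z by (intro power_mono) auto
  also have "\<dots> = \<kappa> ^ k * exp (- (y * (real k / 2)))"
    by (simp add: power_mult_distrib exp_of_nat_mult[symmetric] mult_ac)
  finally have 1: "(z / 2) ^ k \<le> \<kappa> ^ k * exp (- (y * (real k / 2)))" .
  have "real k powr (2 - z) = real k powr (\<epsilon> + y)" by (simp add: y_def)
  also have "\<dots> = real k powr \<epsilon> * real k powr y" by (rule powr_add)
  also have "real k powr y = exp (y * ln (real k))" using k by (simp add: powr_def)
  finally have 2: "real k powr (2 - z) = real k powr \<epsilon> * exp (y * ln (real k))" .
  have "(z / 2) ^ k * real k powr (2 - z) \<le> (\<kappa> ^ k * exp (- (y * (real k / 2)))) * (real k powr \<epsilon> * exp (y * ln (real k)))"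
    unfolding 2 by (intro mult_right_mono 1) auto
  also have "\<dots> = \<kappa> ^ k * real k powr \<epsilon> * (exp (y * ln (real k)) * exp (- (y * (real k / 2))))"
    by (simp only: mult_ac)
  also have "exp (y * ln (real k)) * exp (- (y * (real k / 2))) = exp (y * ln (real k) - y * (real k / 2))"
    by (simp add: exp_add[symmetric])
  also have "\<kappa> ^ k * real k powr \<epsilon> * exp (y * ln (real k) - y * (real k / 2)) \<le> \<kappa> ^ k * real k powr \<epsilon> * 1"
    using mult_left_mono[OF ln_le_half[OF k] y] kap by (intro mult_left_mono) auto
  finally show ?thesis by (simp add: \<kappa>_def)
qed

lemma cube_times_geometric_bounded:
  fixes r :: real
  assumes "0 < r" "r < 1"
  obtains C where "\<And>k :: nat. real k ^ 3 * r ^ k \<le> C"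
proof -
  have "(\<lambda>k :: nat. real k ^ 3 * r ^ k) \<longlonglongrightarrow> 0" using assms by real_asymp
  hence "Bseq (\<lambda>k :: nat. real k ^ 3 * r ^ k)" by (rule convergent_imp_Bseq[OF convergentI])
  then obtain K where "\<And>k :: nat. norm (real k ^ 3 * r ^ k) \<le> K" by (auto simp: Bseq_def)
  hence "real k ^ 3 * r ^ k \<le> K" for k :: nat using abs_le_D1 by (metis real_norm_def)
  thus ?thesis using that by blast
qed

text \<open>The estimates at z = 1 and z = 2 hold without the square root, which is at least 1 from
  k = 3 on.\<close>

lemma bigo_sqrt_ln:
  assumes "C > 0" "\<And>k. k \<ge> 1 \<Longrightarrow> \<bar>E k\<bar> \<le> C * f k" "\<And>k. f k \<ge> (0 :: real)"
  shows "E \<in> O(\<lambda>k. f k * sqrt (ln (real k)))"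
proof (rule bigoI[where c = C])
  show "\<forall>\<^sub>F k in at_top. norm (E k) \<le> C * norm (f k * sqrt (ln (real k)))"
    using eventually_ge_at_top[of "3 :: nat"]
  proof eventually_elim
    case (elim k)
    have "ln (real k) \<ge> 1" using elim exp_le by (subst ln_ge_iff) auto
    hence "1 \<le> sqrt (ln (real k))" by simp
    hence "C * f k * 1 \<le> C * f k * sqrt (ln (real k))" using assms by (intro mult_left_mono) auto
    thus ?case using assms(2)[of k] assms(3)[of k] elim \<open>1 \<le> sqrt (ln (real k))\<close>
      by (simp add: abs_mult mult.assoc)
  qed
qed

section \<open>Uniform estimates in z\<close>

lemma inverse_Gamma_le:
  obtains c :: real where "c > 0" "\<And>z. 0 < z \<Longrightarrow> z \<le> 2 \<Longrightarrow> 1 / Gamma z \<le> c"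
proof -
  obtain c :: real where c: "c > 0" "\<And>z. 0 < z \<Longrightarrow> z \<le> 2 \<Longrightarrow> 1 / Gamma (1 + z) \<le> c"
    using inverse_Gamma_bound by blast
  have "1 / Gamma z \<le> 2 * c" if z: "0 < z" "z \<le> 2" for z
  proof -
    have "z \<notin> \<int>\<^sub>\<le>\<^sub>0" using z by (auto elim!: nonpos_Ints_cases)
    hence "Gamma (1 + z) = z * Gamma z" using Gamma_plus1[of z] by (simp add: add.commute)
    hence "1 / Gamma z = z * (1 / Gamma (1 + z))" using z by simp
    also have "\<dots> \<le> 2 * c" using z c(2)[OF z] Gamma_real_pos[of "1 + z"] by (intro mult_mono) auto
    finally show ?thesis .
  qed
  thus ?thesis using that[of "2 * c"] c(1) by simp
qed

lemma times_inverse_Gamma_le: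
  fixes c x y z :: real
  assumes "c > 0" "\<And>w::real. 0 < w \<Longrightarrow> w \<le> 2 \<Longrightarrow> 1 / Gamma w \<le> c" "0 < z" "z \<le> 2" "\<bar>x\<bar> \<le> y"
  shows "\<bar>(z / 2) ^ k / Gamma z * x\<bar> \<le> c * ((z / 2) ^ k * y)"
proof -
  have "\<bar>(z / 2) ^ k / Gamma z * x\<bar> = (1 / Gamma z) * ((z / 2) ^ k * \<bar>x\<bar>)"
    using assms Gamma_real_pos[of z] by (simp add: abs_mult)
  also have "\<dots> \<le> c * ((z / 2) ^ k * y)"
    using assms by (intro mult_mono mult_left_mono) auto
  finally show ?thesis .
qed

text \<open>The factor (z/2)^k turns (2/(z + 1))^k into (z/(z + 1))^k, while 2 - z \<ge> 1 and 1 - z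
  \<ge> \<epsilon> make the constants uniform.\<close>

lemma erdos_gamma_lt_1:
  fixes \<epsilon> :: real
  assumes eps: "\<epsilon> > 0"
  shows "\<exists>C. \<forall>k\<ge>1. \<forall>z\<in>{\<epsilon>..1 - \<epsilon>}.
    \<bar>erdos_gamma k z - (G_fun z + (z / (z + 1)) ^ k * (2 * d_fun (z + 1) / (Gamma z * (1 - z))) * second_const z)\<bar>
      \<le> C * ((z / 2) ^ k * real k powr (2 - z))"
proof -
  obtain A :: real where A: "A > 0"
    "\<And>k z. k \<ge> 1 \<Longrightarrow> 0 < z \<Longrightarrow> z < 2 \<Longrightarrow>
      \<bar>erdos_gamma k z - G_fun z - (z / 2) ^ k / Gamma z * second_term k z\<bar>
       \<le> A / (2 - z)\<^sup>2 * ((z / 2) ^ k * real k powr (2 - z))"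
    using erdos_gamma_first_term by blast
  obtain B :: real where B: "B > 0"
    "\<And>k z. k \<ge> 1 \<Longrightarrow> 0 < z \<Longrightarrow> z < 1 \<Longrightarrow>
      \<bar>second_term k z - (2 / (z + 1)) ^ k * (2 * d_fun (z + 1) / (1 - z) * second_const z)\<bar>
        \<le> B / (1 - z)\<^sup>2 * real k powr (2 - z)"
    using second_term_lt_1 by blast
  obtain c :: real where c: "c > 0" "\<And>z. 0 < z \<Longrightarrow> z \<le> 2 \<Longrightarrow> 1 / Gamma z \<le> c"
    using inverse_Gamma_le by blast
  have "\<bar>erdos_gamma k z - (G_fun z + (z / (z + 1)) ^ k * (2 * d_fun (z + 1) / (Gamma z * (1 - z))) * second_const z)\<bar>
      \<le> (A + c * (B / \<epsilon>\<^sup>2)) * ((z / 2) ^ k * real k powr (2 - z))"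
    if k: "k \<ge> 1" and z: "z \<in> {\<epsilon>..1 - \<epsilon>}" for k z
  proof -
    have z0: "0 < z" "z < 1" "z < 2" "z \<le> 2" using z eps by auto
    define W where "W = (z / 2) ^ k / Gamma z"
    define X where "X = (2 / (z + 1)) ^ k * (2 * d_fun (z + 1) / (1 - z) * second_const z)"
    define P where "P = (z / 2) ^ k * real k powr (2 - z)"
    have P0: "P \<ge> 0" using z0 by (simp add: P_def)
    have "(z / 2) ^ k * (2 / (z + 1)) ^ k = (z / (z + 1)) ^ k"
      by (simp flip: power_mult_distrib)
    hence WX: "W * X = (z / (z + 1)) ^ k * (2 * d_fun (z + 1) / (Gamma z * (1 - z))) * second_const z"
      by (simp add: W_def X_def mult_ac flip: power_mult_distrib)
    have 1: "\<bar>erdos_gamma k z - G_fun z - W * second_term k z\<bar> \<le> A * P"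
    proof -
      have "1\<^sup>2 \<le> (2 - z)\<^sup>2" using z0 by (intro power_mono) auto
      hence "A / (2 - z)\<^sup>2 \<le> A / 1" using A(1) by (intro divide_left_mono) auto
      hence "A / (2 - z)\<^sup>2 * P \<le> A * P" using P0 by (intro mult_right_mono) auto
      thus ?thesis using A(2)[OF k z0(1,3)] unfolding W_def P_def by linarith
    qed
    have 2: "\<bar>W * (second_term k z - X)\<bar> \<le> c * (B / \<epsilon>\<^sup>2) * P"
    proof -
      have "\<epsilon>\<^sup>2 \<le> (1 - z)\<^sup>2" using z eps by (intro power_mono) auto
      hence "B / (1 - z)\<^sup>2 \<le> B / \<epsilon>\<^sup>2" using B(1) eps z0 by (intro divide_left_mono) auto
      hence "B / (1 - z)\<^sup>2 * real k powr (2 - z) \<le> B / \<epsilon>\<^sup>2 * real k powr (2 - z)" by (intro mult_right_mono) auto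
      hence "\<bar>second_term k z - X\<bar> \<le> B / \<epsilon>\<^sup>2 * real k powr (2 - z)"
        using B(2)[OF k z0(1,2)] unfolding X_def by linarith
      from times_inverse_Gamma_le[OF c z0(1,4) this, of k]
      show ?thesis by (simp add: W_def P_def mult_ac)
    qed
    have "\<bar>g - (G + W * X)\<bar> \<le> (A + K) * P" if "\<bar>g - G - W * s\<bar> \<le> A * P" "\<bar>W * (s - X)\<bar> \<le> K * P" for g G s K
      using that unfolding right_diff_distrib distrib_right by linarith
    from this[OF 1 2] show ?thesis unfolding WX P_def .
  qed
  thus ?thesis by blast
qed

lemma erdos_gamma_gt_1:
  fixes \<epsilon> :: real
  assumes eps: "\<epsilon> > 0"
  shows "\<exists>C. \<forall>k\<ge>1. \<forall>z\<in>{1 + \<epsilon>..2 - \<epsilon>}.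
    \<bar>erdos_gamma k z - G_fun z\<bar> \<le> C * ((z / 2) ^ k * real k powr (2 - z))"
proof -
  obtain A :: real where A: "A > 0"
    "\<And>k z. k \<ge> 1 \<Longrightarrow> 0 < z \<Longrightarrow> z < 2 \<Longrightarrow>
      \<bar>erdos_gamma k z - G_fun z - (z / 2) ^ k / Gamma z * second_term k z\<bar>
       \<le> A / (2 - z)\<^sup>2 * ((z / 2) ^ k * real k powr (2 - z))"
    using erdos_gamma_first_term by blast
  obtain B :: real where B: "B > 0"
    "\<And>k z. k \<ge> 1 \<Longrightarrow> 1 < z \<Longrightarrow> z \<le> 2 \<Longrightarrow> \<bar>second_term k z\<bar> \<le> B / (z - 1) * real k powr (2 - z)"
    using second_term_bounds by metis
  obtain c :: real where c: "c > 0" "\<And>z. 0 < z \<Longrightarrow> z \<le> 2 \<Longrightarrow> 1 / Gamma z \<le> c"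
    using inverse_Gamma_le by blast
  have "\<bar>erdos_gamma k z - G_fun z\<bar> \<le> (A / \<epsilon>\<^sup>2 + c * (B / \<epsilon>)) * ((z / 2) ^ k * real k powr (2 - z))"
    if k: "k \<ge> 1" and z: "z \<in> {1 + \<epsilon>..2 - \<epsilon>}" for k z
  proof -
    have z0: "0 < z" "1 < z" "z < 2" "z \<le> 2" using z eps by auto
    define P where "P = (z / 2) ^ k * real k powr (2 - z)"
    have P0: "P \<ge> 0" using z0 by (simp add: P_def)
    have 1: "\<bar>erdos_gamma k z - G_fun z - (z / 2) ^ k / Gamma z * second_term k z\<bar> \<le> A / \<epsilon>\<^sup>2 * P"
    proof -
      have "\<epsilon>\<^sup>2 \<le> (2 - z)\<^sup>2" using z eps by (intro power_mono) auto
      hence "A / (2 - z)\<^sup>2 \<le> A / \<epsilon>\<^sup>2" using A(1) eps z0 by (intro divide_left_mono) auto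
      hence "A / (2 - z)\<^sup>2 * P \<le> A / \<epsilon>\<^sup>2 * P" using P0 by (intro mult_right_mono) auto
      thus ?thesis using A(2)[OF k z0(1,3)] unfolding P_def by linarith
    qed
    have 2: "\<bar>(z / 2) ^ k / Gamma z * second_term k z\<bar> \<le> c * (B / \<epsilon>) * P"
    proof -
      have "B / (z - 1) \<le> B / \<epsilon>" using B(1) eps z by (intro divide_left_mono) auto
      hence "B / (z - 1) * real k powr (2 - z) \<le> B / \<epsilon> * real k powr (2 - z)" by (intro mult_right_mono) auto
      hence "\<bar>second_term k z\<bar> \<le> B / \<epsilon> * real k powr (2 - z)"
        using B(2)[OF k z0(2,4)] by linarith
      from times_inverse_Gamma_le[OF c z0(1,4) this, of k]
      show ?thesis by (simp add: P_def mult_ac)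
    qed
    show ?thesis using 1 2 unfolding P_def[symmetric] distrib_right by linarith
  qed
  thus ?thesis by blast
qed

text \<open>The second term is bounded separately on either side of (3 - \<epsilon>)/2, the midpoint
  between 1 and 2 - \<epsilon>. Above it z - 1 \<ge> (1 - \<epsilon>)/2 and the sharp bound applies;
  below it the crude bound has an exponential base smaller than 1 - \<epsilon>/2.\<close>

lemma erdos_gamma_uniform:
  fixes \<epsilon> :: real
  assumes eps: "0 < \<epsilon>" "\<epsilon> < 1"
  shows "\<exists>C. \<forall>k\<ge>1. \<forall>z\<in>{0<..2 - \<epsilon>}.
    \<bar>erdos_gamma k z - G_fun z\<bar> \<le> C * ((1 - \<epsilon> / 2) ^ k * real k powr \<epsilon>)"
proof -
  obtain A :: real where A: "A > 0"
    "\<And>k z. k \<ge> 1 \<Longrightarrow> 0 < z \<Longrightarrow> z < 2 \<Longrightarrow>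
      \<bar>erdos_gamma k z - G_fun z - (z / 2) ^ k / Gamma z * second_term k z\<bar>
       \<le> A / (2 - z)\<^sup>2 * ((z / 2) ^ k * real k powr (2 - z))"
    using erdos_gamma_first_term by blast
  obtain B :: real where B: "B > 0"
    "\<And>k z. k \<ge> 1 \<Longrightarrow> 1 < z \<Longrightarrow> z \<le> 2 \<Longrightarrow> \<bar>second_term k z\<bar> \<le> B / (z - 1) * real k powr (2 - z)"
    "\<And>k z. k \<ge> 1 \<Longrightarrow> 0 < z \<Longrightarrow> z \<le> 2 \<Longrightarrow>
       \<bar>second_term k z\<bar> \<le> B * real k powr (2 - z) * real k * max 1 (2 / (z + 1)) ^ k"
    using second_term_bounds by blast
  obtain c :: real where c: "c > 0" "\<And>z. 0 < z \<Longrightarrow> z \<le> 2 \<Longrightarrow> 1 / Gamma z \<le> c"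
    using inverse_Gamma_le by blast
  define \<kappa> where "\<kappa> = 1 - \<epsilon> / 2"
  \<comment> \<open>Half of the splitting point (3 - \<epsilon>)/2. As \<epsilon> < 1 it lies
    strictly below \<kappa>, so the powers of \<rho>/\<kappa> absorb k^3.\<close>
  define \<rho> where "\<rho> = (3 - \<epsilon>) / 4"
  have kr: "0 < \<rho>" "\<rho> < \<kappa>" "0 < \<kappa>" "1 / 2 \<le> \<rho>" using eps by (auto simp: \<kappa>_def \<rho>_def)
  obtain M where M: "\<And>k :: nat. real k ^ 3 * (\<rho> / \<kappa>) ^ k \<le> M"
    using cube_times_geometric_bounded[of "\<rho> / \<kappa>"] kr by auto
  have M0: "M \<ge> 0" using M[of 0] by simp
  define C where "C = A / \<epsilon>\<^sup>2 + c * (B * (2 / (1 - \<epsilon>))) + c * (B * M)"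
  have "\<bar>erdos_gamma k z - G_fun z\<bar> \<le> C * ((1 - \<epsilon> / 2) ^ k * real k powr \<epsilon>)"
    if k: "k \<ge> 1" and z: "z \<in> {0<..2 - \<epsilon>}" for k z
  proof -
    have z0: "0 < z" "z < 2" "z \<le> 2" "z \<le> 2 - \<epsilon>" using z eps by auto
    define P where "P = (z / 2) ^ k * real k powr (2 - z)"
    define Q where "Q = \<kappa> ^ k * real k powr \<epsilon>"
    have P0: "P \<ge> 0" using z0 by (simp add: P_def)
    have Q0: "Q \<ge> 0" using kr by (simp add: Q_def)
    have PQ: "P \<le> Q" unfolding P_def Q_def \<kappa>_def by (rule error_term_mono[OF k z0(1,4) eps])
    have 1: "\<bar>erdos_gamma k z - G_fun z - (z / 2) ^ k / Gamma z * second_term k z\<bar> \<le> A / \<epsilon>\<^sup>2 * Q"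
    proof -
      have "\<epsilon>\<^sup>2 \<le> (2 - z)\<^sup>2" using z eps by (intro power_mono) auto
      hence "A / (2 - z)\<^sup>2 \<le> A / \<epsilon>\<^sup>2" using A(1) eps z0 by (intro divide_left_mono) auto
      hence "A / (2 - z)\<^sup>2 * P \<le> A / \<epsilon>\<^sup>2 * Q" using P0 PQ A(1) by (intro mult_mono) auto
      thus ?thesis using A(2)[OF k z0(1,2)] unfolding P_def by linarith
    qed
    have 2: "\<bar>(z / 2) ^ k / Gamma z * second_term k z\<bar> \<le> (c * (B * (2 / (1 - \<epsilon>))) + c * (B * M)) * Q"
    proof (cases "z \<le> (3 - \<epsilon>) / 2")
      case True
      \<comment> \<open>For z \<le> 1 the base is z/(z + 1) \<le> 1/2, for larger z it is
        z/2.\<close>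
      have le: "z / 2 * max 1 (2 / (z + 1)) \<le> \<rho>"
      proof (cases "z \<le> 1")
        case t: True
        hence "max 1 (2 / (z + 1)) = 2 / (z + 1)" using z0 by (simp add: max_def)
        moreover have "z / (z + 1) \<le> 1 / 2" using t z0 by (simp add: divide_simps)
        moreover have "z / 2 * (2 / (z + 1)) = z / (z + 1)" by simp
        ultimately show ?thesis using kr(4) by linarith
      next
        case False
        hence "max 1 (2 / (z + 1)) = 1" using z0 by (simp add: max_def)
        thus ?thesis using True by (simp add: \<rho>_def)
      qed
      have "\<bar>(z / 2) ^ k / Gamma z * second_term k z\<bar> \<le>
         c * ((z / 2) ^ k * (B * real k powr (2 - z) * real k * max 1 (2 / (z + 1)) ^ k))"
        by (rule times_inverse_Gamma_le[OF c z0(1,3) B(3)[OF k z0(1,3)]])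
      also have "\<dots> = c * B * (real k powr (2 - z) * real k * (z / 2 * max 1 (2 / (z + 1))) ^ k)"
        unfolding power_mult_distrib by (simp only: mult_ac)
      also have "\<dots> \<le> c * B * (real k ^ 3 * \<rho> ^ k)"
      proof (intro mult_left_mono mult_mono)
        have "real k powr (2 - z) \<le> real k powr 2" using k z0 by (intro powr_mono) auto
        hence "real k powr (2 - z) * real k \<le> (real k)\<^sup>2 * real k" using k by (intro mult_right_mono) auto
        thus "real k powr (2 - z) * real k \<le> real k ^ 3" by (simp add: power2_eq_square power3_eq_cube)
        show "(z / 2 * max 1 (2 / (z + 1))) ^ k \<le> \<rho> ^ k" using le z0 by (intro power_mono) auto
      qed (use c B z0 in \<open>auto simp: le_max_iff_disj\<close>)
      also have "real k ^ 3 * \<rho> ^ k = (real k ^ 3 * (\<rho> / \<kappa>) ^ k) * \<kappa> ^ k"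
        using kr by (simp add: power_divide)
      also have "c * B * ((real k ^ 3 * (\<rho> / \<kappa>) ^ k) * \<kappa> ^ k) \<le> c * B * (M * Q)"
      proof (intro mult_left_mono mult_mono M)
        have "1 \<le> real k powr \<epsilon>" using k eps by (intro ge_one_powr_ge_zero) auto
        hence "\<kappa> ^ k * 1 \<le> \<kappa> ^ k * real k powr \<epsilon>" using kr by (intro mult_left_mono) auto
        thus "\<kappa> ^ k \<le> Q" by (simp add: Q_def)
      qed (use c B M0 kr in auto)
      finally have "\<bar>(z / 2) ^ k / Gamma z * second_term k z\<bar> \<le> c * (B * M) * Q" by (simp add: mult_ac)
      moreover have "0 \<le> c * (B * (2 / (1 - \<epsilon>))) * Q" using c(1) B(1) eps Q0 by simp
      ultimately show ?thesis unfolding distrib_right by linarith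
    next
      case False
      hence z1: "1 < z" "(1 - \<epsilon>) / 2 \<le> z - 1" using eps by (auto simp: field_simps)
      have "B / (z - 1) \<le> B / ((1 - \<epsilon>) / 2)" using B(1) eps z1 by (intro divide_left_mono) auto
      hence "B / (z - 1) * real k powr (2 - z) \<le> B / ((1 - \<epsilon>) / 2) * real k powr (2 - z)" by (intro mult_right_mono) auto
      hence "\<bar>second_term k z\<bar> \<le> B * (2 / (1 - \<epsilon>)) * real k powr (2 - z)"
        using B(2)[OF k z1(1) z0(3)] by simp
      from times_inverse_Gamma_le[OF c z0(1,3) this, of k]
      have "\<bar>(z / 2) ^ k / Gamma z * second_term k z\<bar> \<le> c * (B * (2 / (1 - \<epsilon>))) * P"
        by (simp add: P_def mult_ac)
      also have "\<dots> \<le> c * (B * (2 / (1 - \<epsilon>))) * Q"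
        using PQ c(1) B(1) eps by (intro mult_left_mono) auto
      finally have "\<bar>(z / 2) ^ k / Gamma z * second_term k z\<bar> \<le> c * (B * (2 / (1 - \<epsilon>))) * Q" .
      moreover have "0 \<le> c * (B * M) * Q" using c(1) B(1) M0 Q0 by simp
      ultimately show ?thesis unfolding distrib_right by linarith
    qed
    have "\<bar>erdos_gamma k z - G_fun z\<bar> \<le> C * Q"
      using 1 2 unfolding C_def distrib_right by linarith
    thus ?thesis by (simp add: Q_def \<kappa>_def)
  qed
  thus ?thesis by blast
qed

section \<open>The expansions at z = 1 and z = 2 in big-O form\<close>

lemma erdos_gamma_1_asymp:
  "\<exists>E::nat \<Rightarrow> real. E \<in> O(\<lambda>k. real k * sqrt (ln (real k))) \<and>
     (\<forall>\<^sub>F k in sequentially. erdos_gamma k 1 =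
       1 - (1 / 2 ^ k) * (d_fun 2 / 4) * ln 2 * ((real k)\<^sup>2 - 4 * real k * ln (real k) + E k))"
proof -
  obtain C :: real where C: "C > 0"
    "\<And>k. k \<ge> 1 \<Longrightarrow> \<bar>2 ^ k * (1 - erdos_gamma k 1) -
        d_fun 2 / 4 * ln 2 * ((real k)\<^sup>2 - 4 * real k * ln (real k))\<bar> \<le> C * real k"
    using erdos_gamma_at_1 by blast
  define e where "e = d_fun 2 / 4 * ln 2"
  have e: "e > 0" using d_fun_pos[of 2] by (simp add: e_def)
  \<comment> \<open>E is obtained by solving the claimed identity, which is possible because
    \<open>d_fun 2\<close> is positive.\<close>
  define E where "E k = (2 ^ k * (1 - erdos_gamma k 1) - e * ((real k)\<^sup>2 - 4 * real k * ln (real k))) / e" for k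
  have "E \<in> O(\<lambda>k. real k * sqrt (ln (real k)))"
  proof (rule bigo_sqrt_ln[where C = "C / e"])
    show "\<bar>E k\<bar> \<le> C / e * real k" if "k \<ge> 1" for k
    proof -
      have "\<bar>E k\<bar> = \<bar>2 ^ k * (1 - erdos_gamma k 1) - e * ((real k)\<^sup>2 - 4 * real k * ln (real k))\<bar> / e"
        using e by (simp only: E_def abs_divide abs_of_pos)
      also have "\<dots> \<le> C * real k / e"
        using C(2)[OF that] e unfolding e_def by (intro divide_right_mono) auto
      finally show ?thesis by simp
    qed
  qed (use C e in auto)
  moreover have "erdos_gamma k 1 = 1 - (1 / 2 ^ k) * (d_fun 2 / 4) * ln 2 * ((real k)\<^sup>2 - 4 * real k * ln (real k) + E k)" for k
  proof -
    have "e * ((real k)\<^sup>2 - 4 * real k * ln (real k) + E k) = 2 ^ k * (1 - erdos_gamma k 1)"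
      using e by (simp add: E_def distrib_left)
    hence "(1 / 2 ^ k) * (e * ((real k)\<^sup>2 - 4 * real k * ln (real k) + E k)) = 1 - erdos_gamma k 1" by simp
    thus ?thesis unfolding e_def by (simp only: mult.assoc)
  qed
  ultimately show ?thesis by (intro exI[of _ E] conjI always_eventually) auto
qed

lemma erdos_gamma_2_asymp:
  "\<exists>E::nat \<Rightarrow> real. E \<in> O(\<lambda>k. sqrt (ln (real k))) \<and>
     (\<forall>\<^sub>F k in sequentially. erdos_gamma k 2 = d_fun 2 / 2 * (real k - 2 * ln (real k) + E k))"
proof -
  obtain C :: real where C: "C > 0"
    "\<And>k. k \<ge> 1 \<Longrightarrow> \<bar>erdos_gamma k 2 - d_fun 2 / 2 * (real k - 2 * ln (real k))\<bar> \<le> C"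
    using erdos_gamma_at_2 by blast
  define d where "d = d_fun 2 / 2"
  have d: "d > 0" using d_fun_pos[of 2] by (simp add: d_def)
  define E where "E k = (erdos_gamma k 2 - d * (real k - 2 * ln (real k))) / d" for k
  have "E \<in> O(\<lambda>k. 1 * sqrt (ln (real k)))"
  proof (rule bigo_sqrt_ln[where C = "C / d"])
    show "\<bar>E k\<bar> \<le> C / d * 1" if "k \<ge> 1" for k
    proof -
      have "\<bar>E k\<bar> = \<bar>erdos_gamma k 2 - d * (real k - 2 * ln (real k))\<bar> / d"
        using d by (simp only: E_def abs_divide abs_of_pos)
      also have "\<dots> \<le> C / d"
        using C(2)[OF that] d unfolding d_def by (intro divide_right_mono) auto
      finally show ?thesis by simp
    qed
  qed (use C d in auto)
  moreover have "erdos_gamma k 2 = d * (real k - 2 * ln (real k) + E k)" for k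
    using d by (simp add: E_def distrib_left)
  ultimately show ?thesis unfolding d_def by (intro exI[of _ E] conjI always_eventually) auto
qed

theorem theorem2:
  shows
    "(\<forall>\<epsilon>::real. \<epsilon> > 0 \<longrightarrow> (\<exists>C::real. \<forall>\<^sub>F k::nat in sequentially. \<forall>z\<in>{\<epsilon>..1 - \<epsilon>}.
        \<bar>erdos_gamma k z -
           (G_fun z + (z / (z + 1)) ^ k * (2 * d_fun (z + 1) / (Gamma z * (1 - z))) *
              (euler_mascheroni - z * ln 2 / (1 - z) -
                (\<Sum>\<^sub>\<infinity>p\<in>{p::nat. prime p \<and> p > 2}.
                   z * ln (real p) / ((real p - 1) * (real p - z - 1)))))\<bar>
        \<le> C * ((z / 2) ^ k * real k powr (2 - z))))
   \<and> (\<exists>E::nat \<Rightarrow> real. E \<in> O(\<lambda>k. real k * sqrt (ln (real k))) \<and>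
        (\<forall>\<^sub>F k in sequentially. erdos_gamma k 1 =
           1 - (1 / 2 ^ k) * (d_fun 2 / 4) * ln 2 *
             ((real k)\<^sup>2 - 4 * real k * ln (real k) + E k)))
   \<and> (\<forall>\<epsilon>::real. \<epsilon> > 0 \<longrightarrow> (\<exists>C::real. \<forall>\<^sub>F k::nat in sequentially. \<forall>z\<in>{1 + \<epsilon>..2 - \<epsilon>}.
        \<bar>erdos_gamma k z - G_fun z\<bar> \<le> C * ((z / 2) ^ k * real k powr (2 - z))))
   \<and> (\<exists>E::nat \<Rightarrow> real. E \<in> O(\<lambda>k. sqrt (ln (real k))) \<and>
        (\<forall>\<^sub>F k in sequentially. erdos_gamma k 2 =
           d_fun 2 / 2 * (real k - 2 * ln (real k) + E k)))
   \<and> (\<forall>\<epsilon>::real. 0 < \<epsilon> \<and> \<epsilon> < 1 \<longrightarrow> (\<exists>C::real. \<forall>k::nat. k \<ge> 1 \<longrightarrow> (\<forall>z\<in>{0<..2 - \<epsilon>}.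
        \<bar>erdos_gamma k z - G_fun z\<bar> \<le> C * ((1 - \<epsilon> / 2) ^ k * real k powr \<epsilon>))))"
proof (intro conjI allI impI)
  have ev: "\<exists>C. \<forall>\<^sub>F k in sequentially. P C k" if "\<exists>C. \<forall>k\<ge>1. P C k" for P :: "real \<Rightarrow> nat \<Rightarrow> bool"
    using that unfolding eventually_sequentially by blast
  fix \<epsilon> :: real assume "\<epsilon> > 0"
  show "\<exists>C::real. \<forall>\<^sub>F k::nat in sequentially. \<forall>z\<in>{\<epsilon>..1 - \<epsilon>}.
        \<bar>erdos_gamma k z -
           (G_fun z + (z / (z + 1)) ^ k * (2 * d_fun (z + 1) / (Gamma z * (1 - z))) *
              (euler_mascheroni - z * ln 2 / (1 - z) -
                (\<Sum>\<^sub>\<infinity>p\<in>{p::nat. prime p \<and> p > 2}.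
                   z * ln (real p) / ((real p - 1) * (real p - z - 1)))))\<bar>
        \<le> C * ((z / 2) ^ k * real k powr (2 - z))"
    by (rule ev[OF erdos_gamma_lt_1[OF \<open>\<epsilon> > 0\<close>, unfolded second_const_def]])
  show "\<exists>C::real. \<forall>\<^sub>F k::nat in sequentially. \<forall>z\<in>{1 + \<epsilon>..2 - \<epsilon>}.
        \<bar>erdos_gamma k z - G_fun z\<bar> \<le> C * ((z / 2) ^ k * real k powr (2 - z))"
    by (rule ev[OF erdos_gamma_gt_1[OF \<open>\<epsilon> > 0\<close>]])
next
  fix \<epsilon> :: real assume "0 < \<epsilon> \<and> \<epsilon> < 1"
  thus "\<exists>C::real. \<forall>k::nat. k \<ge> 1 \<longrightarrow> (\<forall>z\<in>{0<..2 - \<epsilon>}.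
        \<bar>erdos_gamma k z - G_fun z\<bar> \<le> C * ((1 - \<epsilon> / 2) ^ k * real k powr \<epsilon>))"
    using erdos_gamma_uniform by blast
qed (rule erdos_gamma_1_asymp erdos_gamma_2_asymp)+

end
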